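(* Let $d\ge 1$, let $\Lambda_\Phi\subset[0,1]^d$ be a self-affine sponge, where $\Phi=(\phi_{\mathbf{a}})_{\mathbf{a}\in E}$, and let $\mathbf{p}$ be an irreducible good probability measure on $E$ with distinct Lyapunov exponents. Then $$\dim_H(\Lambda_\Phi\cap \mathrm{BA}_d)\ \ge\ \dim_H(\nu_{\mathbf{p}}).$$ In particular, if $\dim_H(\nu_{\mathbf{p}})=\dim_H(\Lambda_\Phi)$, then $\dim_H(\Lambda_\Phi\cap \mathrm{BA}_d)=\dim_H(\Lambda_\Phi)$.
   Context: $\dim_H$ denotes Hausdorff dimension; the Hausdorff dimension of a measure is the infimum of the Hausdorff dimensions of sets of full measure. $\mathrm{BA}_d$ is the set of badly approximable points of $\mathbb{R}^d$: those $\mathbf{x}\in\mathbb{R}^d$ for which there is $c>0$ with $\|\mathbf{x}-\mathbf{r}/q\|\ge c\,q^{-(1+1/d)}$ for all $\mathbf{r}\in\mathbb{Z}^d$ and all integers $q\ge 1$. Diagonal IFS and self-affine sponge. Let $D=\{1,\ldots,d\}$. For each $i\in D$ let $A_i$ be a finite index set and $\Phi_i=(\phi_{i,a})_{a\in A_i}$ a finite collection of contracting similarities $[0,1]\to[0,1]$ (the base IFS in coordinate $i$). Let $A=\prod_{i\in D}A_i$, and for $\mathbf{a}=(a_1,\ldots,a_d)\in A$ let $\phi_{\mathbf{a}}(x_1,\ldots,x_d)=(\phi_{\mathbf{a},1}(x_1),\ldots,\phi_{\mathbf{a},d}(x_d))$, where $\phi_{\mathbf{a},i}:=\phi_{i,a_i}$.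 The constant $|\phi_{\mathbf{a},i}'|\in(0,1)$ is the contraction ratio of $\phi_{\mathbf{a},i}$. For nonempty $E\subset A$ the collection $\Phi=(\phi_{\mathbf{a}})_{\mathbf{a}\in E}$ is called a diagonal IFS. Its coding map is $\pi:E^{\mathbb{N}}\to[0,1]^d$, $\pi(\omega)=\lim_{n\to\infty}\phi_{\omega_1}\circ\cdots\circ\phi_{\omega_n}(\mathbf{0})$, and its limit set $\Lambda_\Phi=\pi(E^{\mathbb{N}})$ is called a self-affine sponge. Let $\mathbf{p}$ be a probability measure on $E$. The Bernoulli measure $\nu_{\mathbf{p}}=\pi_*[\mathbf{p}^{\mathbb{N}}]$ is the pushforward of the product measure $\mathbf{p}^{\mathbb{N}}$ under $\pi$. The Lyapunov exponent of $\mathbf{p}$ in coordinate $i\in D$ is $\chi_i(\mathbf{p})=-\int\log|\phi_{\mathbf{a},i}'|\,d\mathbf{p}(\mathbf{a})$. The measure $\mathbf{p}$ has distinct Lyapunov exponents if the numbers $\chi_i(\mathbf{p})$ ($i\in D$) are all distinct. Write $i\prec_{\mathbf{p}}j$ (equivalently $j\succ_{\mathbf{p}}i$) if $\chi_i(\mathbf{p})\le\chi_j(\mathbf{p})$. The measure $\mathbf{p}$ is irreducible if for every $i\in D$ there exist $\mathbf{a},\mathbf{b}\in E$ such that $a_i\ne b_i$ and $\{j\in D:a_j\ne b_j\}\subset\{j\in D: j\succ_{\mathbf{p}}i\}$. For $I\subset D$ let $\pi_I:A\to\prod_{i\in I}A_i$ be the projection, and for $\mathbf{a}\in\pi_I(E)$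 let $\phi_{I,\mathbf{a}}:[0,1]^I\to[0,1]^I$, $\phi_{I,\mathbf{a}}(\mathbf{x})=(\phi_{i,a_i}(x_i))_{i\in I}$. The set $I$ is good if the sets $\phi_{I,\mathbf{a}}((0,1)^I)$, $\mathbf{a}\in\pi_I(E)$, are pairwise disjoint. The measure $\mathbf{p}$ is good if for every $x>0$ the set $I(\mathbf{p},x)=\{i\in D:\chi_i(\mathbf{p})\le x\}$ is good. *)

theory Defs
  imports "HOL-Probability.Probability"
begin

section \<open>Hausdorff dimension\<close>

text \<open>The \<open>s\<close>-th power of the diameter, with the usual conventions that the empty set contributes
  \<open>0\<close> and a nonempty set contributes \<open>1\<close> when \<open>s = 0\<close> (whereas \<open>0 powr 0 = 0\<close>).\<close>

definition diam_pow :: "real \<Rightarrow> 'a::metric_space set \<Rightarrow> ennreal" where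
  "diam_pow s U =
     (if U = {} then 0 else if s = 0 then 1 else ennreal (diameter U powr s))"

text \<open>The boundedness condition excludes sets of infinite diameter, on which the real-valued
  \<open>diameter\<close> is meaningless.\<close>

definition hausdorff_premeasure ::
  "real \<Rightarrow> real \<Rightarrow> 'a::metric_space set \<Rightarrow> ennreal" where
  "hausdorff_premeasure s \<delta> S =
     (INF U \<in> {U :: nat \<Rightarrow> 'a set.
                 S \<subseteq> (\<Union>n. U n) \<and> (\<forall>n. bounded (U n) \<and> diameter (U n) \<le> \<delta>)}.
        \<Sum>n. diam_pow s (U n))"

definition hausdorff_measure :: "real \<Rightarrow> 'a::metric_space set \<Rightarrow> ennreal" where
  "hausdorff_measure s S = (SUP \<delta> \<in> {0<..}. hausdorff_premeasure s \<delta> S)"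

definition hausdorff_dim :: "'a::metric_space set \<Rightarrow> ennreal" where
  "hausdorff_dim S = (INF s \<in> {s::real. 0 \<le> s \<and> hausdorff_measure s S = 0}. ennreal s)"

definition hausdorff_dim_measure :: "'a::metric_space measure \<Rightarrow> ennreal" where
  "hausdorff_dim_measure \<mu> =
     (INF S \<in> {S \<in> sets \<mu>. emeasure \<mu> (space \<mu> - S) = 0}. hausdorff_dim S)"

section \<open>Badly approximable points\<close>

definition badly_approximable :: "(real ^ 'd::finite) set" where
  "badly_approximable =
     {x. \<exists>c>0. \<forall>(r :: int ^ 'd) (q :: nat). 1 \<le> q \<longrightarrow>
           c * real q powr (- (1 + 1 / real CARD('d)))
             \<le> norm (x - (\<chi> i. real_of_int (r $ i) / real q))}"

section \<open>Diagonal IFS and self-affine sponges\<close>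

text \<open>The coordinates are indexed by a finite type \<open>'d\<close>. The alphabet of coordinate \<open>i\<close> is a finite
  set \<open>A i\<close>, all inside one type \<open>'a\<close>, and a letter of the product alphabet is a function
  \<open>a :: 'd \<Rightarrow> 'a\<close>. The map \<open>\<phi> i b\<close> is regarded as a self-map of \<open>[0,1]\<close> only; its values
  outside the unit interval are irrelevant.\<close>

definition contracting_similarity :: "(real \<Rightarrow> real) \<Rightarrow> bool" where
  "contracting_similarity f \<longleftrightarrow>
     f ` {0..1} \<subseteq> {0..1} \<and>
     (\<exists>\<rho>. 0 < \<rho> \<and> \<rho> < 1 \<and> (\<forall>x\<in>{0..1}. \<forall>y\<in>{0..1}. \<bar>f x - f y\<bar> = \<rho> * \<bar>x - y\<bar>))"

definition contraction_ratio :: "(real \<Rightarrow> real) \<Rightarrow> real" where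
  "contraction_ratio f =
     (THE \<rho>. \<forall>x\<in>{0..1}. \<forall>y\<in>{0..1}. \<bar>f x - f y\<bar> = \<rho> * \<bar>x - y\<bar>)"

definition diagonal_IFS ::
  "('d::finite \<Rightarrow> 'a set) \<Rightarrow> ('d \<Rightarrow> 'a \<Rightarrow> real \<Rightarrow> real) \<Rightarrow> ('d \<Rightarrow> 'a) set \<Rightarrow> bool" where
  "diagonal_IFS A \<phi> E \<longleftrightarrow>
     (\<forall>i. finite (A i)) \<and>
     (\<forall>i. \<forall>b\<in>A i. contracting_similarity (\<phi> i b)) \<and>
     E \<noteq> {} \<and> E \<subseteq> (\<Pi>\<^sub>E i\<in>UNIV. A i)"

definition diag_map ::
  "('d::finite \<Rightarrow> 'a \<Rightarrow> real \<Rightarrow> real) \<Rightarrow> ('d \<Rightarrow> 'a) \<Rightarrow> real ^ 'd \<Rightarrow> real ^ 'd" where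
  "diag_map \<phi> a x = (\<chi> i. \<phi> i (a i) (x $ i))"

primrec word_map ::
  "('d::finite \<Rightarrow> 'a \<Rightarrow> real \<Rightarrow> real) \<Rightarrow> (nat \<Rightarrow> 'd \<Rightarrow> 'a) \<Rightarrow> nat \<Rightarrow> real ^ 'd \<Rightarrow> real ^ 'd" where
  "word_map \<phi> \<omega> 0 = id"
| "word_map \<phi> \<omega> (Suc n) = word_map \<phi> \<omega> n \<circ> diag_map \<phi> (\<omega> n)"

definition coding_map ::
  "('d::finite \<Rightarrow> 'a \<Rightarrow> real \<Rightarrow> real) \<Rightarrow> (nat \<Rightarrow> 'd \<Rightarrow> 'a) \<Rightarrow> real ^ 'd" where
  "coding_map \<phi> \<omega> = lim (\<lambda>n. word_map \<phi> \<omega> n 0)"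

definition sponge ::
  "('d::finite \<Rightarrow> 'a \<Rightarrow> real \<Rightarrow> real) \<Rightarrow> ('d \<Rightarrow> 'a) set \<Rightarrow> (real ^ 'd) set" where
  "sponge \<phi> E = coding_map \<phi> ` (UNIV \<rightarrow> E)"

section \<open>Bernoulli measures\<close>

definition prob_measure_on :: "'b set \<Rightarrow> 'b measure \<Rightarrow> bool" where
  "prob_measure_on E p \<longleftrightarrow> prob_space p \<and> space p = E \<and> sets p = Pow E"

text \<open>If \<open>space p = E\<close>, then the product measure below lives on exactly the sequences with values
  in \<open>E\<close>; nothing outside the symbolic space is involved.\<close>

definition bernoulli_measure ::
  "('d::finite \<Rightarrow> 'a \<Rightarrow> real \<Rightarrow> real) \<Rightarrow> ('d \<Rightarrow> 'a) measure \<Rightarrow> (real ^ 'd) measure" where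
  "bernoulli_measure \<phi> p = distr (\<Pi>\<^sub>M n\<in>(UNIV :: nat set). p) borel (coding_map \<phi>)"

definition lyapunov ::
  "('d \<Rightarrow> 'a \<Rightarrow> real \<Rightarrow> real) \<Rightarrow> ('d \<Rightarrow> 'a) measure \<Rightarrow> 'd \<Rightarrow> real" where
  "lyapunov \<phi> p i = - (\<integral>a. ln (contraction_ratio (\<phi> i (a i))) \<partial>p)"

definition distinct_lyapunov ::
  "('d \<Rightarrow> 'a \<Rightarrow> real \<Rightarrow> real) \<Rightarrow> ('d \<Rightarrow> 'a) measure \<Rightarrow> bool" where
  "distinct_lyapunov \<phi> p \<longleftrightarrow> inj (lyapunov \<phi> p)"

definition lyapunov_prec ::
  "('d \<Rightarrow> 'a \<Rightarrow> real \<Rightarrow> real) \<Rightarrow> ('d \<Rightarrow> 'a) measure \<Rightarrow> 'd \<Rightarrow> 'd \<Rightarrow> bool" where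
  "lyapunov_prec \<phi> p i j \<longleftrightarrow> lyapunov \<phi> p i \<le> lyapunov \<phi> p j"

text \<open>Irreducibility refers to all letters of \<open>E\<close>, not only to those of positive \<open>p\<close>-mass.\<close>

definition irreducible_measure ::
  "('d \<Rightarrow> 'a \<Rightarrow> real \<Rightarrow> real) \<Rightarrow> ('d \<Rightarrow> 'a) set \<Rightarrow> ('d \<Rightarrow> 'a) measure \<Rightarrow> bool" where
  "irreducible_measure \<phi> E p \<longleftrightarrow>
     (\<forall>i. \<exists>a\<in>E. \<exists>b\<in>E. a i \<noteq> b i \<and> {j. a j \<noteq> b j} \<subseteq> {j. lyapunov_prec \<phi> p i j})"

text \<open>For \<open>I \<subseteq> D\<close>, both the projected letters and the points of \<open>[0,1]\<^sup>I\<close> are represented by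
  functions that are \<open>undefined\<close> outside \<open>I\<close>, so that distinct such functions differ on \<open>I\<close>.\<close>

definition proj_map ::
  "('d \<Rightarrow> 'a \<Rightarrow> real \<Rightarrow> real) \<Rightarrow> 'd set \<Rightarrow> ('d \<Rightarrow> 'a) \<Rightarrow> ('d \<Rightarrow> real) \<Rightarrow> ('d \<Rightarrow> real)" where
  "proj_map \<phi> I a x = (\<lambda>i\<in>I. \<phi> i (a i) (x i))"

definition good_set ::
  "('d \<Rightarrow> 'a \<Rightarrow> real \<Rightarrow> real) \<Rightarrow> ('d \<Rightarrow> 'a) set \<Rightarrow> 'd set \<Rightarrow> bool" where
  "good_set \<phi> E I \<longleftrightarrow>
     disjoint_family_on (\<lambda>a. proj_map \<phi> I a ` (\<Pi>\<^sub>E i\<in>I. {0<..<1})) ((\<lambda>a. restrict a I) ` E)"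

definition good_measure ::
  "('d \<Rightarrow> 'a \<Rightarrow> real \<Rightarrow> real) \<Rightarrow> ('d \<Rightarrow> 'a) set \<Rightarrow> ('d \<Rightarrow> 'a) measure \<Rightarrow> bool" where
  "good_measure \<phi> E p \<longleftrightarrow> (\<forall>x>0. good_set \<phi> E {i. lyapunov \<phi> p i \<le> x})"

end

theory Submission
  imports Defs "HOL-Combinatorics.Multiset_Permutations"
begin

text \<open>Order the coordinates by their Lyapunov exponents \<open>\<chi>\<^sub>k\<close> and let \<open>h\<^sub>k\<close> be the conditional entropy of
  coordinate \<open>k\<close> given the preceding ones. Both dimensions are compared with the sum of \<open>h\<^sub>k / \<chi>\<^sub>k\<close>.

  The dimension of the Bernoulli measure is at most this sum: an approximate cube of size
  \<open>exp (- T)\<close> around a typical point has mass about \<open>exp (- T * (\<Sum>k. h\<^sub>k / \<chi>\<^sub>k))\<close>, which bounds the number of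
  such cubes.

  For the lower bound, consider the words with one fixed typical frequency of letters. They all
  contract coordinate \<open>k\<close> by the same factor, and since permutations of the positions act
  transitively on them, the number of choices for coordinate \<open>k\<close> given the preceding ones does not depend on
  these. They thus generate a homogeneous sub-sponge of almost the right dimension, which is
  strongly separated because \<open>p\<close> is good, and has at least two choices in each coordinate because \<open>p\<close> is
  irreducible. By the simplex lemma, the rational points with denominators in the
  range relevant at a given scale and lying near an approximate cube are on a single hyperplane. Let \<open>i\<close> be the
  coordinate in which its normal vector is largest. Altering one digit of coordinate \<open>i\<close> leaves the
  coordinates of smaller exponent fixed and moves those of larger exponent by a negligible amount,
  so at most one choice of this digit gives a point near the hyperplane. Hence at least half of
  the subcubes can be kept, and a factor of two per stage is
  negligible when the stages are long.\<close>

section \<open>Hausdorff dimension\<close>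

text \<open>Homogeneity is arranged before any hyperplane is avoided: once the number of digits and
  the contraction of each coordinate are the same throughout, a single digit can be altered while
  all others stay free, and this is what the halving argument rests on. Two obstacles shape the
  words. Goodness separates open boxes only, so closed images may touch; every word therefore ends
  in a fixed word carrying the closed interval into its interior in each coordinate. Irreducibility
  may rest on letters of mass zero, which typical words avoid; hence an arrangement of all letters
  of \<open>E\<close>, each once, is inserted to supply a second digit. Both additions have bounded
  length and disappear as the typical part grows. Distinct exponents enter twice: the order of the
  coordinates becomes strict, and the gap between two exponents yields the factor
  \<open>exp (- t * (l j / l i - 1))\<close> that shields a faster coordinate from a change in a
  slower one.\<close>

lemma hausdorff_premeasure_mono:
  "S \<subseteq> T \<Longrightarrow> hausdorff_premeasure s \<delta> S \<le> hausdorff_premeasure s \<delta> T"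
  unfolding hausdorff_premeasure_def by (rule INF_superset_mono) auto

lemma hausdorff_measure_mono: "S \<subseteq> T \<Longrightarrow> hausdorff_measure s S \<le> hausdorff_measure s T"
  unfolding hausdorff_measure_def by (intro SUP_mono') (rule hausdorff_premeasure_mono)

lemma hausdorff_dim_mono:
  assumes "S \<subseteq> T" shows "hausdorff_dim S \<le> hausdorff_dim T"
  unfolding hausdorff_dim_def
proof (rule INF_superset_mono)
  show "{s. 0 \<le> s \<and> hausdorff_measure s T = 0} \<subseteq> {s. 0 \<le> s \<and> hausdorff_measure s S = 0}"
    using hausdorff_measure_mono[OF assms] le_zero_eq by (metis (mono_tags, lifting) Collect_mono)
qed auto

lemma hausdorff_dim_le:
  "0 \<le> s \<Longrightarrow> hausdorff_measure s S = 0 \<Longrightarrow> hausdorff_dim S \<le> ennreal s"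
  unfolding hausdorff_dim_def by (rule INF_lower) auto

lemma hausdorff_measure_zero_iff:
  "hausdorff_measure s S = 0 \<longleftrightarrow> (\<forall>\<delta>>0. hausdorff_premeasure s \<delta> S = 0)"
  unfolding hausdorff_measure_def bot_ennreal[symmetric] SUP_bot_conv by auto

lemma hausdorff_measure_zero_UN:
  assumes "\<And>j::nat. hausdorff_measure s (S j) = 0"
  shows "hausdorff_measure s (\<Union>j. S j) = 0"
  unfolding hausdorff_measure_zero_iff
proof (intro allI impI)
  fix \<delta> :: real assume \<delta>: "\<delta> > 0"
  show "hausdorff_premeasure s \<delta> (\<Union>j. S j) = 0"
  proof (rule antisym[OF ennreal_le_epsilon])
    fix e :: real assume e: "0 < e"
    have "\<exists>U. (S j \<subseteq> (\<Union>n. U n) \<and> (\<forall>n. bounded (U n) \<and> diameter (U n) \<le> \<delta>))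
            \<and> (\<Sum>n. diam_pow s (U n)) \<le> ennreal (e * (1/2)^Suc j)" for j
    proof -
      have "hausdorff_premeasure s \<delta> (S j) < ennreal (e * (1/2)^Suc j)"
        using assms \<delta> e by (auto simp: hausdorff_measure_zero_iff)
      then show ?thesis
        unfolding hausdorff_premeasure_def INF_less_iff by (auto intro: less_imp_le)
    qed
    then obtain U where U: "\<And>j. S j \<subseteq> (\<Union>n. U j n)" "\<And>j n. bounded (U j n)"
        "\<And>j n. diameter (U j n) \<le> \<delta>"
        "\<And>j. (\<Sum>n. diam_pow s (U j n)) \<le> ennreal (e * (1/2)^Suc j)"
      by metis
    define V where "V = (\<lambda>k. case_prod U (prod_decode k))"
    have "(\<Union>j. S j) \<subseteq> (\<Union>k. V k)"
    proof
      fix x assume "x \<in> (\<Union>j. S j)"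
      then obtain j n where "x \<in> U j n" using U(1) by blast
      then have "x \<in> V (prod_encode (j, n))" by (simp add: V_def)
      then show "x \<in> (\<Union>k. V k)" by blast
    qed
    then have "hausdorff_premeasure s \<delta> (\<Union>j. S j) \<le> (\<Sum>k. diam_pow s (V k))"
      unfolding hausdorff_premeasure_def
      using U(2,3) by (intro INF_lower) (auto simp: V_def split: prod.split)
    also have "\<dots> = (\<Sum>j. \<Sum>n. diam_pow s (U j n))"
      using suminf_ennreal_2dimen[of "\<lambda>j. \<Sum>n. diam_pow s (U j n)" "\<lambda>(j, n). diam_pow s (U j n)"]
      by (simp add: V_def split_beta)
    also have "\<dots> \<le> (\<Sum>j. ennreal (e * (1/2)^Suc j))"
      using U(4) by (intro suminf_le) auto
    also have "\<dots> = ennreal e"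
    proof (rule suminf_ennreal_eq)
      show "(\<lambda>j. e * (1/2)^Suc j) sums e"
        using sums_mult[OF power_half_series, of e] by simp
    qed (use e in auto)
    finally show "hausdorff_premeasure s \<delta> (\<Union>j. S j) \<le> 0 + ennreal e" by simp
  qed auto
qed

text \<open>A common bound \<open>D\<close> for the diameters reduces the cost of a cover to the
  number of its sets times \<open>D powr s\<close>; covers by approximate cubes are counted in this
  form.\<close>

lemma hausdorff_measure_zero_finite_covers:
  assumes s: "0 < s"
    and cov: "\<And>\<epsilon>. \<epsilon> > 0 \<Longrightarrow> \<exists>\<U> D. finite \<U> \<and> S \<subseteq> \<Union>\<U> \<and> 0 \<le> D \<and> D \<le> \<epsilon> \<and> card \<U> * D powr s \<le> \<epsilon> \<and>
                 (\<forall>U\<in>\<U>. bounded U \<and> diameter U \<le> D)"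
  shows "hausdorff_measure s S = 0"
  unfolding hausdorff_measure_zero_iff
proof (intro allI impI)
  fix \<delta> :: real assume \<delta>: "\<delta> > 0"
  show "hausdorff_premeasure s \<delta> S = 0"
  proof (rule antisym[OF ennreal_le_epsilon])
    fix e :: real assume e: "0 < e"
    obtain \<U> D where U: "finite \<U>" "S \<subseteq> \<Union>\<U>" "0 \<le> D" "D \<le> min \<delta> e" "card \<U> * D powr s \<le> min \<delta> e"
        "\<forall>U\<in>\<U>. bounded U \<and> diameter U \<le> D"
      using cov[of "min \<delta> e"] e \<delta> by auto
    obtain h where h: "bij_betw h {0..<card \<U>} \<U>"
      using ex_bij_betw_nat_finite[OF U(1)] by blast
    \<comment> \<open>Padding with empty sets is free, since \<open>diam_pow\<close> vanishes at the
      empty set for every exponent.\<close>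
    define V where "V = (\<lambda>n. if n < card \<U> then h n else {})"
    have V: "\<Union>\<U> = (\<Union>n. V n)"
    proof -
      have "\<Union>\<U> = (\<Union>n\<in>{0..<card \<U>}. h n)" using bij_betw_imp_surj_on[OF h] by simp
      also have "\<dots> = (\<Union>n. V n)" by (auto simp: V_def split: if_splits)
      finally show ?thesis .
    qed
    have hU: "n < card \<U> \<Longrightarrow> h n \<in> \<U>" for n using h by (auto simp: bij_betw_def)
    have "hausdorff_premeasure s \<delta> S \<le> (\<Sum>n. diam_pow s (V n))"
      unfolding hausdorff_premeasure_def
    proof (intro INF_lower, safe)
      fix x assume "x \<in> S" then show "x \<in> (\<Union>n. V n)" using U(2) V by auto
    next
      fix n show "bounded (V n)" using U(6) hU by (auto simp: V_def)
      show "diameter (V n) \<le> \<delta>"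
      proof (cases "n < card \<U>")
        case True
        then have "diameter (h n) \<le> D" using U(6) hU by blast
        then show ?thesis using True U(4) by (simp add: V_def)
      qed (use \<delta> in \<open>simp add: V_def\<close>)
    qed
    also have "\<dots> = (\<Sum>n<card \<U>. diam_pow s (V n))"
      by (rule suminf_finite) (auto simp: V_def diam_pow_def)
    also have "\<dots> \<le> (\<Sum>n<card \<U>. ennreal (D powr s))"
      using U(6) hU s by (intro sum_mono)
        (auto simp: V_def diam_pow_def intro!: ennreal_leI powr_mono2 diameter_ge_0)
    also have "\<dots> = ennreal (card \<U> * D powr s)"
      by (simp add: ennreal_mult ennreal_of_nat_eq_real_of_nat)
    also have "\<dots> \<le> ennreal e" using U(5) by (intro ennreal_leI) auto
    finally show "hausdorff_premeasure s \<delta> S \<le> 0 + ennreal e" by simp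
  qed auto
qed

text \<open>Mass distribution principle for the uniform product measure on digit sequences. By
  \<open>sep\<close>, the sequences sent into a set of diameter below
  \<open>c * exp (- t * k)\<close> share their first \<open>k\<close> digits and so lie in a
  cylinder of mass \<open>(1 / m) ^ k\<close>. Only these cylinders are measured, not the preimages
  under \<open>f\<close>.\<close>

lemma hausdorff_dim_ge_branching:
  fixes f :: "(nat \<Rightarrow> nat) \<Rightarrow> 'a::metric_space"
  assumes m: "2 \<le> m" and t: "0 < t" and c: "0 < c"
    and sep: "\<And>u v n. u \<in> UNIV \<rightarrow> {..<m} \<Longrightarrow> v \<in> UNIV \<rightarrow> {..<m} \<Longrightarrow> \<exists>i<n. u i \<noteq> v i \<Longrightarrow>
                c * exp (- t * real n) \<le> dist (f u) (f v)"
  shows "ennreal (ln m / t) \<le> hausdorff_dim (f ` (UNIV \<rightarrow> {..<m}))"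
  unfolding hausdorff_dim_def
proof (rule INF_greatest, clarify)
  let ?\<Omega> = "UNIV \<rightarrow> {..<m} :: (nat \<Rightarrow> nat) set"
  fix s :: real assume s: "0 \<le> s" and z: "hausdorff_measure s (f ` ?\<Omega>) = 0"
  show "ennreal (ln m / t) \<le> ennreal s"
  proof (rule ccontr)
    assume "\<not> ?thesis"
    then have s_less: "s \<le> ln m / t" using s by (auto simp: ennreal_le_iff not_le intro: less_imp_le)
    define M where "M = (\<lambda>_::nat. uniform_count_measure {..<m})"
    interpret P: product_prob_space M UNIV
      unfolding product_prob_space_def product_prob_space_axioms_def product_sigma_finite_def M_def
      using m by (auto intro!: prob_space_uniform_count_measure prob_space_imp_sigma_finite
                       simp: lessThan_empty_iff)
    let ?P = "PiM UNIV M"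
    have space_P: "space ?P = ?\<Omega>"
      by (auto simp: space_PiM M_def space_uniform_count_measure PiE_def)
    define Cyl where "Cyl u k = {v\<in>space ?P. \<forall>i\<in>{..<k}. v i \<in> {u i}}" for u k
    have Cyl: "Cyl u k \<in> sets ?P" "emeasure ?P (Cyl u k) = ennreal ((1 / m) ^ k)"
      if "u \<in> ?\<Omega>" for u k
    proof -
      have *: "{u i} \<in> sets (M i)" for i
        using that by (auto simp: M_def sets_uniform_count_measure)
      show "Cyl u k \<in> sets ?P"
        unfolding Cyl_def using * by measurable
      have "emeasure ?P (Cyl u k) = (\<Prod>i\<in>{..<k}. emeasure (M i) {u i})"
        unfolding Cyl_def using * by (intro P.emeasure_PiM_Collect) auto
      also have "\<dots> = (\<Prod>i\<in>{..<k}. ennreal (1 / m))"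
        using that by (intro prod.cong) (auto simp: M_def emeasure_uniform_count_measure Pi_iff)
      also have "\<dots> = ennreal ((1 / m) ^ k)" by (simp add: ennreal_power)
      finally show "emeasure ?P (Cyl u k) = ennreal ((1 / m) ^ k)" .
    qed
    \<comment> \<open>The factor \<open>m\<close> pays for rounding the number of digits down,
      \<open>c powr (- s)\<close> for the constant in the separation.\<close>
    define K where "K = m * c powr (- s)"
    have K: "K > 0" using m c by (auto simp: K_def)
    have hull: "\<exists>C\<in>sets ?P. {u\<in>?\<Omega>. f u \<in> U} \<subseteq> C \<and> emeasure ?P C \<le> ennreal K * diam_pow s U"
      if U: "bounded U" "diameter U \<le> c / 2" for U
    proof (cases "\<exists>u\<in>?\<Omega>. f u \<in> U")
      case False
      then show ?thesis by (intro bexI[of _ "{}"]) auto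
    next
      case True
      then obtain u where u: "u \<in> ?\<Omega>" "f u \<in> U" by blast
      have sub: "{v\<in>?\<Omega>. f v \<in> U} \<subseteq> Cyl u k" if k: "diameter U < c * exp (- t * real k)" for k
      proof safe
        fix v assume v: "v \<in> ?\<Omega>" "f v \<in> U"
        have "dist (f u) (f v) \<le> diameter U" using diameter_bounded_bound U u v by blast
        then have "\<not> (\<exists>i<k. u i \<noteq> v i)" using sep[of u v k] u v k by force
        then show "v \<in> Cyl u k" using v by (auto simp: Cyl_def space_P)
      qed
      \<comment> \<open>For \<open>s = 0\<close> the convention that a nonempty set contributes 1
        suffices. A set of diameter zero determines all digits, so its sequences lie in a null
        intersection of cylinders.\<close>
      consider "s = 0" | "s > 0" "diameter U = 0" | "s > 0" "diameter U > 0"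
        using s diameter_ge_0[OF U(1)] by force
      then show ?thesis
      proof cases
        case 1
        have "emeasure ?P (space ?P) = 1" by (rule P.P.emeasure_space_1)
        also have "1 \<le> ennreal K * diam_pow s U"
          using u 1 m c by (auto simp: diam_pow_def K_def)
        finally show ?thesis
          using space_P sets.top[of ?P] by (intro bexI[of _ "space ?P"]) (auto simp del: sets.top)
      next
        case 2
        have "emeasure ?P (\<Inter>k. Cyl u k) \<le> ennreal e" if "e > 0" for e :: real
        proof -
          have "(\<lambda>k. (1 / real m) ^ k) \<longlonglongrightarrow> 0" using m by (intro LIMSEQ_realpow_zero) auto
          then have "eventually (\<lambda>k. (1 / real m) ^ k < e) sequentially"
            using that by (rule order_tendstoD)
          then obtain k where k: "(1 / real m) ^ k < e"
            by (auto simp: eventually_sequentially)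
          have "emeasure ?P (\<Inter>k. Cyl u k) \<le> emeasure ?P (Cyl u k)"
            using Cyl u by (intro emeasure_mono) auto
          also have "\<dots> \<le> ennreal e" using Cyl(2)[OF u(1)] k by (auto intro!: ennreal_leI)
          finally show ?thesis .
        qed
        then have "emeasure ?P (\<Inter>k. Cyl u k) = 0"
          using zero_less_iff_neq_zero ennreal_le_epsilon[of 0 "emeasure ?P (\<Inter>k. Cyl u k)"] by fastforce
        moreover have "{v\<in>?\<Omega>. f v \<in> U} \<subseteq> (\<Inter>k. Cyl u k)"
          using sub 2 c by (intro INT_greatest) auto
        moreover have "(\<Inter>k. Cyl u k) \<in> sets ?P" using Cyl(1)[OF u(1)] by auto
        ultimately show ?thesis by (intro bexI[of _ "\<Inter>k. Cyl u k"]) simp_all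
      next
        case 3
        define D where "D = diameter U"
        have D: "D > 0" "D < c" using 3 U c by (auto simp: D_def)
        define y where "y = ln (c / D) / t"
        have y: "y > 0" using D t by (auto simp: y_def)
        \<comment> \<open>The largest integer strictly below \<open>y\<close>: strictness is what
          \<open>sub\<close> requires, and the bound \<open>c / 2\<close> on the diameter makes
          \<open>y\<close> positive.\<close>
        define k where "k = nat (\<lceil>y\<rceil> - 1)"
        have ceil: "\<lceil>y\<rceil> \<ge> 1" using y by simp
        then have rk: "real k = of_int \<lceil>y\<rceil> - 1" by (simp add: k_def)
        have k: "real k < y" "y \<le> real k + 1" unfolding rk using ceiling_correct[of y] by auto
        have Dy: "D = c * exp (- t * y)" using D t by (simp add: y_def exp_minus exp_ln)
        have "diameter U < c * exp (- t * real k)"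
          using k c t unfolding D_def[symmetric] Dy by simp
        from sub[OF this] have "{v\<in>?\<Omega>. f v \<in> U} \<subseteq> Cyl u k" .
        moreover have "emeasure ?P (Cyl u k) \<le> ennreal K * diam_pow s U"
        proof -
          have "s * (t * y) \<le> (k + 1) * ln m"
          proof -
            have "s * t \<le> ln m" using s_less t by (simp add: field_simps)
            then have "s * t * y \<le> ln m * (k + 1)"
              using y k s t m by (intro mult_mono) auto
            then show ?thesis by (simp add: mult_ac)
          qed
          then have "exp (- ((k + 1) * ln m)) \<le> exp (- (s * (t * y)))" by simp
          moreover have "exp (- ((k + 1) * ln m)) = (1 / m) ^ (k + 1)"
            using m by (simp add: exp_minus exp_of_nat_mult inverse_eq_divide power_one_over flip: of_nat_Suc)
          moreover have "exp (- (s * (t * y))) = (D / c) powr s"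
            unfolding Dy using c by (simp add: powr_def)
          ultimately have "(1 / m) ^ (k + 1) \<le> (D / c) powr s" by simp
          then have "m * (1 / m) ^ (k + 1) \<le> m * (D / c) powr s"
            using m by (intro mult_left_mono) auto
          moreover have "m * (1 / m) ^ (k + 1) = (1 / m) ^ k" using m by simp
          moreover have "m * (D / c) powr s = K * D powr s"
            using c D by (simp add: K_def powr_divide powr_minus_divide)
          ultimately have "(1 / m) ^ k \<le> K * D powr s" by simp
          then have "ennreal ((1 / m) ^ k) \<le> ennreal K * ennreal (D powr s)"
            using K by (simp add: ennreal_mult[symmetric] ennreal_leI)
          then show ?thesis using Cyl(2)[OF u(1), of k] 3 u by (auto simp: diam_pow_def D_def)
        qed
        ultimately show ?thesis using Cyl u by blast
      qed
    qed
    \<comment> \<open>A cover of cost below \<open>1 / K\<close> would give the whole sequence space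
      a mass below 1.\<close>
    have "hausdorff_premeasure s (c / 2) (f ` ?\<Omega>) < ennreal (1 / K)"
      using z c K by (auto simp: hausdorff_measure_zero_iff)
    then obtain U where U: "f ` ?\<Omega> \<subseteq> (\<Union>n. U n)" "\<And>n. bounded (U n) \<and> diameter (U n) \<le> c / 2"
       "(\<Sum>n. diam_pow s (U n)) < ennreal (1 / K)"
      unfolding hausdorff_premeasure_def INF_less_iff by auto
    have "\<forall>n. \<exists>C. C \<in> sets ?P \<and> {u\<in>?\<Omega>. f u \<in> U n} \<subseteq> C \<and> emeasure ?P C \<le> ennreal K * diam_pow s (U n)"
      using hull U(2) unfolding Bex_def by simp
    from choice[OF this] obtain C where C': "\<forall>n. C n \<in> sets ?P \<and> {u\<in>?\<Omega>. f u \<in> U n} \<subseteq> C n \<and>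
      emeasure ?P (C n) \<le> ennreal K * diam_pow s (U n)" ..
    then have C: "\<And>n. C n \<in> sets ?P" "\<And>n. {u\<in>?\<Omega>. f u \<in> U n} \<subseteq> C n"
      "\<And>n. emeasure ?P (C n) \<le> ennreal K * diam_pow s (U n)" by simp_all
    have "space ?P \<subseteq> (\<Union>n. C n)" unfolding space_P using U(1) C(2) by blast
    then have "1 \<le> emeasure ?P (\<Union>n. C n)"
      using P.P.emeasure_space_1 emeasure_mono[of "space ?P" "\<Union>n. C n" ?P] C(1) by auto
    also have "\<dots> \<le> (\<Sum>n. emeasure ?P (C n))"
      using C(1) by (intro emeasure_subadditive_countably) auto
    also have "\<dots> \<le> (\<Sum>n. ennreal K * diam_pow s (U n))" using C(3) by (intro suminf_le) auto
    also have "\<dots> = ennreal K * (\<Sum>n. diam_pow s (U n))" by simp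
    also have "\<dots> < ennreal K * ennreal (1 / K)"
      using U(3) K by (intro ennreal_mult_strict_left_mono) auto
    also have "\<dots> = 1" using K by (simp add: ennreal_mult[symmetric])
    finally show False by simp
  qed
qed

section \<open>The simplex lemma\<close>

text \<open>Pigeonhole: with \<open>d\<close> the dimension, the \<open>(H + 1) ^ d\<close> forms
  with coefficients from 0 to \<open>H\<close> outnumber the \<open>H ^ d\<close> intervals into
  which the fractional parts of their values fall. Two forms in the same interval are subtracted,
  and \<open>B\<close> absorbs the integer parts.\<close>

lemma dirichlet_linear_form:
  fixes c :: "'d::finite \<Rightarrow> real" and H :: nat
  assumes H: "1 \<le> H"
  obtains A :: "'d \<Rightarrow> int" and B :: int
  where "\<exists>i. A i \<noteq> 0" "\<And>i. \<bar>A i\<bar> \<le> int H"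
    "\<bar>(\<Sum>i\<in>UNIV. A i * c i) + B\<bar> < 1 / real H ^ CARD('d)"
proof -
  let ?n = "H ^ CARD('d)"
  define L where "L a = (\<Sum>i\<in>UNIV. real (a i) * c i)" for a :: "'d \<Rightarrow> nat"
  define g where "g a = nat \<lfloor>real ?n * frac (L a)\<rfloor>" for a
  have "g ` (PiE UNIV (\<lambda>_. {..H})) \<subseteq> {..<?n}"
  proof safe
    fix a
    have "real ?n * frac (L a) < real ?n * 1"
      using H by (intro mult_strict_left_mono) (auto simp: frac_lt_1)
    then have "\<lfloor>real ?n * frac (L a)\<rfloor> < int ?n" by (simp add: floor_less_iff)
    then show "g a < ?n" using H by (simp add: g_def nat_less_iff)
  qed
  then have "card (g ` (PiE UNIV (\<lambda>_. {..H}))) \<le> ?n"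
    using card_mono[of "{..<?n}"] by fastforce
  also have "\<dots> < card (PiE (UNIV :: 'd set) (\<lambda>_. {..H}))"
    by (simp add: card_PiE power_strict_mono)
  finally have "\<not> inj_on g (PiE UNIV (\<lambda>_. {..H}))" using pigeonhole by blast
  then obtain a b where ab: "a \<in> PiE UNIV (\<lambda>_. {..H})" "b \<in> PiE UNIV (\<lambda>_. {..H})" "a \<noteq> b" "g a = g b"
    unfolding inj_on_def by blast
  define A where "A i = int (a i) - int (b i)" for i
  define B where "B = \<lfloor>L b\<rfloor> - \<lfloor>L a\<rfloor>"
  show thesis
  proof
    show "\<exists>i. A i \<noteq> 0" using ab(3) by (auto simp: A_def)
    show "\<bar>A i\<bar> \<le> int H" for i
    proof -
      have "a i \<le> H" "b i \<le> H" using ab(1,2) by (auto simp: PiE_iff)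
      then show ?thesis by (simp add: A_def)
    qed
    have "(\<Sum>i\<in>UNIV. A i * c i) = L a - L b"
      by (simp add: A_def L_def left_diff_distrib sum_subtractf)
    then have eq: "(\<Sum>i\<in>UNIV. A i * c i) + B = frac (L a) - frac (L b)"
      by (simp add: B_def frac_def)
    have "\<lfloor>real ?n * frac (L a)\<rfloor> = \<lfloor>real ?n * frac (L b)\<rfloor>"
    proof -
      have "0 \<le> \<lfloor>real ?n * frac (L x)\<rfloor>" for x by (simp add: frac_ge_0)
      then show ?thesis using ab(4) unfolding g_def by (metis nat_eq_iff2 nat_0_le)
    qed
    then have "\<bar>real ?n * frac (L a) - real ?n * frac (L b)\<bar> < 1" by linarith
    then have "real ?n * \<bar>frac (L a) - frac (L b)\<bar> < 1"
      by (simp add: abs_mult right_diff_distrib[symmetric])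
    then show "\<bar>(\<Sum>i\<in>UNIV. A i * c i) + B\<bar> < 1 / real H ^ CARD('d)"
      unfolding eq using H by (simp add: field_simps)
  qed
qed

text \<open>Instead of comparing volumes of simplices, the hyperplane is found by the pigeonhole principle
  at the centre of the box; being integral, it then contains all the rational points at once.\<close>

lemma simplex_lemma:
  obtains K :: real where "K > 0"
    "\<And>(c :: real ^ 'd::finite) R. R > 0 \<Longrightarrow> \<exists>(A :: 'd \<Rightarrow> int) B. (\<exists>i. A i \<noteq> 0) \<and>
       (\<forall>(q::nat) (r :: 'd \<Rightarrow> int). 1 \<le> q \<longrightarrow> R \<le> K * real q powr (- (1 + 1 / real CARD('d))) \<longrightarrow>
          (\<forall>i. \<bar>r i / q - c $ i\<bar> \<le> R) \<longrightarrow> (\<Sum>i\<in>UNIV. A i * r i) + B * int q = 0)"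
proof
  let ?d = "CARD('d)"
  \<comment> \<open>The displacement term below is at most
    \<open>3 * d * R * z ^ Suc d = 3 * d * K\<close>, with \<open>d\<close> the dimension; this
    value makes it 1/2.\<close>
  define K where "K = 1 / (6 * real ?d)"
  have d: "?d \<ge> 1" by simp
  show "K > 0" by (simp add: K_def)
  fix c :: "real ^ 'd" and R :: real
  assume R: "R > 0"
  \<comment> \<open>Chosen so that the condition relating \<open>R\<close> and \<open>q\<close>
    implies \<open>q \<le> z ^ d\<close>: the rationals in question have denominators up to
    \<open>z ^ d\<close>.\<close>
  define z where "z = root (Suc ?d) (K / R)"
  have z0: "z > 0" using R \<open>K > 0\<close> by (simp add: z_def)
  have zd: "z ^ Suc ?d = K / R" using R \<open>K > 0\<close> unfolding z_def by (intro real_root_pow_pos2) auto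
  have q_le: "real q \<le> z ^ ?d" if "1 \<le> q" "R \<le> K * real q powr (- (1 + 1 / real ?d))" for q :: nat
  proof -
    have "real q powr (1 + 1 / ?d) \<le> K / R"
      using that R by (simp add: powr_minus field_simps)
    also have "\<dots> = (z ^ ?d) powr (1 + 1 / ?d)"
    proof -
      have "(z ^ ?d) powr (1 + 1 / ?d) = z powr (?d * (1 + 1 / ?d))"
        using z0 by (simp add: powr_powr flip: powr_realpow)
      also have "real ?d * (1 + 1 / ?d) = real (Suc ?d)" using d by (simp add: field_simps)
      also have "z powr real (Suc ?d) = z ^ Suc ?d" using z0 by (rule powr_realpow)
      finally show ?thesis using zd by simp
    qed
    finally have *: "real q powr (1 + 1 / ?d) \<le> (z ^ ?d) powr (1 + 1 / ?d)" .
    show ?thesis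
    proof (rule ccontr)
      assume "\<not> ?thesis"
      then have "(z ^ ?d) powr (1 + 1 / ?d) < real q powr (1 + 1 / ?d)"
        using z0 by (intro powr_less_mono2) (auto intro: add_pos_pos)
      with * show False by simp
    qed
  qed
  show "\<exists>(A :: 'd \<Rightarrow> int) B. (\<exists>i. A i \<noteq> 0) \<and>
       (\<forall>(q::nat) (r :: 'd \<Rightarrow> int). 1 \<le> q \<longrightarrow> R \<le> K * real q powr (- (1 + 1 / real CARD('d))) \<longrightarrow>
          (\<forall>i. \<bar>r i / q - c $ i\<bar> \<le> R) \<longrightarrow> (\<Sum>i\<in>UNIV. A i * r i) + B * int q = 0)"
  proof (cases "z < 1")
    \<comment> \<open>Every eligible denominator would be below 1, so any hyperplane serves.\<close>
    case True
    have False if "1 \<le> q" "R \<le> K * real q powr (- (1 + 1 / real ?d))" for q :: nat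
    proof -
      have "z ^ ?d < 1" using True z0 d by (simp add: power_less_one_iff)
      then show False using q_le[OF that] that(1) by linarith
    qed
    then show ?thesis by (intro exI[of _ "\<lambda>_. 1"] exI[of _ 0]) auto
  next
    case False
    \<comment> \<open>\<open>H \<ge> 2 * z\<close> makes \<open>q / H ^ d\<close> at most 1/2, while
      \<open>H \<le> 3 * z\<close>, valid because \<open>z \<ge> 1\<close>, bounds the
      coefficients.\<close>
    define H where "H = nat \<lceil>2 * z\<rceil>"
    have H: "2 * z \<le> H" "H \<le> 3 * z" "1 \<le> H"
      using False by (auto simp: H_def) linarith+
    obtain A :: "'d \<Rightarrow> int" and B :: int where A: "\<exists>i. A i \<noteq> 0" "\<And>i. \<bar>A i\<bar> \<le> int H"
      "\<bar>(\<Sum>i\<in>UNIV. A i * c $ i) + B\<bar> < 1 / real H ^ ?d"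
      using dirichlet_linear_form[OF H(3), of "\<lambda>i. c $ i"] by metis
    have "(\<Sum>i\<in>UNIV. A i * r i) + B * int q = 0"
      if q: "1 \<le> q" "R \<le> K * real q powr (- (1 + 1 / real ?d))"
        and r: "\<forall>i. \<bar>r i / q - c $ i\<bar> \<le> R" for q :: nat and r :: "'d \<Rightarrow> int"
    proof -
      have qz: "real q \<le> z ^ ?d" by (rule q_le[OF q])
      have "2 * real q \<le> real H ^ ?d"
      proof -
        have "2 * real q \<le> 2 ^ ?d * z ^ ?d"
          using qz d self_le_power[of "2::real" ?d] by (intro mult_mono) auto
        also have "\<dots> \<le> real H ^ ?d"
          unfolding power_mult_distrib[symmetric] using H z0 by (intro power_mono) auto
        finally show ?thesis .
      qed
      then have 1: "q * (1 / real H ^ ?d) \<le> 1 / 2"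
        using H by (simp add: field_simps)
      have "\<bar>\<Sum>i\<in>UNIV. A i * (r i / q - c $ i)\<bar> \<le> (\<Sum>i\<in>(UNIV::'d set). H * R)"
      proof (rule order_trans[OF sum_abs], rule sum_mono)
        fix i
        have "\<bar>of_int (A i)\<bar> \<le> real H" using A(2)[of i] by linarith
        then show "\<bar>A i * (r i / q - c $ i)\<bar> \<le> H * R"
          unfolding abs_mult using r by (intro mult_mono) auto
      qed
      also have "\<dots> = ?d * (H * R)" by simp
      also have "\<dots> \<le> ?d * (3 * z * R)"
        using H(2) R by (intro mult_left_mono mult_right_mono) auto
      finally have "q * \<bar>\<Sum>i\<in>UNIV. A i * (r i / q - c $ i)\<bar> \<le> z ^ ?d * (?d * (3 * z * R))"
        using qz z0 by (intro mult_mono) auto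
      also have "\<dots> = 3 * ?d * R * z ^ Suc ?d" by simp
      also have "\<dots> = 1 / 2" unfolding zd using R by (simp add: K_def)
      finally have 2: "q * \<bar>\<Sum>i\<in>UNIV. A i * (r i / q - c $ i)\<bar> \<le> 1 / 2" .
      \<comment> \<open>The integer to be shown zero is \<open>q\<close> times the form at the
        centre plus \<open>q\<close> times the displacement. The first is below 1/2 and the second
        at most 1/2 in absolute value.\<close>
      let ?x = "(\<Sum>i\<in>UNIV. A i * c $ i) + B" and ?y = "\<Sum>i\<in>UNIV. A i * (r i / q - c $ i)"
      have "q * ?y = (\<Sum>i\<in>UNIV. real_of_int (A i) * r i) - q * (\<Sum>i\<in>UNIV. A i * c $ i)"
        unfolding sum_distrib_left sum_subtractf[symmetric]
        using q by (intro sum.cong) (auto simp: field_simps)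
      then have "real_of_int ((\<Sum>i\<in>UNIV. A i * r i) + B * int q) = q * ?x + q * ?y"
        by (simp add: algebra_simps)
      then have "\<bar>real_of_int ((\<Sum>i\<in>UNIV. A i * r i) + B * int q)\<bar> \<le> q * \<bar>?x\<bar> + q * \<bar>?y\<bar>"
        using abs_triangle_ineq[of "q * ?x" "q * ?y"] by (simp add: abs_mult)
      also have "\<dots> < 1"
      proof -
        have "q * \<bar>(\<Sum>i\<in>UNIV. A i * c $ i) + B\<bar> < q * (1 / real H ^ ?d)"
          using A(3) q by (intro mult_strict_left_mono) auto
        then show ?thesis using 1 2 by linarith
      qed
      finally show ?thesis by linarith
    qed
    then show ?thesis using A(1) by blast
  qed
qed

section \<open>Badly approximable points in hierarchically coded sets\<close>

text \<open>Counts the children of an approximate cube: everything outside the free block is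
  prescribed by \<open>c\<close>, so restriction to the block is a bijection onto a finite
  product.\<close>

lemma card_funcs_block:
  fixes M :: "'d::finite \<Rightarrow> nat" and a b :: "'d \<Rightarrow> nat"
  shows "card {c'. \<forall>m k. if a k \<le> m \<and> m < b k then c' m k < M k else c' m k = c m k}
       = (\<Prod>k\<in>UNIV. M k ^ (b k - a k))"
    and "finite {c' :: nat \<Rightarrow> 'd \<Rightarrow> nat. \<forall>m k. if a k \<le> m \<and> m < b k then c' m k < M k else c' m k = c m k}"
proof -
  let ?S = "{c' :: nat \<Rightarrow> 'd \<Rightarrow> nat. \<forall>m k. if a k \<le> m \<and> m < b k then c' m k < M k else c' m k = c m k}"
  let ?I = "SIGMA k:UNIV. {a k..<b k}"
  let ?P = "PiE ?I (\<lambda>(k, m). {..<M k})"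
  have bij: "bij_betw (\<lambda>c'. restrict (\<lambda>(k, m). c' m k) ?I) ?S ?P"
  proof (rule bij_betw_byWitness[where f' = "\<lambda>h m k. if a k \<le> m \<and> m < b k then h (k, m) else c m k"])
    show "\<forall>c'\<in>?S. (\<lambda>m k. if a k \<le> m \<and> m < b k then restrict (\<lambda>(k, m). c' m k) ?I (k, m) else c m k) = c'"
      by (auto simp: fun_eq_iff split: if_splits)
    show "\<forall>h\<in>?P. restrict (\<lambda>(k, m). if a k \<le> m \<and> m < b k then h (k, m) else c m k) ?I = h"
      by (auto simp: PiE_def extensional_def fun_eq_iff restrict_def)
    show "(\<lambda>c'. restrict (\<lambda>(k, m). c' m k) ?I) ` ?S \<subseteq> ?P"
      by (auto simp: PiE_def Pi_def split: if_splits)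
    show "(\<lambda>h m k. if a k \<le> m \<and> m < b k then h (k, m) else c m k) ` ?P \<subseteq> ?S"
      by (auto simp: PiE_def Pi_def)
  qed
  have "card ?P = (\<Prod>(k, m)\<in>?I. M k)"
    by (subst card_PiE) (auto intro!: prod.cong)
  also have "\<dots> = (\<Prod>k\<in>UNIV. \<Prod>m\<in>{a k..<b k}. M k)"
    by (subst prod.Sigma[symmetric]) auto
  finally show "card ?S = (\<Prod>k\<in>UNIV. M k ^ (b k - a k))"
    using bij_betw_same_card[OF bij] by simp
  have "finite ?P" by (intro finite_PiE) auto
  then show "finite ?S" using bij_betw_finite[OF bij] by simp
qed

text \<open>The abstract form of a homogeneous sub-sponge: each level carries one digit per
  coordinate, and \<open>l k\<close> is the contraction exponent of coordinate \<open>k\<close> per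
  level. Coordinate \<open>k\<close> of a point may depend on digits of smaller exponent, because
  the choices offered to digit \<open>k\<close> depend on them, but never on digits of larger
  exponent. Accordingly both estimates compare digits with \<open>l j \<le> l k\<close> only, and
  \<open>separate\<close> also asks that those of smaller exponent agree at level \<open>n\<close>
  itself.\<close>

locale hierarchical_coding =
  fixes l :: "'d::finite \<Rightarrow> real" and M :: "'d \<Rightarrow> nat"
    and X :: "(nat \<Rightarrow> 'd \<Rightarrow> nat) \<Rightarrow> real ^ 'd" and \<eta> :: real
  assumes l_pos: "0 < l k" and M_ge_2: "2 \<le> M k" and \<eta>_pos: "0 < \<eta>"
    and contract: "\<lbrakk>\<And>m k. c m k < M k; \<And>m k. c' m k < M k;
           \<And>m j. m < n \<Longrightarrow> l j \<le> l k \<Longrightarrow> c m j = c' m j\<rbrakk>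
         \<Longrightarrow> \<bar>X c $ k - X c' $ k\<bar> \<le> exp (- real n * l k)"
    and separate: "\<lbrakk>\<And>m k. c m k < M k; \<And>m k. c' m k < M k;
           \<And>m j. m < n \<Longrightarrow> l j \<le> l k \<Longrightarrow> c m j = c' m j;
           \<And>j. l j < l k \<Longrightarrow> c n j = c' n j; c n k \<noteq> c' n k\<rbrakk>
         \<Longrightarrow> \<eta> * exp (- real n * l k) \<le> \<bar>X c $ k - X c' $ k\<bar>"
    and l_inj: "inj l"
begin

section \<open>Approximate cubes of coded points\<close>

definition codes :: "(nat \<Rightarrow> 'd \<Rightarrow> nat) set" where
  "codes = {c. \<forall>m k. c m k < M k}"

definition l_max :: real where "l_max = Max (range l)"

lemma l_le_max: "l k \<le> l_max"
  by (simp add: l_max_def)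

definition depth :: "real \<Rightarrow> nat \<Rightarrow> 'd \<Rightarrow> nat" where
  "depth t n k = nat \<lceil>t * n / l k\<rceil>"

text \<open>Two codes agree to stage \<open>n\<close> if they lie in the same approximate cube of side
  about \<open>exp (- t * n)\<close>.\<close>

definition agree :: "real \<Rightarrow> nat \<Rightarrow> (nat \<Rightarrow> 'd \<Rightarrow> nat) \<Rightarrow> (nat \<Rightarrow> 'd \<Rightarrow> nat) \<Rightarrow> bool" where
  "agree t n c c' \<longleftrightarrow> (\<forall>k. \<forall>m<depth t n k. c m k = c' m k)"

lemma agree_sym: "agree t n c c' \<Longrightarrow> agree t n c' c"
  by (simp add: agree_def)

lemma agree_trans: "agree t n c c' \<Longrightarrow> agree t n c' c'' \<Longrightarrow> agree t n c c''"
  by (simp add: agree_def)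

lemma depth_ge: "t * n \<le> depth t n k * l k"
proof -
  have "t * n / l k \<le> depth t n k" unfolding depth_def by linarith
  then show ?thesis using l_pos[of k] by (simp add: field_simps)
qed

lemma depth_le: assumes "0 \<le> t" shows "depth t n k * l k \<le> t * n + l k"
proof -
  have "0 \<le> t * n / l k" using assms l_pos[of k] by simp
  then have "depth t n k \<le> t * n / l k + 1" unfolding depth_def by linarith
  then show ?thesis using l_pos[of k] by (simp add: field_simps)
qed

lemma depth_mono: "0 \<le> t \<Longrightarrow> n \<le> n' \<Longrightarrow> depth t n k \<le> depth t n' k"
  unfolding depth_def using l_pos[of k]
  by (intro nat_mono ceiling_mono divide_right_mono mult_left_mono) auto

text \<open>Coordinates of smaller exponent shrink more slowly and are prescribed to more levels.
  Hence agreement up to the depth of coordinate \<open>k\<close> covers all digits on which this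
  coordinate depends, as \<open>contract\<close> and \<open>separate\<close> demand.\<close>

lemma depth_antimono: "0 \<le> t \<Longrightarrow> l j \<le> l k \<Longrightarrow> depth t n k \<le> depth t n j"
  unfolding depth_def using l_pos[of k] l_pos[of j]
  by (intro nat_mono ceiling_mono divide_left_mono) auto

text \<open>Rounding up a sum gives at least one summand rounded up plus the other rounded down. The
  number of new levels in a stage thus has a lower bound independent of \<open>n\<close>, which
  allows a regular subtree.\<close>

lemma depth_Suc: assumes "0 \<le> t" shows "depth t n k + nat \<lfloor>t / l k\<rfloor> \<le> depth t (Suc n) k"
proof -
  have "0 \<le> t * n / l k" "0 \<le> t / l k" using assms l_pos[of k] by auto
  moreover have "t * real (Suc n) / l k = t * n / l k + t / l k"
    by (simp add: add_divide_distrib ring_distribs)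
  ultimately show ?thesis unfolding depth_def by linarith
qed

lemma agree_mono: "0 \<le> t \<Longrightarrow> n \<le> n' \<Longrightarrow> agree t n' c c' \<Longrightarrow> agree t n c c'"
  using depth_mono unfolding agree_def by (meson order_less_le_trans)

lemma agree_dist:
  assumes t: "0 \<le> t" and c: "c \<in> codes" "c' \<in> codes" and a: "agree t n c c'"
  shows "\<bar>X c $ k - X c' $ k\<bar> \<le> exp (- t * n)"
proof -
  have "\<bar>X c $ k - X c' $ k\<bar> \<le> exp (- real (depth t n k) * l k)"
  proof (rule contract)
    fix m j assume "m < depth t n k" "l j \<le> l k"
    then have "m < depth t n j" using depth_antimono[OF t, of j k n] by simp
    then show "c m j = c' m j" using a by (auto simp: agree_def)
  qed (use c in \<open>auto simp: codes_def\<close>)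
  also have "\<dots> \<le> exp (- t * n)" using depth_ge[of t n k] by simp
  finally show ?thesis .
qed

text \<open>At the first level where the codes differ within the depth, the differing coordinate of
  least exponent meets the hypotheses of \<open>separate\<close>: all relevant digits of earlier
  levels agree, and so do those of smaller exponent at this level. The factor
  \<open>exp (- l_max)\<close> is the price of rounding the depth up.\<close>

lemma not_agree_dist:
  assumes t: "0 \<le> t" and c: "c \<in> codes" "c' \<in> codes" and a: "\<not> agree t n c c'"
  shows "\<eta> * exp (- l_max) * exp (- t * n) \<le> dist (X c) (X c')"
proof -
  define P where "P m \<longleftrightarrow> (\<exists>k. m < depth t n k \<and> c m k \<noteq> c' m k)" for m
  define m where "m = (LEAST m. P m)"
  have "\<exists>m. P m" using a by (auto simp: agree_def P_def)
  then have m: "P m" "\<And>m'. m' < m \<Longrightarrow> \<not> P m'" unfolding m_def by (auto intro: LeastI dest: not_less_Least)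
  define S where "S = {k. m < depth t n k \<and> c m k \<noteq> c' m k}"
  have "S \<noteq> {}" using m(1) by (auto simp: P_def S_def)
  then obtain k where k: "k \<in> S" "\<And>j. j \<in> S \<Longrightarrow> l k \<le> l j"
    using ex_is_arg_min_if_finite[of S l] by (auto simp: is_arg_min_linorder)
  have kd: "m < depth t n k" "c m k \<noteq> c' m k" using k(1) by (auto simp: S_def)
  have "\<eta> * exp (- l_max) * exp (- t * n) = \<eta> * exp (- t * n - l_max)"
    by (simp add: exp_add[symmetric])
  also have "\<dots> \<le> \<eta> * exp (- real m * l k)"
  proof -
    have "real m * l k \<le> depth t n k * l k" using kd l_pos[of k] by simp
    also have "\<dots> \<le> t * n + l_max" using depth_le[OF t, of n k] l_le_max[of k] by simp
    finally show ?thesis using \<eta>_pos by simp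
  qed
  also have "\<dots> \<le> \<bar>X c $ k - X c' $ k\<bar>"
  proof (rule separate)
    fix m' j assume *: "m' < m" "l j \<le> l k"
    then have "m' < depth t n j" using kd depth_antimono[OF t, of j k n] by simp
    then show "c m' j = c' m' j" using m(2)[OF *(1)] by (auto simp: P_def)
  next
    fix j assume *: "l j < l k"
    then have "m < depth t n j" using kd depth_antimono[OF t, of j k n] by simp
    then show "c m j = c' m j" using k(2)[of j] * by (auto simp: S_def)
  qed (use c kd in \<open>auto simp: codes_def\<close>)
  also have "\<dots> \<le> dist (X c) (X c')"
    using component_le_norm_cart[of "X c - X c'" k] by (simp add: dist_norm)
  finally show ?thesis .
qed

text \<open>Representatives of the children of the approximate cube of \<open>c\<close>. Beyond the
  new block the digits are again those of \<open>c\<close>, so each child has exactly one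
  representative.\<close>

definition ext :: "real \<Rightarrow> nat \<Rightarrow> (nat \<Rightarrow> 'd \<Rightarrow> nat) \<Rightarrow> (nat \<Rightarrow> 'd \<Rightarrow> nat) set" where
  "ext t n c = {c'. \<forall>m k. if depth t n k \<le> m \<and> m < depth t (Suc n) k then c' m k < M k else c' m k = c m k}"

lemma ext_codes: "c \<in> codes \<Longrightarrow> c' \<in> ext t n c \<Longrightarrow> c' \<in> codes"
  unfolding ext_def codes_def mem_Collect_eq by metis

lemma ext_agree: "c' \<in> ext t n c \<Longrightarrow> agree t n c c'"
  unfolding ext_def agree_def mem_Collect_eq by (metis not_less)

lemma ext_agree_eq:
  assumes "c' \<in> ext t n c" "c'' \<in> ext t n c" "agree t (Suc n) c' c''" shows "c' = c''"
proof (intro ext)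
  fix m k
  show "c' m k = c'' m k"
  proof (cases "m < depth t (Suc n) k")
    case True then show ?thesis using assms(3) by (auto simp: agree_def)
  next
    case False then show ?thesis using assms(1,2) unfolding ext_def by auto
  qed
qed

text \<open>Half of a lower bound for the number of children. It depends neither on \<open>n\<close>
  nor on the cube, so all nodes of the tree of kept cubes branch equally.\<close>

definition kept :: "real \<Rightarrow> nat" where
  "kept t = (\<Prod>k\<in>UNIV. M k ^ nat \<lfloor>t / l k\<rfloor>) div 2"

lemma finite_ext: "finite (ext t n c)"
  unfolding ext_def by (rule card_funcs_block)

lemma card_ext: assumes "0 \<le> t" shows "2 * kept t \<le> card (ext t n c)"
proof -
  have "2 * kept t \<le> (\<Prod>k\<in>UNIV. M k ^ nat \<lfloor>t / l k\<rfloor>)" by (simp add: kept_def)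
  also have "\<dots> \<le> (\<Prod>k\<in>UNIV. M k ^ (depth t (Suc n) k - depth t n k))"
  proof (intro prod_mono conjI power_increasing)
    fix k show "nat \<lfloor>t / l k\<rfloor> \<le> depth t (Suc n) k - depth t n k"
      using depth_Suc[OF assms, of n k] by linarith
    show "1 \<le> M k" using M_ge_2[of k] by simp
  qed simp
  also have "\<dots> = card (ext t n c)" unfolding ext_def by (simp add: card_funcs_block)
  finally show ?thesis .
qed

text \<open>Admissibility of the stage length \<open>t\<close>: inside an approximate cube, changing one digit of
  coordinate \<open>i\<close> moves the faster coordinates by at most \<open>\<epsilon>\<close> times the side.\<close>

definition \<epsilon> :: real where "\<epsilon> = \<eta> * exp (- l_max) / (8 * CARD('d))"

definition admissible :: "real \<Rightarrow> bool" where
  "admissible t \<longleftrightarrow> 0 < t \<and> (\<forall>k. 2 * l k \<le> t) \<and> exp (- t) \<le> \<epsilon> \<and>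
     (\<forall>i j. l i < l j \<longrightarrow> exp (- t * (l j / l i - 1)) \<le> \<epsilon>)"

lemma \<epsilon>_pos: "0 < \<epsilon>" using \<eta>_pos by (simp add: \<epsilon>_def)

lemma eventually_admissible: "eventually admissible at_top"
  unfolding admissible_def
proof (intro eventually_conj eventually_all_finite allI)
  show "\<forall>\<^sub>F t in at_top. 0 < (t::real)" by (rule eventually_gt_at_top)
  show "\<forall>\<^sub>F t in at_top. 2 * l k \<le> t" for k by (rule eventually_ge_at_top)
  have *: "\<forall>\<^sub>F t in at_top. exp (- t * a) \<le> \<epsilon>" if "a > 0" for a :: real
    using eventually_ge_at_top[of "- ln \<epsilon> / a"]
  proof eventually_elim
    case (elim t)
    then have "- t * a \<le> ln \<epsilon>" using that by (simp add: field_simps)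
    then show ?case using \<epsilon>_pos by (metis exp_le_cancel_iff exp_ln)
  qed
  show "\<forall>\<^sub>F t in at_top. exp (- t) \<le> \<epsilon>" using *[of 1] by simp
  show "\<forall>\<^sub>F t in at_top. l i < l j \<longrightarrow> exp (- t * (l j / l i - 1)) \<le> \<epsilon>" for i j
  proof (cases "l i < l j")
    case True
    then have "l j / l i - 1 > 0" using l_pos[of i] by simp
    from *[OF this] show ?thesis by simp
  qed simp
qed

text \<open>The map \<open>flip\<close> alters the first new digit of coordinate \<open>i\<close>
  and sends \<open>Bad\<close> injectively into its complement in \<open>ext t n c\<close>. It moves
  coordinate \<open>i\<close> of the point by at least \<open>\<eta> * exp (- l_max)\<close> times
  the side and every other coordinate by at most \<open>\<epsilon>\<close> times the side; as the
  coefficient of \<open>i\<close> is the largest, the two values of \<open>F\<close> cannot both be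
  small.\<close>

lemma card_near_hyperplane:
  fixes A :: "'d \<Rightarrow> real" and B :: real
  assumes t: "admissible t" and n: "1 \<le> n" and c: "c \<in> codes" and i: "\<And>j. \<bar>A j\<bar> \<le> \<bar>A i\<bar>" "A i \<noteq> 0"
  defines "F \<equiv> \<lambda>x :: real ^ 'd. (\<Sum>j\<in>UNIV. A j * x $ j) + B"
  defines "Bad \<equiv> {g \<in> ext t n c. \<exists>g'\<in>codes. agree t (Suc n) g g' \<and>
              \<bar>F (X g')\<bar> < \<bar>A i\<bar> * (\<eta> * exp (- l_max) / 4 * exp (- t * n))}"
  shows "2 * card Bad \<le> card (ext t n c)"
proof -
  define s where "s = exp (- t * n)"
  have t0: "0 \<le> t" using t by (simp add: admissible_def)
  have s: "s > 0" by (simp add: s_def)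
  have s_Suc: "exp (- t * Suc n) \<le> \<epsilon> * s"
  proof -
    have "exp (- t * Suc n) = exp (- t) * s" by (simp add: s_def exp_add[symmetric] algebra_simps)
    also have "\<dots> \<le> \<epsilon> * s" using t s by (intro mult_right_mono) (auto simp: admissible_def)
    finally show ?thesis .
  qed
  have F_diff: "\<bar>F x - F y\<bar> \<le> \<bar>A i\<bar> * (\<Sum>j\<in>UNIV. \<bar>x $ j - y $ j\<bar>)" for x y
  proof -
    have "F x - F y = (\<Sum>j\<in>UNIV. A j * (x $ j - y $ j))"
      by (simp add: F_def sum_subtractf right_diff_distrib)
    also have "\<bar>\<dots>\<bar> \<le> (\<Sum>j\<in>UNIV. \<bar>A j * (x $ j - y $ j)\<bar>)" by (rule sum_abs)
    also have "\<dots> \<le> (\<Sum>j\<in>UNIV. \<bar>A i\<bar> * \<bar>x $ j - y $ j\<bar>)"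
      unfolding abs_mult using i by (intro sum_mono mult_right_mono) auto
    finally show ?thesis by (simp add: sum_distrib_left)
  qed
  define p where "p = depth t n i"
  have p_less: "p < depth t (Suc n) i"
  proof -
    have "2 * l i \<le> t" using t by (auto simp: admissible_def)
    then have "1 \<le> nat \<lfloor>t / l i\<rfloor>" using l_pos[of i] by (simp add: le_nat_iff le_floor_iff field_simps)
    then show ?thesis using depth_Suc[OF t0, of n i] by (simp add: p_def)
  qed
  \<comment> \<open>A cyclic shift of one digit: it has no fixed point because \<open>M i\<close> is
    at least 2, and it is injective because the other digits stay.\<close>
  define flip where "flip g = g(p := (g p)(i := Suc (g p i) mod M i))" for g :: "nat \<Rightarrow> 'd \<Rightarrow> nat"
  have flip: "flip g m j = (if m = p \<and> j = i then Suc (g p i) mod M i else g m j)" for g m j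
    by (simp add: flip_def)
  have flip_ext: "flip g \<in> ext t n c" if "g \<in> ext t n c" for g
    unfolding ext_def mem_Collect_eq
  proof (intro allI)
    fix m k
    show "if depth t n k \<le> m \<and> m < depth t (Suc n) k then flip g m k < M k else flip g m k = c m k"
    proof (cases "m = p \<and> k = i")
      case True
      then show ?thesis using p_less M_ge_2[of i] by (auto simp: flip p_def)
    next
      case False
      then show ?thesis using that by (auto simp: flip ext_def)
    qed
  qed
  have gp: "g p i < M i" if "g \<in> ext t n c" for g
    using that p_less by (auto simp: ext_def p_def)
  have flip_neq: "Suc v mod M i \<noteq> v" if "v < M i" for v
    using that M_ge_2[of i] by (cases "Suc v = M i") auto
  have flip_inj: "inj_on flip (ext t n c)"
  proof (rule inj_onI)
    fix g h assume gh: "g \<in> ext t n c" "h \<in> ext t n c" "flip g = flip h"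
    have "Suc (g p i) mod M i = Suc (h p i) mod M i"
      using fun_cong[OF fun_cong[OF gh(3)], of p i] by (simp add: flip)
    then have "g p i = h p i"
      using gp[OF gh(1)] gp[OF gh(2)] by (auto simp: mod_Suc split: if_splits)
    moreover have "g m j = h m j" if "\<not> (m = p \<and> j = i)" for m j
      using fun_cong[OF fun_cong[OF gh(3)], of m j] that by (auto simp: flip split: if_splits)
    ultimately show "g = h" by (intro HOL.ext) (metis)
  qed
  \<comment> \<open>Replaces an arbitrary code of the child by its representative, at the cost of
    \<open>\<epsilon> * s\<close> in each coordinate.\<close>
  have step: "\<bar>F (X g)\<bar> < \<bar>A i\<bar> * (\<eta> * exp (- l_max) / 4 * s + CARD('d) * (\<epsilon> * s))" if g: "g \<in> Bad" for g
  proof -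
    obtain g' where g': "g' \<in> codes" "agree t (Suc n) g g'"
        "\<bar>F (X g')\<bar> < \<bar>A i\<bar> * (\<eta> * exp (- l_max) / 4 * s)"
      using g by (auto simp: Bad_def s_def)
    have gc: "g \<in> codes" using g c ext_codes by (auto simp: Bad_def)
    have "\<bar>F (X g) - F (X g')\<bar> \<le> \<bar>A i\<bar> * (\<Sum>j\<in>(UNIV::'d set). \<epsilon> * s)"
      using agree_dist[OF t0 gc g'(1,2)] s_Suc
      by (intro order_trans[OF F_diff] mult_left_mono sum_mono) (auto intro: order_trans)
    then have "\<bar>F (X g) - F (X g')\<bar> \<le> \<bar>A i\<bar> * (CARD('d) * (\<epsilon> * s))" by simp
    moreover have "\<bar>F (X g)\<bar> \<le> \<bar>F (X g')\<bar> + \<bar>F (X g) - F (X g')\<bar>" by linarith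
    ultimately show ?thesis using g'(3) unfolding distrib_left by linarith
  qed
  have flip_bad: "flip g \<notin> Bad" if g: "g \<in> Bad" for g
  proof
    assume fb: "flip g \<in> Bad"
    have ge: "g \<in> ext t n c" using g by (simp add: Bad_def)
    note fe = flip_ext[OF ge]
    have gc: "g \<in> codes" "flip g \<in> codes" using ge fe c ext_codes by auto
    have gc': "\<And>m k. g m k < M k" "\<And>m k. flip g m k < M k" using gc by (auto simp: codes_def)
    have oth: "\<bar>X g $ j - X (flip g) $ j\<bar> \<le> \<epsilon> * s" if "j \<noteq> i" for j
    proof (cases "l j < l i")
      \<comment> \<open>Smaller exponent: the altered digit has no influence, so the codes agree at
        all relevant digits and the depth of the next stage may be taken.\<close>
      case True
      have "\<bar>X g $ j - X (flip g) $ j\<bar> \<le> exp (- real (depth t (Suc n) j) * l j)"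
        using gc' True by (intro contract) (auto simp: flip)
      also have "\<dots> \<le> exp (- t * Suc n)" using depth_ge[of t "Suc n" j] by simp
      also note s_Suc
      finally show ?thesis .
    next
      case False
      then have ij: "l i < l j" using that l_inj by (metis injD linorder_neqE)
      \<comment> \<open>Larger exponent: the codes agree below level \<open>p\<close>, where
        \<open>p * l i\<close> is at least \<open>t * n\<close>. As \<open>n\<close> is at least 1,
        the bound is smaller than the side by at least the factor
        \<open>exp (- t * (l j / l i - 1))\<close>.\<close>
      have "\<bar>X g $ j - X (flip g) $ j\<bar> \<le> exp (- real p * l j)"
        using gc' by (intro contract) (auto simp: flip)
      also have "\<dots> \<le> exp (- t * (l j / l i - 1)) * s"
      proof -
        define x where "x = l j / l i - 1"
        have x: "x > 0" using ij l_pos[of i] by (simp add: x_def)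
        have "l j = l i * (1 + x)" using l_pos[of i] by (simp add: x_def field_simps)
        then have "real p * l j = (real p * l i) * (1 + x)" by simp
        also have "\<dots> \<ge> (t * n) * (1 + x)"
          using depth_ge[of t n i] x by (intro mult_right_mono) (auto simp: p_def)
        also have "(t * n) * (1 + x) = t * n + (t * x) * n" by (simp add: algebra_simps)
        also have "\<dots> \<ge> t * n + (t * x) * 1"
          using n t0 x by (intro add_left_mono mult_left_mono) auto
        finally show ?thesis
          unfolding x_def[symmetric] s_def by (simp add: exp_add[symmetric] algebra_simps)
      qed
      also have "\<dots> \<le> \<epsilon> * s"
        using t ij s by (intro mult_right_mono) (auto simp: admissible_def)
      finally show ?thesis .
    qed
    define a where "a j = A j * (X g $ j - X (flip g) $ j)" for j
    have "\<bar>A i\<bar> * (\<eta> * exp (- l_max) * s) \<le> \<bar>a i\<bar>"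
    proof -
      have "\<eta> * exp (- l_max) * s = \<eta> * exp (- t * n - l_max)"
        by (simp add: s_def exp_add[symmetric])
      also have "\<dots> \<le> \<eta> * exp (- real p * l i)"
        using depth_le[OF t0, of n i] l_le_max[of i] \<eta>_pos by (simp add: p_def)
      also have "\<dots> \<le> \<bar>X g $ i - X (flip g) $ i\<bar>"
        using gc' flip_neq[OF gp[OF ge]] by (intro separate) (auto simp: flip)
      finally show ?thesis unfolding a_def abs_mult by (intro mult_left_mono) auto
    qed
    moreover have "\<bar>\<Sum>j\<in>UNIV - {i}. a j\<bar> \<le> \<bar>A i\<bar> * (CARD('d) * (\<epsilon> * s))"
    proof -
      have "\<bar>\<Sum>j\<in>UNIV - {i}. a j\<bar> \<le> (\<Sum>j\<in>UNIV - {i}. \<bar>A i\<bar> * (\<epsilon> * s))"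
        unfolding a_def using oth i
        by (intro order_trans[OF sum_abs] sum_mono) (auto simp: abs_mult intro!: mult_mono)
      also have "\<dots> \<le> (\<Sum>j\<in>(UNIV::'d set). \<bar>A i\<bar> * (\<epsilon> * s))"
        using \<epsilon>_pos s by (intro sum_mono2) auto
      finally show ?thesis by (simp add: mult_ac)
    qed
    moreover have "F (X g) - F (X (flip g)) = a i + (\<Sum>j\<in>UNIV - {i}. a j)"
    proof -
      have "F (X g) - F (X (flip g)) = (\<Sum>j\<in>UNIV. a j)"
        by (simp add: F_def a_def sum_subtractf right_diff_distrib)
      also have "\<dots> = a i + (\<Sum>j\<in>UNIV - {i}. a j)" by (rule sum.remove) auto
      finally show ?thesis .
    qed
    moreover have "\<bar>F (X g) - F (X (flip g))\<bar>
         < 2 * (\<bar>A i\<bar> * (\<eta> * exp (- l_max) / 4 * s + CARD('d) * (\<epsilon> * s)))"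
      using step[OF g] step[OF fb] by linarith
    \<comment> \<open>In units of \<open>W\<close> the change of \<open>F\<close> is at least 1 -
      1/8, whereas two bad values differ by less than 2 (1/4 + 1/8). The 4 in the threshold and the
      8 in \<open>\<epsilon>\<close> are chosen to make these incompatible.\<close>
    moreover define W where "W = \<bar>A i\<bar> * (\<eta> * exp (- l_max) * s)"
    moreover have "\<bar>A i\<bar> * (CARD('d) * (\<epsilon> * s)) = W / 8" by (simp add: \<epsilon>_def W_def)
    moreover have "\<bar>A i\<bar> * (\<eta> * exp (- l_max) / 4 * s + CARD('d) * (\<epsilon> * s)) = W / 4 + W / 8"
      by (simp add: \<epsilon>_def W_def algebra_simps)
    moreover have "0 < W" using i(2) \<eta>_pos s by (simp add: W_def)
    ultimately show False by linarith
  qed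
  have "card Bad + card (flip ` Bad) \<le> card (ext t n c)"
  proof (subst card_Un_disjoint[symmetric])
    have Bsub: "Bad \<subseteq> ext t n c" by (auto simp: Bad_def)
    then show "finite Bad" "finite (flip ` Bad)" using finite_ext finite_subset by blast+
    show "Bad \<inter> flip ` Bad = {}" using flip_bad by auto
    show "card (Bad \<union> flip ` Bad) \<le> card (ext t n c)"
      using Bsub flip_ext by (intro card_mono finite_ext) auto
  qed
  moreover have "card (flip ` Bad) = card Bad"
    using flip_inj by (intro card_image) (auto simp: Bad_def inj_on_def)
  ultimately show ?thesis by simp
qed

text \<open>The simplex lemma confines the rationals of small height near an approximate cube to one
  hyperplane, and at least half of the children of the cube stay away from it.\<close>

lemma good_children:
  assumes t: "admissible t" and K: "\<And>(c :: real ^ 'd) R. R > 0 \<Longrightarrow> \<exists>(A :: 'd \<Rightarrow> int) B. (\<exists>i. A i \<noteq> 0) \<and>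
       (\<forall>(q::nat) (r :: 'd \<Rightarrow> int). 1 \<le> q \<longrightarrow> R \<le> K * real q powr (- (1 + 1 / real CARD('d))) \<longrightarrow>
          (\<forall>i. \<bar>r i / q - c $ i\<bar> \<le> R) \<longrightarrow> (\<Sum>i\<in>UNIV. A i * r i) + B * int q = 0)"
    and n: "1 \<le> n" and c: "c \<in> codes"
  obtains g :: "nat \<Rightarrow> nat \<Rightarrow> 'd \<Rightarrow> nat"
  where "inj_on g {..<kept t}" "\<And>u. u < kept t \<Longrightarrow> g u \<in> ext t n c"
    "\<And>u c' (q::nat) (r :: 'd \<Rightarrow> int). \<lbrakk>u < kept t; c' \<in> codes; agree t (Suc n) (g u) c'; 1 \<le> q;
        2 * exp (- t * n) \<le> K * real q powr (- (1 + 1 / real CARD('d)))\<rbrakk>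
        \<Longrightarrow> \<exists>i. min 1 (2 * \<epsilon>) * exp (- t * n) \<le> \<bar>X c' $ i - r i / q\<bar>"
proof -
  define s where "s = exp (- t * n)"
  have t0: "0 \<le> t" using t by (simp add: admissible_def)
  have s: "s > 0" by (simp add: s_def)
  \<comment> \<open>Radius twice the side: points of the cube are within \<open>s\<close> of
    \<open>X c\<close> in each coordinate, so a rational outside this box is at least
    \<open>s\<close> away from them in some coordinate.\<close>
  obtain A :: "'d \<Rightarrow> int" and B :: int where A: "\<exists>i. A i \<noteq> 0"
    and AB: "\<forall>(q::nat) (r :: 'd \<Rightarrow> int). 1 \<le> q \<longrightarrow> 2 * s \<le> K * real q powr (- (1 + 1 / real CARD('d))) \<longrightarrow>
          (\<forall>i. \<bar>r i / q - X c $ i\<bar> \<le> 2 * s) \<longrightarrow> (\<Sum>i\<in>UNIV. A i * r i) + B * int q = 0"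
    using K[of "2 * s" "X c", OF mult_pos_pos[OF zero_less_numeral s]] by blast
  define A' where "A' j = real_of_int (A j)" for j
  define F where "F x = (\<Sum>j\<in>UNIV. A' j * x $ j) + B" for x :: "real ^ 'd"
  obtain i where i: "\<And>j. \<bar>A' j\<bar> \<le> \<bar>A' i\<bar>"
    using ex_is_arg_min_if_finite[of UNIV "\<lambda>j. - \<bar>A' j\<bar>"] by (auto simp: is_arg_min_linorder)
  obtain j0 where "A j0 \<noteq> 0" using A by auto
  then have i0: "A' i \<noteq> 0" using i[of j0] by (auto simp: A'_def)
  define Bad where "Bad = {g \<in> ext t n c. \<exists>g'\<in>codes. agree t (Suc n) g g' \<and>
              \<bar>F (X g')\<bar> < \<bar>A' i\<bar> * (\<eta> * exp (- l_max) / 4 * s)}"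
  have "2 * card Bad \<le> card (ext t n c)"
    unfolding Bad_def F_def s_def by (rule card_near_hyperplane[where A = A' and i = i, OF t n c]) (rule i, rule i0)
  moreover have "card (ext t n c - Bad) = card (ext t n c) - card Bad"
    by (intro card_Diff_subset) (auto simp: Bad_def intro: finite_subset[OF _ finite_ext])
  ultimately have "kept t \<le> card (ext t n c - Bad)" using card_ext[OF t0, of n c] by linarith
  then obtain G where G: "G \<subseteq> ext t n c - Bad" "card G = kept t" "finite G"
    by (meson obtain_subset_with_card_n)
  obtain g where g: "bij_betw g {0..<kept t} G" using ex_bij_betw_nat_finite[OF G(3)] G(2) by auto
  have gG: "g u \<in> G" if "u < kept t" for u using g that by (auto simp: bij_betw_def)
  show thesis
  proof
    show "inj_on g {..<kept t}" using g by (simp add: bij_betw_def atLeast0LessThan)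
    show "g u \<in> ext t n c" if "u < kept t" for u using gG[OF that] G by auto
    fix u c' and q :: nat and r :: "'d \<Rightarrow> int"
    assume u: "u < kept t" and c': "c' \<in> codes" "agree t (Suc n) (g u) c'" and q: "1 \<le> q"
      "2 * exp (- t * n) \<le> K * real q powr (- (1 + 1 / real CARD('d)))"
    show "\<exists>i. min 1 (2 * \<epsilon>) * exp (- t * n) \<le> \<bar>X c' $ i - r i / q\<bar>"
    proof (cases "\<forall>i. \<bar>r i / q - X c $ i\<bar> \<le> 2 * s")
      \<comment> \<open>The rational lies on the hyperplane, so \<open>F\<close> at the point is at
        most the largest coefficient times the sum of the coordinate distances to the
        rational.\<close>
      case True
      have "(\<Sum>i\<in>UNIV. A i * r i) + B * int q = 0" using AB q True unfolding s_def by blast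
      then have "real_of_int ((\<Sum>i\<in>UNIV. A i * r i) + B * int q) = 0" by simp
      then have "(\<Sum>i\<in>UNIV. A' i * (r i / q)) + B = 0"
        using q(1) by (simp add: A'_def sum_divide_distrib[symmetric] field_simps)
      then have "F (X c') = (\<Sum>j\<in>UNIV. A' j * (X c' $ j - r j / q))"
        unfolding right_diff_distrib sum_subtractf F_def by linarith
      also have "\<bar>\<dots>\<bar> \<le> (\<Sum>j\<in>UNIV. \<bar>A' i\<bar> * \<bar>X c' $ j - r j / q\<bar>)"
        using i by (intro order_trans[OF sum_abs] sum_mono) (auto simp: abs_mult intro!: mult_right_mono)
      finally have "\<bar>F (X c')\<bar> \<le> \<bar>A' i\<bar> * (\<Sum>j\<in>UNIV. \<bar>X c' $ j - r j / q\<bar>)"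
        by (simp add: sum_distrib_left)
      moreover have "\<bar>A' i\<bar> * (\<eta> * exp (- l_max) / 4 * s) \<le> \<bar>F (X c')\<bar>"
      proof (rule ccontr)
        assume "\<not> ?thesis"
        then have "\<bar>F (X c')\<bar> < \<bar>A' i\<bar> * (\<eta> * exp (- l_max) / 4 * s)" by (simp only: not_le)
        then have "g u \<in> Bad" using gG[OF u] G(1) c' unfolding Bad_def by blast
        then show False using gG[OF u] G(1) by blast
      qed
      ultimately have "\<eta> * exp (- l_max) / 4 * s \<le> (\<Sum>j\<in>UNIV. \<bar>X c' $ j - r j / q\<bar>)"
        using i0 by (smt (verit) mult_less_cancel_left_pos zero_less_abs_iff)
      \<comment> \<open>By the choice of \<open>\<epsilon>\<close> the threshold amounts to
        \<open>2 * \<epsilon> * s\<close> per coordinate, so some coordinate attains its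
        share.\<close>
      also have "\<eta> * exp (- l_max) / 4 * s = (\<Sum>j\<in>(UNIV::'d set). 2 * \<epsilon> * s)"
        by (simp add: \<epsilon>_def)
      finally obtain j where "2 * \<epsilon> * s \<le> \<bar>X c' $ j - r j / q\<bar>"
        by (meson not_less sum_strict_mono finite UNIV_not_empty)
      then have "min 1 (2 * \<epsilon>) * s \<le> \<bar>X c' $ j - r j / q\<bar>"
        using s by (intro order_trans[OF mult_right_mono[of "min 1 (2 * \<epsilon>)" "2 * \<epsilon>" s]]) auto
      then show ?thesis by (auto simp: s_def)
    next
      case False
      then obtain j where j: "2 * s < \<bar>r j / q - X c $ j\<bar>" by (auto simp: not_le)
      have "agree t n (g u) c'" using agree_mono[OF t0 _ c'(2)] by simp
      moreover have "agree t n c (g u)" using gG[OF u] G(1) ext_agree by auto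
      ultimately have "agree t n c c'" using agree_trans by blast
      from agree_dist[OF t0 c c'(1) this, of j] have "\<bar>X c $ j - X c' $ j\<bar> \<le> s" by (simp add: s_def)
      with j have "s \<le> \<bar>X c' $ j - r j / q\<bar>" by linarith
      then have "min 1 (2 * \<epsilon>) * s \<le> \<bar>X c' $ j - r j / q\<bar>"
        using s by (intro order_trans[OF mult_right_mono[of "min 1 (2 * \<epsilon>)" 1 s]]) auto
      then show ?thesis by (auto simp: s_def)
    qed
  qed
qed

text \<open>Choosing \<open>kept t\<close> good children at every node gives a regular tree. A
  rational is excluded at the first stage whose side is small enough for its denominator; minimality
  of this stage makes the side comparable with the required distance, or else it is stage 1.
  Different branches are kept apart by \<open>not_agree_dist\<close>, and the branching bound gives
  the dimension.\<close>

lemma badly_approximable_subtree: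
  assumes t: "admissible t" and kept: "2 \<le> kept t"
  shows "ennreal (ln (kept t) / t) \<le> hausdorff_dim (X ` codes \<inter> badly_approximable)"
proof -
  have t0: "0 < t" using t by (simp add: admissible_def)
  then have t0': "0 \<le> t" by simp
  define \<rho> where "\<rho> = 1 + 1 / real CARD('d)"
  obtain K where K: "K > 0" "\<And>(c :: real ^ 'd) R. R > 0 \<Longrightarrow> \<exists>(A :: 'd \<Rightarrow> int) B. (\<exists>i. A i \<noteq> 0) \<and>
       (\<forall>(q::nat) (r :: 'd \<Rightarrow> int). 1 \<le> q \<longrightarrow> R \<le> K * real q powr (- (1 + 1 / real CARD('d))) \<longrightarrow>
          (\<forall>i. \<bar>r i / q - c $ i\<bar> \<le> R) \<longrightarrow> (\<Sum>i\<in>UNIV. A i * r i) + B * int q = 0)"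
    by (rule simplex_lemma) blast
  define far where "far n c' \<longleftrightarrow> (\<forall>(q::nat) (r :: 'd \<Rightarrow> int). 1 \<le> q \<longrightarrow>
        2 * exp (- t * n) \<le> K * real q powr (- \<rho>)
        \<longrightarrow> (\<exists>i. min 1 (2 * \<epsilon>) * exp (- t * n) \<le> \<bar>X c' $ i - r i / q\<bar>))" for n :: nat and c'
  define good where "good n c g \<longleftrightarrow> inj_on g {..<kept t} \<and> (\<forall>u<kept t. g u \<in> ext t n c) \<and>
          (\<forall>u c'. u < kept t \<longrightarrow> c' \<in> codes \<longrightarrow> agree t (Suc n) (g u) c' \<longrightarrow> far n c')" for n c g
  have "\<exists>g. good n c g" if "1 \<le> n" "c \<in> codes" for n c
  proof (rule good_children[OF t K(2) that])
    fix g assume g: "inj_on g {..<kept t}" "\<And>u. u < kept t \<Longrightarrow> g u \<in> ext t n c"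
      "\<And>u c' (q::nat) (r :: 'd \<Rightarrow> int). \<lbrakk>u < kept t; c' \<in> codes; agree t (Suc n) (g u) c'; 1 \<le> q;
        2 * exp (- t * n) \<le> K * real q powr (- (1 + 1 / real CARD('d)))\<rbrakk>
        \<Longrightarrow> \<exists>i. min 1 (2 * \<epsilon>) * exp (- t * n) \<le> \<bar>X c' $ i - r i / q\<bar>"
    show ?thesis
      unfolding good_def far_def \<rho>_def by (intro exI[of _ g] conjI allI impI g)
  qed
  then obtain G where "\<And>n c. 1 \<le> n \<Longrightarrow> c \<in> codes \<Longrightarrow> good n c (G n c)" by metis
  then have G: "\<And>n c. 1 \<le> n \<Longrightarrow> c \<in> codes \<Longrightarrow> inj_on (G n c) {..<kept t}"
    "\<And>n c u. 1 \<le> n \<Longrightarrow> c \<in> codes \<Longrightarrow> u < kept t \<Longrightarrow> G n c u \<in> ext t n c"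
    "\<And>n c u c'. 1 \<le> n \<Longrightarrow> c \<in> codes \<Longrightarrow> u < kept t \<Longrightarrow> c' \<in> codes \<Longrightarrow>
        agree t (Suc n) (G n c u) c' \<Longrightarrow> far n c'"
    unfolding good_def by blast+
  \<comment> \<open>Stages are shifted by one, because good children are available from stage 1 on;
    the root is the zero code.\<close>
  define nd where "nd u = rec_nat (\<lambda>_ _. 0) (\<lambda>n c. G (Suc n) c (u n))" for u :: "nat \<Rightarrow> nat"
  have nd0: "nd u 0 = (\<lambda>_ _. 0)" and nd_Suc: "nd u (Suc n) = G (Suc n) (nd u n) (u n)" for u n
    by (simp_all add: nd_def)
  let ?U = "UNIV \<rightarrow> {..<kept t}"
  have M_pos: "0 < M k" for k using M_ge_2[of k] by simp
  have nd_codes: "nd u n \<in> codes" if "u \<in> ?U" for u n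
  proof (induction n)
    case 0 show ?case using M_pos by (simp add: nd0 codes_def)
  next
    case (Suc n)
    have "G (Suc n) (nd u n) (u n) \<in> ext t (Suc n) (nd u n)" using that Suc by (intro G(2)) auto
    then show ?case using Suc ext_codes by (auto simp: nd_Suc)
  qed
  have nd_step: "agree t (Suc n) (nd u n) (nd u (Suc n))" if "u \<in> ?U" for u n
    unfolding nd_Suc using that nd_codes[OF that] by (intro ext_agree G(2)) auto
  have nd_agree: "agree t (Suc n) (nd u n) (nd u n')" if u: "u \<in> ?U" and "n \<le> n'" for u n n'
    using that(2)
  proof (induction n' rule: dec_induct)
    case base show ?case by (simp add: agree_def)
  next
    case (step n')
    have "agree t (Suc n) (nd u n') (nd u (Suc n'))"
      using step nd_step[OF u, of n'] by (intro agree_mono[OF t0', of "Suc n" "Suc n'"]) auto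
    then show ?case using step agree_trans by blast
  qed
  \<comment> \<open>Level \<open>m\<close> is settled by stage \<open>m + 1\<close>, thanks to the
    lower bound on \<open>t\<close> in \<open>admissible\<close>. Therefore the diagonal
    \<open>lm\<close> below is the limit of the nodes.\<close>
  have depth_gt: "m < depth t (Suc m) k" for m k
  proof -
    have "2 * l k \<le> t" using t by (simp add: admissible_def)
    then have "l k * Suc m \<le> t * Suc m" using l_pos[of k] by (intro mult_right_mono) auto
    also have "\<dots> \<le> depth t (Suc m) k * l k" by (rule depth_ge)
    finally have "real (Suc m) \<le> depth t (Suc m) k" using l_pos[of k] by (simp add: mult.commute)
    then show ?thesis by linarith
  qed
  define lm where "lm u = (\<lambda>m. nd u m m)" for u
  have lm_codes: "lm u \<in> codes" if "u \<in> ?U" for u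
    using nd_codes[OF that] by (auto simp: lm_def codes_def)
  have lm_agree: "agree t (Suc n) (nd u n) (lm u)" if u: "u \<in> ?U" for u n
    unfolding agree_def
  proof (intro allI impI)
    fix k m assume m: "m < depth t (Suc n) k"
    show "nd u n m k = lm u m k"
    proof (cases "n \<le> m")
      case True
      then show ?thesis using nd_agree[OF u True] m by (auto simp: agree_def lm_def)
    next
      case False
      then have "agree t (Suc m) (nd u m) (nd u n)" using nd_agree[OF u, of m n] by simp
      then show ?thesis using depth_gt[of m k] by (auto simp: agree_def lm_def)
    qed
  qed
  have far: "far n (lm u)" if u: "u \<in> ?U" and n: "1 \<le> n" for n u
  proof -
    obtain n' where n': "n = Suc n'" using n by (cases n) auto
    show ?thesis
      using lm_agree[OF u, of n] u unfolding n'
      by (intro G(3)[of "Suc n'" "nd u n'" "u n'"]) (auto simp: nd_Suc nd_codes lm_codes)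
  qed
  have BA: "X (lm u) \<in> badly_approximable" if u: "u \<in> ?U" for u
  proof -
    define \<delta> where "\<delta> = min 1 (2 * \<epsilon>)"
    have \<delta>: "\<delta> > 0" using \<epsilon>_pos by (simp add: \<delta>_def)
    \<comment> \<open>The first entry serves denominators handled at stage 1, the second those for
      which minimality of the stage bounds \<open>K * q powr (- \<rho>)\<close> by twice the
      preceding side.\<close>
    define C where "C = min (\<delta> * exp (- t)) (\<delta> * exp (- t) * K / 2)"
    have C: "C > 0" using \<delta> K by (simp add: C_def)
    have "C * real q powr (- \<rho>) \<le> norm (X (lm u) - (\<chi> i. real_of_int (r $ i) / real q))"
      if q: "1 \<le> q" for q :: nat and r :: "int ^ 'd"
    proof -
      define P where "P n \<longleftrightarrow> 1 \<le> n \<and> 2 * exp (- t * n) \<le> K * real q powr (- \<rho>)" for n :: nat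
      define n where "n = (LEAST n. P n)"
      have "\<exists>n. P n"
      proof -
        have "K * real q powr (- \<rho>) > 0" using K q by simp
        moreover obtain n0 :: nat where "- ln (K * real q powr (- \<rho>) / 2) / t \<le> n0"
          using real_arch_simple by blast
        ultimately have "- t * Suc n0 \<le> ln (K * real q powr (- \<rho>) / 2)"
          using t0 by (simp add: field_simps)
        then have "exp (- t * Suc n0) \<le> exp (ln (K * real q powr (- \<rho>) / 2))" by simp
        also have "\<dots> = K * real q powr (- \<rho>) / 2" using K q by (intro exp_ln) auto
        finally have "exp (- t * Suc n0) \<le> K * real q powr (- \<rho>) / 2" .
        then show ?thesis by (intro exI[of _ "Suc n0"]) (simp add: P_def)
      qed
      then have Pn: "P n" "\<And>n'. n' < n \<Longrightarrow> \<not> P n'" unfolding n_def by (auto intro: LeastI dest: not_less_Least)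
      have "C * real q powr (- \<rho>) \<le> \<delta> * exp (- t * n)"
      proof (cases "n = 1")
        case True
        have "real q powr (- \<rho>) \<le> 1"
        proof -
          have "0 \<le> 1 / real CARD('d)" by simp
          then have "- \<rho> \<le> 0" unfolding \<rho>_def by linarith
          from powr_mono[OF this, of "real q"] show ?thesis using q by simp
        qed
        then have "C * real q powr (- \<rho>) \<le> \<delta> * exp (- t) * 1"
          using C by (intro mult_mono) (auto simp: C_def)
        then show ?thesis using True by simp
      next
        case False
        define n' where "n' = n - 1"
        have n': "n = Suc n'" "1 \<le> n'" using False Pn(1) by (auto simp: P_def n'_def)
        have "K * real q powr (- \<rho>) < 2 * exp (- t * n')"
          using Pn(2)[of n'] n' by (auto simp: P_def)
        then have "\<delta> * exp (- t) * (K * real q powr (- \<rho>)) \<le> \<delta> * exp (- t) * (2 * exp (- t * n'))"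
          using \<delta> by (intro mult_left_mono) auto
        moreover have "exp (- t * n) = exp (- t) * exp (- t * n')"
          unfolding n' by (simp add: exp_add[symmetric] algebra_simps)
        moreover have "C * real q powr (- \<rho>) \<le> (\<delta> * exp (- t) * K / 2) * real q powr (- \<rho>)"
          by (intro mult_right_mono) (auto simp: C_def)
        ultimately show ?thesis by (simp add: mult_ac)
      qed
      also obtain i where "\<delta> * exp (- t * n) \<le> \<bar>X (lm u) $ i - (r $ i) / q\<bar>"
        using far[OF u, of n] Pn(1) q unfolding far_def P_def \<delta>_def by metis
      then have "\<delta> * exp (- t * n) \<le> \<bar>(X (lm u) - (\<chi> i. real_of_int (r $ i) / real q)) $ i\<bar>" by simp
      also have "\<dots> \<le> norm (X (lm u) - (\<chi> i. real_of_int (r $ i) / real q))"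
        by (rule component_le_norm_cart)
      finally show ?thesis .
    qed
    then show ?thesis unfolding badly_approximable_def \<rho>_def using C by blast
  qed
  \<comment> \<open>The extra factor \<open>exp (- t)\<close> comes from the shift of stages:
    branches that part before step \<open>n\<close> disagree at stage \<open>n + 1\<close>.\<close>
  have sep: "\<eta> * exp (- l_max) * exp (- t) * exp (- t * real n) \<le> dist (X (lm u)) (X (lm v))"
    if uv: "u \<in> ?U" "v \<in> ?U" "\<exists>i<n. u i \<noteq> v i" for u v n
  proof -
    define i where "i = (LEAST i. u i \<noteq> v i)"
    have i: "u i \<noteq> v i" "\<And>j. j < i \<Longrightarrow> u j = v j"
      unfolding i_def using uv(3) LeastI_ex[of "\<lambda>i. u i \<noteq> v i"] by (auto dest: not_less_Least)
    have "i < n" using uv(3) i(2) by (metis linorder_neqE_nat order_less_trans)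
    have nd_eq: "nd u j = nd v j" if "j \<le> i" for j
      using that by (induction j) (auto simp: nd0 nd_Suc i(2))
    have "\<not> agree t (Suc (Suc i)) (nd u (Suc i)) (nd v (Suc i))"
    proof
      assume "agree t (Suc (Suc i)) (nd u (Suc i)) (nd v (Suc i))"
      then have "G (Suc i) (nd u i) (u i) = G (Suc i) (nd u i) (v i)"
        using nd_eq[of i] uv nd_codes[OF uv(1), of i]
        by (intro ext_agree_eq[of _ t "Suc i" "nd u i"] G(2)) (auto simp: nd_Suc)
      then show False
        using G(1)[of "Suc i" "nd u i"] nd_codes[OF uv(1)] i(1) uv(1,2) by (auto simp: inj_on_def Pi_iff)
    qed
    then have "\<not> agree t (Suc (Suc i)) (lm u) (lm v)"
      using lm_agree[OF uv(1), of "Suc i"] lm_agree[OF uv(2), of "Suc i"] agree_trans agree_sym by blast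
    then have "\<not> agree t (Suc n) (lm u) (lm v)"
      using agree_mono[OF t0', of "Suc (Suc i)" "Suc n"] \<open>i < n\<close> by auto
    from not_agree_dist[OF t0' lm_codes[OF uv(1)] lm_codes[OF uv(2)] this]
    show ?thesis by (simp add: mult.assoc exp_add[symmetric] algebra_simps)
  qed
  have "ennreal (ln (kept t) / t) \<le> hausdorff_dim ((\<lambda>u. X (lm u)) ` ?U)"
    using sep \<eta>_pos by (intro hausdorff_dim_ge_branching[OF kept t0, of "\<eta> * exp (- l_max) * exp (- t)"]) auto
  also have "\<dots> \<le> hausdorff_dim (X ` codes \<inter> badly_approximable)"
    using BA lm_codes by (intro hausdorff_dim_mono) auto
  finally show ?thesis .
qed

text \<open>Rounding the number of levels down loses at most the sum of the \<open>ln (M k)\<close>,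
  and discarding half of the children at most \<open>ln 4\<close>. The constant \<open>C\<close>
  collects both, and \<open>C / t\<close> becomes arbitrarily small.\<close>

theorem hausdorff_dim_badly_approximable_ge:
  "ennreal (\<Sum>k\<in>UNIV. ln (M k) / l k) \<le> hausdorff_dim (X ` codes \<inter> badly_approximable)"
proof (rule ennreal_le_epsilon)
  fix e :: real assume e: "0 < e"
  define S where "S = (\<Sum>k\<in>UNIV. ln (M k) / l k)"
  define C where "C = (\<Sum>k\<in>UNIV. ln (M k)) + ln 4"
  have "\<forall>\<^sub>F t in at_top. admissible t \<and> C / e \<le> t"
    using eventually_admissible eventually_ge_at_top by (rule eventually_conj)
  then obtain t where t: "admissible t" "C / e \<le> t" using eventually_happens by fastforce
  have t0: "t > 0" using t by (simp add: admissible_def)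
  define p where "p = (\<Prod>k\<in>UNIV. M k ^ nat \<lfloor>t / l k\<rfloor>)"
  have fl: "2 \<le> nat \<lfloor>t / l k\<rfloor>" for k
    using t l_pos[of k] by (simp add: le_nat_iff le_floor_iff field_simps admissible_def)
  have "4 \<le> p"
  proof -
    obtain k :: 'd where True by blast
    have "(4::nat) = 2 ^ 2" by simp
    also have "\<dots> \<le> M k ^ nat \<lfloor>t / l k\<rfloor>"
      using fl[of k] M_ge_2[of k] by (intro order_trans[OF power_increasing[of 2 "nat \<lfloor>t / l k\<rfloor>" 2]] power_mono) auto
    also have "\<dots> \<le> p"
    proof (rule dvd_imp_le)
      show "M k ^ nat \<lfloor>t / l k\<rfloor> dvd p" unfolding p_def by (intro dvd_prodI) auto
      show "0 < p" unfolding p_def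
      proof (intro prod_pos ballI)
        fix k' show "0 < M k' ^ nat \<lfloor>t / l k'\<rfloor>" using M_ge_2[of k'] by simp
      qed
    qed
    finally show ?thesis .
  qed
  then have kept: "2 \<le> kept t" "p \<le> 4 * kept t" by (auto simp: kept_def p_def[symmetric])
  have M0: "real (M k) > 0" "ln (M k) \<ge> 0" for k using M_ge_2[of k] by auto
  have "ln p = (\<Sum>k\<in>UNIV. nat \<lfloor>t / l k\<rfloor> * ln (M k))"
    unfolding p_def using M0 by (simp add: ln_prod ln_realpow)
  also have "\<dots> \<ge> (\<Sum>k\<in>UNIV. (t / l k - 1) * ln (M k))"
  proof (intro sum_mono mult_right_mono)
    fix k show "t / l k - 1 \<le> real (nat \<lfloor>t / l k\<rfloor>)" by linarith
  qed (rule M0)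
  also have "(\<Sum>k\<in>UNIV. (t / l k - 1) * ln (M k)) = t * S - (C - ln 4)"
    by (simp add: S_def C_def sum_distrib_left left_diff_distrib sum_subtractf)
  finally have "t * S - (C - ln 4) \<le> ln p" .
  also have "ln p \<le> ln (4 * kept t)" using kept \<open>4 \<le> p\<close> by (intro ln_mono) auto
  also have "\<dots> = ln 4 + ln (kept t)" using kept by (simp add: ln_mult)
  finally have "t * S - C \<le> ln (kept t)" by simp
  moreover have "C \<le> t * e" using t(2) e by (simp add: field_simps)
  ultimately have "S \<le> ln (kept t) / t + e" using t0 by (simp add: field_simps)
  then have "ennreal S \<le> ennreal (ln (kept t) / t + e)" by (rule ennreal_leI)
  also have "\<dots> = ennreal (ln (kept t) / t) + ennreal e"
    using t0 e kept by simp
  also have "\<dots> \<le> hausdorff_dim (X ` codes \<inter> badly_approximable) + ennreal e"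
    by (intro add_right_mono badly_approximable_subtree t kept)
  finally show "ennreal (\<Sum>k\<in>UNIV. ln (M k) / l k)
      \<le> hausdorff_dim (X ` codes \<inter> badly_approximable) + ennreal e" by (simp add: S_def)
qed

end

section \<open>Coding maps of interval systems\<close>

lemma contraction_ratio:
  assumes "contracting_similarity f"
  shows "0 < contraction_ratio f" "contraction_ratio f < 1"
    and "\<And>x y. x \<in> {0..1} \<Longrightarrow> y \<in> {0..1} \<Longrightarrow> \<bar>f x - f y\<bar> = contraction_ratio f * \<bar>x - y\<bar>"
    and "\<And>x. x \<in> {0..1} \<Longrightarrow> f x \<in> {0..1}"
proof -
  obtain \<rho> where \<rho>: "0 < \<rho>" "\<rho> < 1" "\<forall>x\<in>{0..1}. \<forall>y\<in>{0..1}. \<bar>f x - f y\<bar> = \<rho> * \<bar>x - y\<bar>"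
    and maps: "f ` {0..1} \<subseteq> {0..1}"
    using assms by (auto simp: contracting_similarity_def)
  have "contraction_ratio f = \<rho>"
    unfolding contraction_ratio_def
  proof (rule the_equality)
    fix r assume "\<forall>x\<in>{0..1}. \<forall>y\<in>{0..1}. \<bar>f x - f y\<bar> = r * \<bar>x - y\<bar>"
    then have "\<bar>f 1 - f 0\<bar> = r" by simp
    moreover have "\<bar>f 1 - f 0\<bar> = \<rho>" using \<rho>(3) by simp
    ultimately show "r = \<rho>" by simp
  qed (rule \<rho>(3))
  with \<rho> show "0 < contraction_ratio f" "contraction_ratio f < 1"
    "\<And>x y. x \<in> {0..1} \<Longrightarrow> y \<in> {0..1} \<Longrightarrow> \<bar>f x - f y\<bar> = contraction_ratio f * \<bar>x - y\<bar>" by auto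
  show "\<And>x. x \<in> {0..1} \<Longrightarrow> f x \<in> {0..1}" using maps by blast
qed

lemma contracting_similarity_affine:
  assumes "contracting_similarity f"
  obtains \<alpha> \<beta> where "\<beta> \<noteq> 0" "\<And>x. x \<in> {0..1} \<Longrightarrow> f x = \<alpha> + \<beta> * x"
    "0 \<le> \<alpha>" "\<alpha> \<le> 1" "0 \<le> \<alpha> + \<beta>" "\<alpha> + \<beta> \<le> 1"
proof
  let ?r = "contraction_ratio f"
  note r = contraction_ratio[OF assms]
  have 01: "\<bar>f 1 - f 0\<bar> = ?r" using r(3)[of 1 0] by simp
  show "f 1 - f 0 \<noteq> 0" using 01 r(1) by simp
  fix x :: real assume x: "x \<in> {0..1}"
  have a: "\<bar>f x - f 0\<bar> = ?r * x" "\<bar>f x - f 1\<bar> = ?r * (1 - x)"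
    using r(3)[of x 0] r(3)[of x 1] x by auto
  have b: "0 \<le> ?r * x" "0 \<le> ?r * (1 - x)" "?r * (1 - x) = ?r - ?r * x"
    using r(1) x by (auto simp: algebra_simps)
  show "f x = f 0 + (f 1 - f 0) * x"
  proof (cases "f 1 - f 0 \<ge> 0")
    case True
    then have "f 1 - f 0 = ?r" using 01 by simp
    moreover from this have "f x - f 0 = ?r * x" using a b by linarith
    ultimately show ?thesis by simp
  next
    case False
    then have "f 1 - f 0 = - ?r" using 01 by simp
    moreover from this have "f x - f 0 = - ?r * x" using a b by auto
    ultimately show ?thesis by simp
  qed
qed (use contraction_ratio(4)[OF assms, of 0] contraction_ratio(4)[OF assms, of 1] in auto)

text \<open>The image is a convex combination, with positive weights, of the two endpoint values,
  which are distinct points of the closed interval.\<close>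

lemma contracting_similarity_open:
  assumes "contracting_similarity f" "x \<in> {0<..<1}" shows "f x \<in> {0<..<1}"
proof -
  obtain \<alpha> \<beta> where f: "\<beta> \<noteq> 0" "\<And>x. x \<in> {0..1} \<Longrightarrow> f x = \<alpha> + \<beta> * x"
    "0 \<le> \<alpha>" "\<alpha> \<le> 1" "0 \<le> \<alpha> + \<beta>" "\<alpha> + \<beta> \<le> 1"
    using contracting_similarity_affine[OF assms(1)] by metis
  have "f x = \<alpha> * (1 - x) + (\<alpha> + \<beta>) * x" using assms(2) f(2) by (simp add: algebra_simps)
  moreover have "a * (1 - x) + b * x > 0" if "0 \<le> a" "0 \<le> b" "a \<noteq> b" for a b
  proof (cases "a = 0")
    case True
    then show ?thesis using that assms(2) by simp
  next
    case False
    then show ?thesis using that assms(2) by (intro add_pos_nonneg) auto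
  qed
  then have "\<alpha> * (1 - x) + (\<alpha> + \<beta>) * x > 0" "(1 - \<alpha>) * (1 - x) + (1 - (\<alpha> + \<beta>)) * x > 0"
    using f by auto
  ultimately show ?thesis by (auto simp: algebra_simps)
qed

text \<open>If the images of two similarities do not overlap, then one of them misses an endpoint
  of the unit interval, and a second application can be chosen so as to miss the other one.\<close>

lemma interior_pair:
  assumes f: "contracting_similarity f" and g: "contracting_similarity g"
    and disj: "f ` {0<..<1} \<inter> g ` {0<..<1} = {}"
  obtains h k where "h \<in> {f, g}" "k \<in> {f, g}" "(\<lambda>x. h (k x)) ` {0..1} \<subseteq> {0<..<1}"
proof -
  have main: "\<exists>h\<in>{f, g}. \<exists>k\<in>{f, g}. \<forall>x\<in>{0..1}. h (k x) \<in> {0<..<1}"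
    if f: "contracting_similarity f" and g: "contracting_similarity g"
    and sep: "\<And>x y. x \<in> {0..1} \<Longrightarrow> y \<in> {0..1} \<Longrightarrow> f x \<le> g y" for f g :: "real \<Rightarrow> real"
  proof -
    note cf = contraction_ratio[OF f] and cg = contraction_ratio[OF g]
    have inj_f: "f x \<noteq> f y" if "x \<in> {0..1}" "y \<in> {0..1}" "x \<noteq> y" for x y
      using cf(3)[OF that(1,2)] cf(1) that(3) by auto
    have inj_g: "g x \<noteq> g y" if "x \<in> {0..1}" "y \<in> {0..1}" "x \<noteq> y" for x y
      using cg(3)[OF that(1,2)] cg(1) that(3) by auto
    have f1: "f x < 1" if x: "x \<in> {0..1}" for x
    proof -
      have "f x \<le> g 0" "f x \<le> g 1" "g 0 \<le> 1" "g 1 \<le> 1" "g 0 \<noteq> g 1"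
        using sep[OF x, of 0] sep[OF x, of 1] cg(4)[of 0] cg(4)[of 1] inj_g[of 0 1] by auto
      then show ?thesis by linarith
    qed
    have g0: "g x > 0" if x: "x \<in> {0..1}" for x
    proof -
      have "f 0 \<le> g x" "f 1 \<le> g x" "f 0 \<ge> 0" "f 1 \<ge> 0" "f 0 \<noteq> f 1"
        using sep[OF _ x, of 0] sep[OF _ x, of 1] cf(4)[of 0] cf(4)[of 1] inj_f[of 0 1] by auto
      then show ?thesis by linarith
    qed
    \<comment> \<open>With \<open>f\<close> to the left of \<open>g\<close>, \<open>f\<close> misses
      1 and \<open>g\<close> misses 0. If \<open>f\<close> fixes 0, then \<open>g\<close> applied
      first avoids 0, the only point that \<open>f\<close> sends there. Otherwise \<open>f\<close>
      is positive on all points below 1, and applying \<open>f\<close> twice works.\<close>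
    show ?thesis
    proof (cases "f 0 = 0")
      case True
      have "f (g x) \<in> {0<..<1}" if "x \<in> {0..1}" for x
        using inj_f[of "g x" 0] True cg(4)[OF that] g0[OF that] f1[of "g x"] cf(4)[of "g x"] by auto
      then show ?thesis by blast
    next
      case False
      have "f (f x) \<in> {0<..<1}" if "x \<in> {0..1}" for x
      proof -
        obtain \<alpha> \<beta> where a: "\<beta> \<noteq> 0" "\<And>x. x \<in> {0..1} \<Longrightarrow> f x = \<alpha> + \<beta> * x"
          "0 \<le> \<alpha>" "\<alpha> \<le> 1" "0 \<le> \<alpha> + \<beta>" "\<alpha> + \<beta> \<le> 1"
          using contracting_similarity_affine[OF f] by metis
        have y: "f x \<in> {0..1}" "f x < 1" using cf(4)[OF that] f1[OF that] by auto
        have "\<alpha> > 0" using False a(2)[of 0] a(3) by auto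
        then have "\<alpha> * (1 - f x) + (\<alpha> + \<beta>) * f x > 0"
          using y a by (intro add_pos_nonneg mult_pos_pos mult_nonneg_nonneg) auto
        then have "f (f x) > 0" using a(2)[OF y(1)] by (simp add: algebra_simps)
        then show ?thesis using f1[OF y(1)] by simp
      qed
      then show ?thesis by blast
    qed
  qed
  obtain \<alpha> \<beta> where a: "\<beta> \<noteq> 0" "\<And>x. x \<in> {0..1} \<Longrightarrow> f x = \<alpha> + \<beta> * x"
    using contracting_similarity_affine[OF f] by metis
  obtain \<gamma> \<delta> where b: "\<delta> \<noteq> 0" "\<And>x. x \<in> {0..1} \<Longrightarrow> g x = \<gamma> + \<delta> * x"
    using contracting_similarity_affine[OF g] by metis
  have fimg: "z \<in> f ` {0<..<1}" if "min (f 0) (f 1) < z" "z < max (f 0) (f 1)" for z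
  proof
    have "f 0 = \<alpha>" "f 1 = \<alpha> + \<beta>" using a(2)[of 0] a(2)[of 1] by auto
    with that a(1) show m: "(z - \<alpha>) / \<beta> \<in> {0<..<1}"
      by (cases "\<beta> > 0") (auto simp: field_simps min_def max_def split: if_splits)
    then show "z = f ((z - \<alpha>) / \<beta>)" using a by (subst a(2)) auto
  qed
  have gimg: "z \<in> g ` {0<..<1}" if "min (g 0) (g 1) < z" "z < max (g 0) (g 1)" for z
  proof
    have "g 0 = \<gamma>" "g 1 = \<gamma> + \<delta>" using b(2)[of 0] b(2)[of 1] by auto
    with that b(1) show m: "(z - \<gamma>) / \<delta> \<in> {0<..<1}"
      by (cases "\<delta> > 0") (auto simp: field_simps min_def max_def split: if_splits)
    then show "z = g ((z - \<gamma>) / \<delta>)" using b by (subst b(2)) auto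
  qed
  have ne: "min (f 0) (f 1) < max (f 0) (f 1)" "min (g 0) (g 1) < max (g 0) (g 1)"
    using a(1) a(2)[of 0] a(2)[of 1] b(1) b(2)[of 0] b(2)[of 1] by auto
  have frange: "min (f 0) (f 1) \<le> f x \<and> f x \<le> max (f 0) (f 1)" if "x \<in> {0..1}" for x
    using a(2)[of 0] a(2)[of 1] a(2)[OF that] that a(1)
    by (cases "\<beta> > 0") (auto simp: min_def max_def mult_le_cancel_left1 mult_less_0_iff zero_le_mult_iff mult_le_0_iff)
  have grange: "min (g 0) (g 1) \<le> g x \<and> g x \<le> max (g 0) (g 1)" if "x \<in> {0..1}" for x
    using b(2)[of 0] b(2)[of 1] b(2)[OF that] that b(1)
    by (cases "\<delta> > 0") (auto simp: min_def max_def mult_le_cancel_left1 mult_less_0_iff zero_le_mult_iff mult_le_0_iff)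
  \<comment> \<open>Of two disjoint open intervals one lies to the left of the other, possibly with
    a common endpoint.\<close>
  have "max (f 0) (f 1) \<le> min (g 0) (g 1) \<or> max (g 0) (g 1) \<le> min (f 0) (f 1)"
  proof (rule ccontr)
    assume "\<not> ?thesis"
    then have "max (min (f 0) (f 1)) (min (g 0) (g 1)) < min (max (f 0) (f 1)) (max (g 0) (g 1))"
      using ne by auto
    then obtain z where "max (min (f 0) (f 1)) (min (g 0) (g 1)) < z" "z < min (max (f 0) (f 1)) (max (g 0) (g 1))"
      using dense by blast
    then have "z \<in> f ` {0<..<1}" "z \<in> g ` {0<..<1}" using fimg[of z] gimg[of z] by simp_all
    then show False using disj by blast
  qed
  then consider "\<And>x y. x \<in> {0..1} \<Longrightarrow> y \<in> {0..1} \<Longrightarrow> f x \<le> g y"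
    | "\<And>x y. x \<in> {0..1} \<Longrightarrow> y \<in> {0..1} \<Longrightarrow> g x \<le> f y"
  proof
    assume "max (f 0) (f 1) \<le> min (g 0) (g 1)"
    then have "f x \<le> g y" if "x \<in> {0..1}" "y \<in> {0..1}" for x y
      using frange[OF that(1)] grange[OF that(2)] by linarith
    then show thesis by (rule that(1))
  next
    assume "max (g 0) (g 1) \<le> min (f 0) (f 1)"
    then have "g x \<le> f y" if "x \<in> {0..1}" "y \<in> {0..1}" for x y
      using grange[OF that(1)] frange[OF that(2)] by linarith
    then show thesis by (rule that(2))
  qed
  then show thesis
  proof cases
    case 1 from main[OF f g this] that show ?thesis by blast
  next
    case 2 from main[OF g f this] that show ?thesis by blast
  qed
qed

section \<open>The coding map of a single coordinate\<close>

definition code1 :: "('a \<Rightarrow> real \<Rightarrow> real) \<Rightarrow> (nat \<Rightarrow> 'a) \<Rightarrow> real" where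
  "code1 f s = lim (\<lambda>n. foldr f (map s [0..<n]) 0)"

locale interval_IFS =
  fixes f :: "'a \<Rightarrow> real \<Rightarrow> real" and B :: "'a set"
  assumes fin: "finite B" and sim: "b \<in> B \<Longrightarrow> contracting_similarity (f b)"
begin

definition ratio :: "'a list \<Rightarrow> real" where
  "ratio w = (\<Prod>b\<leftarrow>w. contraction_ratio (f b))"

lemma ratio_simps [simp]:
  "ratio [] = 1" "ratio (b # w) = contraction_ratio (f b) * ratio w" "ratio (u @ w) = ratio u * ratio w"
  by (simp_all add: ratio_def)

lemma ratio_pos: "set w \<subseteq> B \<Longrightarrow> 0 < ratio w"
  by (induction w) (auto simp: contraction_ratio(1)[OF sim])

lemma foldr_mem: "set w \<subseteq> B \<Longrightarrow> x \<in> {0..1} \<Longrightarrow> foldr f w x \<in> {0..1}"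
proof (induction w)
  case (Cons b w)
  then show ?case using contraction_ratio(4)[OF sim[of b], of "foldr f w x"] by simp
qed simp

lemma foldr_open: "set w \<subseteq> B \<Longrightarrow> x \<in> {0<..<1} \<Longrightarrow> foldr f w x \<in> {0<..<1}"
proof (induction w)
  case (Cons b w)
  then show ?case using contracting_similarity_open[OF sim[of b], of "foldr f w x"] by simp
qed simp

lemma foldr_dist:
  "set w \<subseteq> B \<Longrightarrow> x \<in> {0..1} \<Longrightarrow> y \<in> {0..1} \<Longrightarrow> \<bar>foldr f w x - foldr f w y\<bar> = ratio w * \<bar>x - y\<bar>"
proof (induction w)
  case (Cons b w)
  then show ?case
    using contraction_ratio(3)[OF sim[of b] foldr_mem[of w x] foldr_mem[of w y]] by simp
qed simp

lemma ratio_tendsto_0: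
  assumes "\<And>n. s n \<in> B" shows "(\<lambda>n. ratio (map s [0..<n])) \<longlonglongrightarrow> 0"
proof -
  define q where "q = Max ((\<lambda>b. contraction_ratio (f b)) ` B)"
  have ne: "B \<noteq> {}" using assms by auto
  have q: "contraction_ratio (f b) \<le> q" if "b \<in> B" for b using fin that by (simp add: q_def)
  have q1: "q < 1" using fin ne contraction_ratio(2)[OF sim] by (simp add: q_def)
  have q0: "0 < q" using q[OF assms[of 0]] contraction_ratio(1)[OF sim[OF assms[of 0]]] by simp
  have "ratio (map s [0..<n]) \<le> q ^ n" for n
  proof (induction n)
    case (Suc n)
    have "ratio (map s [0..<n]) * contraction_ratio (f (s n)) \<le> q ^ n * q"
      using Suc q[OF assms] contraction_ratio(1)[OF sim[OF assms]] ratio_pos[of "map s [0..<n]"] assms q0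
      by (intro mult_mono) (auto intro: less_imp_le)
    then show ?case by (simp add: mult.commute)
  qed simp
  moreover have "0 \<le> ratio (map s [0..<n])" for n using ratio_pos[of "map s [0..<n]"] assms by (auto intro: less_imp_le)
  moreover have "(\<lambda>n. q ^ n) \<longlonglongrightarrow> 0" using q0 q1 by (intro LIMSEQ_realpow_zero) auto
  moreover have "\<forall>\<^sub>F n in sequentially. norm (ratio (map s [0..<n])) \<le> q ^ n"
    using calculation(1,2) by (intro always_eventually allI) (simp only: real_norm_def abs_of_nonneg)
  ultimately show ?thesis by (blast intro: Lim_null_comparison)
qed

lemma map_shift: "map s [0..<n + k] = map s [0..<n] @ map (\<lambda>i. s (n + i)) [0..<k]"
  by (induction k) auto

lemma code1_LIMSEQ:
  assumes s: "\<And>n. s n \<in> B" shows "(\<lambda>n. foldr f (map s [0..<n]) 0) \<longlonglongrightarrow> code1 f s"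
proof -
  have sub: "set (map (\<lambda>i. s (n + i)) [0..<k]) \<subseteq> B" "set (map s [0..<k]) \<subseteq> B" for n k using s by auto
  have d: "\<bar>foldr f (map s [0..<n + k]) 0 - foldr f (map s [0..<n]) 0\<bar> \<le> ratio (map s [0..<n])" for n k
  proof -
    have m: "foldr f (map (\<lambda>i. s (n + i)) [0..<k]) 0 \<in> {0..1}" by (intro foldr_mem sub) auto
    have "\<bar>foldr f (map s [0..<n + k]) 0 - foldr f (map s [0..<n]) 0\<bar>
        = ratio (map s [0..<n]) * \<bar>foldr f (map (\<lambda>i. s (n + i)) [0..<k]) 0 - 0\<bar>"
      unfolding map_shift foldr_append o_apply by (intro foldr_dist sub m) auto
    also have "\<dots> \<le> ratio (map s [0..<n]) * 1"
      using m ratio_pos[OF sub(2)] by (intro mult_left_mono) (auto intro: less_imp_le)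
    finally show ?thesis by simp
  qed
  have "Cauchy (\<lambda>n. foldr f (map s [0..<n]) 0)"
  proof (rule metric_CauchyI)
    fix e :: real assume "e > 0"
    then have "\<forall>\<^sub>F n in sequentially. ratio (map s [0..<n]) < e / 2"
      using order_tendstoD(2)[OF ratio_tendsto_0[of s, OF s], of "e / 2"] by simp
    then obtain N where N: "ratio (map s [0..<N]) < e / 2" by (auto simp: eventually_sequentially)
    show "\<exists>M. \<forall>m\<ge>M. \<forall>n\<ge>M. dist (foldr f (map s [0..<m]) 0) (foldr f (map s [0..<n]) 0) < e"
    proof (intro exI[of _ N] allI impI)
      fix m n assume "N \<le> m" "N \<le> n"
      then show "dist (foldr f (map s [0..<m]) 0) (foldr f (map s [0..<n]) 0) < e"
        using d[of N "m - N"] d[of N "n - N"] N by (simp add: dist_real_def)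
    qed
  qed
  then show ?thesis unfolding code1_def by (simp add: Cauchy_convergent_iff convergent_LIMSEQ_iff)
qed

lemma code1_mem: assumes s: "\<And>n. s n \<in> B" shows "code1 f s \<in> {0..1}"
proof -
  have "foldr f (map s [0..<n]) 0 \<in> {0..1}" for n using s by (intro foldr_mem) auto
  then show ?thesis
    by (rule closed_sequentially[OF closed_atLeastAtMost _ code1_LIMSEQ[of s, OF s]])
qed

lemma code1_shift:
  assumes s: "\<And>n. s n \<in> B" shows "code1 f s = foldr f (map s [0..<n]) (code1 f (\<lambda>i. s (n + i)))"
proof -
  let ?s = "\<lambda>i. s (n + i)"
  have m: "foldr f (map ?s [0..<k]) 0 \<in> {0..1}" for k using s by (intro foldr_mem) auto
  have eq: "foldr f (map s [0..<n + k]) 0 = foldr f (map s [0..<n]) (foldr f (map ?s [0..<k]) 0)" for k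
    unfolding map_shift by simp
  have "(\<lambda>k. foldr f (map s [0..<n + k]) 0) \<longlonglongrightarrow> foldr f (map s [0..<n]) (code1 f ?s)"
    unfolding eq
  proof (rule Lim_null[THEN iffD2], rule tendsto_rabs_zero_cancel)
    have "\<bar>foldr f (map s [0..<n]) (foldr f (map ?s [0..<k]) 0) - foldr f (map s [0..<n]) (code1 f ?s)\<bar>
      = ratio (map s [0..<n]) * \<bar>foldr f (map ?s [0..<k]) 0 - code1 f ?s\<bar>" for k
      using s by (intro foldr_dist m code1_mem) auto
    moreover have "(\<lambda>k. ratio (map s [0..<n]) * \<bar>foldr f (map ?s [0..<k]) 0 - code1 f ?s\<bar>) \<longlonglongrightarrow> ratio (map s [0..<n]) * \<bar>code1 f ?s - code1 f ?s\<bar>"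
      using code1_LIMSEQ[of ?s] s by (intro tendsto_intros) auto
    ultimately show "(\<lambda>k. \<bar>foldr f (map s [0..<n]) (foldr f (map ?s [0..<k]) 0) - foldr f (map s [0..<n]) (code1 f ?s)\<bar>) \<longlonglongrightarrow> 0"
      by simp
  qed
  moreover have "(\<lambda>k. foldr f (map s [0..<n + k]) 0) \<longlonglongrightarrow> code1 f s"
    using LIMSEQ_ignore_initial_segment[OF code1_LIMSEQ[of s, OF s], of n] by (simp add: add.commute)
  ultimately show ?thesis using LIMSEQ_unique by blast
qed

lemma code1_dist_le:
  assumes s: "\<And>n. s n \<in> B" "\<And>n. s' n \<in> B" and eq: "\<And>m. m < n \<Longrightarrow> s m = s' m"
  shows "\<bar>code1 f s - code1 f s'\<bar> \<le> ratio (map s [0..<n])"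
proof -
  let ?t = "code1 f (\<lambda>i. s (n + i))" and ?t' = "code1 f (\<lambda>i. s' (n + i))"
  have m: "map s' [0..<n] = map s [0..<n]" using eq by simp
  have t: "?t \<in> {0..1}" "?t' \<in> {0..1}" using s by (auto intro!: code1_mem simp del: atLeastAtMost_iff)
  have sub: "set (map s [0..<n]) \<subseteq> B" using s by auto
  have "\<bar>code1 f s - code1 f s'\<bar> = ratio (map s [0..<n]) * \<bar>?t - ?t'\<bar>"
    using code1_shift[of s n] code1_shift[of s' n] s foldr_dist[OF sub t] by (simp add: m)
  also have "\<dots> \<le> ratio (map s [0..<n]) * 1"
    using t ratio_pos[OF sub] by (intro mult_left_mono) auto
  finally show ?thesis by simp
qed

end

lemma word_map_nth: "word_map \<phi> \<omega> n x $ i = foldr (\<phi> i) (map (\<lambda>m. \<omega> m i) [0..<n]) (x $ i)"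
  by (induction n arbitrary: x) (simp_all add: diag_map_def)

lemma diagonal_IFS_interval:
  assumes "diagonal_IFS A \<phi> E" shows "interval_IFS (\<phi> i) (A i)"
  using assms by unfold_locales (auto simp: diagonal_IFS_def)

lemma word_map_LIMSEQ:
  assumes A: "diagonal_IFS A \<phi> E" and \<omega>: "\<And>n. \<omega> n \<in> E"
  shows "(\<lambda>n. word_map \<phi> \<omega> n 0) \<longlonglongrightarrow> (\<chi> i. code1 (\<phi> i) (\<lambda>n. \<omega> n i))"
proof (rule vec_tendstoI)
  fix i
  have "\<omega> n i \<in> A i" for n using A \<omega>[of n] unfolding diagonal_IFS_def PiE_def Pi_def by blast
  from interval_IFS.code1_LIMSEQ[OF diagonal_IFS_interval[OF A], of "\<lambda>n. \<omega> n i", OF this]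
  show "(\<lambda>n. word_map \<phi> \<omega> n 0 $ i) \<longlonglongrightarrow> (\<chi> i. code1 (\<phi> i) (\<lambda>n. \<omega> n i)) $ i"
    by (simp add: word_map_nth)
qed

lemma coding_map_nth:
  assumes "diagonal_IFS A \<phi> E" "\<And>n. \<omega> n \<in> E"
  shows "coding_map \<phi> \<omega> $ i = code1 (\<phi> i) (\<lambda>n. \<omega> n i)"
  using limI[OF word_map_LIMSEQ[OF assms]] by (simp add: coding_map_def)

section \<open>Words with uniform fibers\<close>

text \<open>A word is read as a tuple of columns, ordered by \<open>\<kappa>\<close>; the fiber
  collects the values of column \<open>k\<close> compatible with the preceding columns of
  \<open>w\<close>. Uniform fibers describe a tree whose levels are the coordinates and whose
  branching depends on the level only.\<close>

definition fiber :: "('d \<Rightarrow> real) \<Rightarrow> ('d \<Rightarrow> 'w \<Rightarrow> 'v) \<Rightarrow> 'w set \<Rightarrow> 'd \<Rightarrow> 'w \<Rightarrow> 'v set" where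
  "fiber \<kappa> col W k w = col k ` {w'\<in>W. \<forall>j. \<kappa> j < \<kappa> k \<longrightarrow> col j w' = col j w}"

definition uniform_fibers :: "('d \<Rightarrow> real) \<Rightarrow> ('d \<Rightarrow> 'w \<Rightarrow> 'v) \<Rightarrow> 'w set \<Rightarrow> ('d \<Rightarrow> nat) \<Rightarrow> bool" where
  "uniform_fibers \<kappa> col W M \<longleftrightarrow> (\<forall>k. \<forall>w\<in>W. card (fiber \<kappa> col W k w) = M k)"

lemma fiber_cong: "(\<And>j. \<kappa> j < \<kappa> k \<Longrightarrow> col j w = col j w') \<Longrightarrow> fiber \<kappa> col W k w = fiber \<kappa> col W k w'"
  by (simp add: fiber_def)

text \<open>Uniform fibers allow \<open>W\<close> to be recoded as a full product, where digit \<open>k\<close> affects only the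
  columns from \<open>k\<close> on.\<close>

lemma uniform_fibers_decode:
  fixes \<kappa> :: "'d::finite \<Rightarrow> real" and col :: "'d \<Rightarrow> 'w \<Rightarrow> 'v"
  assumes inj: "inj \<kappa>" and W: "finite W" "W \<noteq> {}" and unif: "uniform_fibers \<kappa> col W M"
  obtains dec :: "('d \<Rightarrow> nat) \<Rightarrow> 'w"
  where "\<And>c. (\<And>k. c k < M k) \<Longrightarrow> dec c \<in> W"
    and "\<And>c c' k. (\<And>k. c k < M k) \<Longrightarrow> (\<And>k. c' k < M k) \<Longrightarrow> (\<And>j. \<kappa> j \<le> \<kappa> k \<Longrightarrow> c j = c' j)
           \<Longrightarrow> col k (dec c) = col k (dec c')"
    and "\<And>c c' k. (\<And>k. c k < M k) \<Longrightarrow> (\<And>k. c' k < M k) \<Longrightarrow> (\<And>j. \<kappa> j < \<kappa> k \<Longrightarrow> c j = c' j)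
           \<Longrightarrow> c k \<noteq> c' k \<Longrightarrow> col k (dec c) \<noteq> col k (dec c')"
proof -
  have "\<exists>h. bij_betw h {..<card S} S" if "finite S" for S :: "'v set"
    using ex_bij_betw_nat_finite[OF that] by (simp add: atLeast0LessThan)
  \<comment> \<open>One enumeration per set, fixed in advance: words with the same fiber interpret
    the same digit in the same way.\<close>
  then obtain en where en: "\<And>S :: 'v set. finite S \<Longrightarrow> bij_betw (en S) {..<card S} S" by metis
  define fib where "fib = fiber \<kappa> col W"
  have fin: "finite (fib k w)" for k w using W by (auto simp: fib_def fiber_def)
  have card: "w \<in> W \<Longrightarrow> card (fib k w) = M k" for k w
    using unif by (auto simp: uniform_fibers_def fib_def)
  define ok where "ok c w \<longleftrightarrow> w \<in> W \<and> (\<forall>j. col j w = en (fib j w) (c j))" for c w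
  \<comment> \<open>Solved on initial segments of the order by induction: the last column is changed
    to the prescribed element of its fiber without affecting the preceding ones.\<close>
  have ex: "\<exists>w\<in>W. \<forall>j\<in>S. col j w = en (fib j w) (c j)"
    if c: "\<And>k. c k < M k" and S: "\<And>j k. k \<in> S \<Longrightarrow> \<kappa> j < \<kappa> k \<Longrightarrow> j \<in> S" for c S
    using finite[of S] S
  proof (induction "card S" arbitrary: S)
    case 0
    then show ?case using W by auto
  next
    case (Suc n)
    then have "S \<noteq> {}" by auto
    then obtain k where k: "k \<in> S" "\<And>j. j \<in> S \<Longrightarrow> \<kappa> j \<le> \<kappa> k"
      using ex_is_arg_min_if_finite[of S "\<lambda>j. - \<kappa> j"] by (auto simp: is_arg_min_linorder)
    have k': "\<kappa> j < \<kappa> k" if "j \<in> S - {k}" for j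
      using k(2)[of j] that inj by (metis DiffE injD insertI1 order_le_less)
    have "\<exists>w\<in>W. \<forall>j\<in>S - {k}. col j w = en (fib j w) (c j)"
    proof (rule Suc.hyps(1))
      show "n = card (S - {k})" using Suc.hyps(2) k(1) by simp
      show "j \<in> S - {k}" if "i \<in> S - {k}" "\<kappa> j < \<kappa> i" for i j
        using that Suc.prems(2)[of i j] k'[of i] by auto
    qed simp
    then obtain w where w: "w \<in> W" "\<And>j. j \<in> S - {k} \<Longrightarrow> col j w = en (fib j w) (c j)" by blast
    have "en (fib k w) (c k) \<in> fib k w"
      using en[OF fin, of k w] card[OF w(1), of k] c[of k] by (auto simp: bij_betw_def)
    then obtain w' where w': "w' \<in> W" "\<And>j. \<kappa> j < \<kappa> k \<Longrightarrow> col j w' = col j w"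
        "col k w' = en (fib k w) (c k)"
      unfolding fib_def fiber_def by auto
    have "col j w' = en (fib j w') (c j)" if "j \<in> S" for j
    proof (cases "j = k")
      case True
      have "fib k w' = fib k w" unfolding fib_def using w'(2) by (rule fiber_cong)
      with True w'(3) show ?thesis by simp
    next
      case False
      with that k' have jk: "\<kappa> j < \<kappa> k" by simp
      have "fib j w' = fib j w" unfolding fib_def using w'(2) jk by (intro fiber_cong) auto
      then show ?thesis using w'(2)[OF jk] w(2)[of j] that False by simp
    qed
    with w'(1) show ?case by blast
  qed
  define dec where "dec c = (SOME w. ok c w)" for c
  have dec: "ok c (dec c)" if c: "\<And>k. c k < M k" for c
  proof -
    have "\<exists>w. ok c w" using ex[of c UNIV, OF c] unfolding ok_def by blast
    then show ?thesis unfolding dec_def by (rule someI_ex)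
  qed
  have le: "col k (dec c) = col k (dec c')"
    if "\<And>k. c k < M k" "\<And>k. c' k < M k" "\<And>j. \<kappa> j \<le> \<kappa> k \<Longrightarrow> c j = c' j" for c c' k
    using that(3)
  proof (induction "card {j. \<kappa> j < \<kappa> k}" arbitrary: k rule: less_induct)
    case less
    have "fib k (dec c) = fib k (dec c')"
      unfolding fib_def
    proof (rule fiber_cong)
      fix j assume j: "\<kappa> j < \<kappa> k"
      then have "card {i. \<kappa> i < \<kappa> j} < card {j. \<kappa> j < \<kappa> k}" by (intro psubset_card_mono) auto
      then show "col j (dec c) = col j (dec c')"
        using j less.prems by (intro less.hyps) auto
    qed
    then show ?case using dec[OF that(1)] dec[OF that(2)] less.prems[of k] by (simp add: ok_def)
  qed
  show thesis
  proof
    show "dec c \<in> W" if "\<And>k. c k < M k" for c using dec[OF that] by (simp add: ok_def)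
    show "col k (dec c) = col k (dec c')"
      if "\<And>k. c k < M k" "\<And>k. c' k < M k" "\<And>j. \<kappa> j \<le> \<kappa> k \<Longrightarrow> c j = c' j" for c c' k
      using that by (rule le)
    show "col k (dec c) \<noteq> col k (dec c')"
      if c: "\<And>k. c k < M k" "\<And>k. c' k < M k" and lt: "\<And>j. \<kappa> j < \<kappa> k \<Longrightarrow> c j = c' j" and ne: "c k \<noteq> c' k" for c c' k
    proof
      assume eq: "col k (dec c) = col k (dec c')"
      have fe: "fib k (dec c) = fib k (dec c')"
        unfolding fib_def using lt by (intro fiber_cong le c) auto
      have ok: "ok c (dec c)" "ok c' (dec c')" using dec c by blast+
      then have "en (fib k (dec c)) (c k) = en (fib k (dec c)) (c' k)"
      proof -
        have "col k (dec c) = en (fib k (dec c)) (c k)" "col k (dec c') = en (fib k (dec c')) (c' k)"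
          using ok unfolding ok_def by blast+
        then show ?thesis using eq fe by simp
      qed
      then have "c k = c' k"
        using en[OF fin, of k "dec c"] card[of "dec c" k] c[of k] ok(1)
        by (auto simp: bij_betw_def ok_def dest: inj_onD)
      with ne show False ..
    qed
  qed
qed

text \<open>Every tuple of preceding columns has \<open>M k\<close> continuations: the counting
  analogue of the chain rule for entropy.\<close>

lemma card_image_uniform_fibers:
  assumes W: "finite W" and unif: "uniform_fibers \<kappa> col W M"
  shows "card ((\<lambda>w. restrict (\<lambda>j. col j w) {j. \<kappa> j < \<kappa> k}) ` W) * M k
       = card ((\<lambda>w. (restrict (\<lambda>j. col j w) {j. \<kappa> j < \<kappa> k}, col k w)) ` W)"
proof -
  define R where "R w = restrict (\<lambda>j. col j w) {j. \<kappa> j < \<kappa> k}" for w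
  have R: "R w' = R w \<longleftrightarrow> (\<forall>j. \<kappa> j < \<kappa> k \<longrightarrow> col j w' = col j w)" for w w'
    by (auto simp: R_def fun_eq_iff restrict_def)
  have "(\<lambda>w. (R w, col k w)) ` W = (SIGMA r:R ` W. col k ` {w\<in>W. R w = r})" (is "?L = ?S")
  proof (intro equalityI subsetI)
    fix z assume "z \<in> ?S"
    then obtain w where "w \<in> W" "z = (R w, col k w)" by auto
    then show "z \<in> ?L" by blast
  qed auto
  then have "card ((\<lambda>w. (R w, col k w)) ` W) = (\<Sum>r\<in>R ` W. card (col k ` {w\<in>W. R w = r}))"
    using W by simp
  also have "\<dots> = (\<Sum>r\<in>R ` W. M k)"
  proof (intro sum.cong refl)
    fix r assume "r \<in> R ` W"
    then obtain w where w: "w \<in> W" "r = R w" by auto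
    then have "col k ` {w\<in>W. R w = r} = fiber \<kappa> col W k w" by (simp add: fiber_def R)
    then show "card (col k ` {w\<in>W. R w = r}) = M k"
      using unif w by (simp add: uniform_fibers_def)
  qed
  finally show ?thesis by (simp add: R_def)
qed

section \<open>Columns of words and words of a given type\<close>

definition coord :: "'d \<Rightarrow> ('d \<Rightarrow> 'a) list \<Rightarrow> 'a list" where
  "coord j w = map (\<lambda>a. a j) w"

lemma coord_append [simp]: "coord j (u @ v) = coord j u @ coord j v"
  and coord_Cons [simp]: "coord j (a # v) = a j # coord j v"
  and length_coord [simp]: "length (coord j w) = length w"
  by (simp_all add: coord_def)

lemma permute_list_inj:
  assumes p: "p permutes {..<length xs}" and len: "length xs = length ys"
    and eq: "permute_list p xs = permute_list p ys"
  shows "xs = ys"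
proof (rule nth_equalityI[OF len])
  fix i assume i: "i < length xs"
  obtain j where j: "j < length xs" "i = p j"
    using permutes_image[OF p] i by (metis imageE lessThan_iff)
  have "permute_list p xs ! j = permute_list p ys ! j" using eq by simp
  then show "xs ! i = ys ! i" using p j len by (simp add: permute_list_nth)
qed

lemma finite_words_mset: "finite {w. mset w = A}"
  using finite_permutations_of_multiset[of A] by (simp add: permutations_of_multiset_def)

text \<open>A permutation of the positions carrying \<open>w\<close> to \<open>w'\<close> acts on
  all columns at once and preserves the multiset, so it maps the fiber at \<open>w\<close>
  injectively into the fiber at \<open>w'\<close>. Exchanging the two words gives equal
  cardinalities.\<close>

lemma uniform_fibers_mset:
  fixes A :: "('d \<Rightarrow> 'a) multiset"
  obtains M where "uniform_fibers \<kappa> coord {w. mset w = A} M"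
proof
  let ?W = "{w. mset w = A}"
  have fin: "finite (fiber \<kappa> coord ?W k w)" for k w
    by (simp add: fiber_def finite_words_mset)
  have le: "card (fiber \<kappa> coord ?W k w) \<le> card (fiber \<kappa> coord ?W k w')" if "w \<in> ?W" "w' \<in> ?W" for k w w'
  proof -
    have "mset w' = mset w" using that by simp
    then obtain p where p: "p permutes {..<length w}" "permute_list p w = w'"
      by (rule mset_eq_permutation)
    have len: "length v = length w" if "mset v = A" for v
      using that \<open>w \<in> ?W\<close> by (metis mem_Collect_eq size_mset)
    have "permute_list p ` fiber \<kappa> coord ?W k w \<subseteq> fiber \<kappa> coord ?W k w'"
    proof
      fix x assume "x \<in> permute_list p ` fiber \<kappa> coord ?W k w"
      then obtain v where v: "mset v = A" "\<And>j. \<kappa> j < \<kappa> k \<Longrightarrow> coord j v = coord j w"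
          "x = permute_list p (coord k v)"
        by (auto simp: fiber_def)
      have pv: "p permutes {..<length v}" using p len[OF v(1)] by simp
      have "coord j (permute_list p v) = permute_list p (coord j v)" for j
        unfolding coord_def by (rule permute_list_map[OF pv, symmetric])
      moreover have "coord j w' = permute_list p (coord j w)" for j
        unfolding coord_def p(2)[symmetric] by (rule permute_list_map[OF p(1), symmetric])
      moreover have "mset (permute_list p v) = A" using pv v by simp
      ultimately show "x \<in> fiber \<kappa> coord ?W k w'"
        unfolding fiber_def using v by (intro image_eqI[of _ _ "permute_list p v"]) auto
    qed
    moreover have "inj_on (permute_list p) (fiber \<kappa> coord ?W k w)"
    proof (rule inj_onI)
      fix x y assume "x \<in> fiber \<kappa> coord ?W k w" "y \<in> fiber \<kappa> coord ?W k w"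
      then have "length x = length w" "length y = length w" by (auto simp: fiber_def len)
      moreover assume "permute_list p x = permute_list p y"
      ultimately show "x = y" using permute_list_inj[of p x y] p by simp
    qed
    ultimately show ?thesis using card_inj_on_le fin by blast
  qed
  show "uniform_fibers \<kappa> coord ?W (\<lambda>k. card (fiber \<kappa> coord ?W k (SOME w. mset w = A)))"
    unfolding uniform_fibers_def
  proof (intro allI ballI)
    fix k w assume w: "w \<in> ?W"
    then have "mset (SOME w. mset w = A) = A" by (intro someI) auto
    with le w show "card (fiber \<kappa> coord ?W k w) = card (fiber \<kappa> coord ?W k (SOME w. mset w = A))"
      by (intro antisym) auto
  qed
qed

text \<open>The words of \<open>U\<close> have equal length, so each column of a concatenation
  splits uniquely and fibers become products.\<close>

lemma uniform_fibers_append: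
  assumes U: "uniform_fibers \<kappa> coord U M" "\<And>u. u \<in> U \<Longrightarrow> length u = n"
    and V: "uniform_fibers \<kappa> coord V M'"
  shows "uniform_fibers \<kappa> coord {u @ v |u v. u \<in> U \<and> v \<in> V} (\<lambda>k. M k * M' k)"
  unfolding uniform_fibers_def
proof (intro allI ballI)
  fix k w assume "w \<in> {u @ v |u v. u \<in> U \<and> v \<in> V}"
  then obtain u v where w: "w = u @ v" and uv: "u \<in> U" "v \<in> V" by auto
  have "fiber \<kappa> coord {u @ v |u v. u \<in> U \<and> v \<in> V} k w
      = (\<lambda>(x, y). x @ y) ` (fiber \<kappa> coord U k u \<times> fiber \<kappa> coord V k v)" (is "?L = ?R")
  proof (intro equalityI subsetI)
    fix x assume "x \<in> ?L"
    then obtain u' v' where *: "u' \<in> U" "v' \<in> V" "x = coord k (u' @ v')"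
      "\<And>j. \<kappa> j < \<kappa> k \<Longrightarrow> coord j (u' @ v') = coord j (u @ v)"
      by (auto simp: fiber_def w)
    have "coord j u' = coord j u \<and> coord j v' = coord j v" if "\<kappa> j < \<kappa> k" for j
      using *(4)[OF that] U(2)[OF *(1)] U(2)[OF uv(1)] by simp
    then show "x \<in> ?R" using * by (auto simp: fiber_def)
  next
    fix x assume "x \<in> ?R"
    then obtain u' v' where "u' \<in> U" "v' \<in> V" "x = coord k u' @ coord k v'"
      "\<And>j. \<kappa> j < \<kappa> k \<Longrightarrow> coord j u' = coord j u" "\<And>j. \<kappa> j < \<kappa> k \<Longrightarrow> coord j v' = coord j v"
      by (auto simp: fiber_def)
    then show "x \<in> ?L"
      unfolding fiber_def w by (intro image_eqI[of _ _ "u' @ v'"]) auto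
  qed
  moreover have "inj_on (\<lambda>(x, y). x @ y) (fiber \<kappa> coord U k u \<times> fiber \<kappa> coord V k v)"
    using U(2) by (auto simp: inj_on_def fiber_def)
  ultimately show "card (fiber \<kappa> coord {u @ v |u v. u \<in> U \<and> v \<in> V} k w) = M k * M' k"
    using U(1) V uv by (simp add: card_image card_cartesian_product uniform_fibers_def)
qed

lemma uniform_fibers_singleton: "uniform_fibers \<kappa> coord {w} (\<lambda>_. 1)"
proof -
  have "{w' \<in> {w}. \<forall>j. \<kappa> j < \<kappa> k \<longrightarrow> coord j w' = coord j w} = {w}" for k by auto
  then show ?thesis by (simp add: uniform_fibers_def fiber_def)
qed

text \<open>Interchanging two letters that differ in coordinate \<open>k\<close> but not in the preceding ones.\<close>

lemma uniform_fibers_ge_2: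
  assumes unif: "uniform_fibers \<kappa> coord {w. mset w = A} M"
    and ab: "{#a, b#} \<subseteq># A" "a k \<noteq> b k" "\<And>j. \<kappa> j < \<kappa> k \<Longrightarrow> a j = b j"
  shows "2 \<le> M k"
proof -
  obtain r where r: "mset r = A - {#a, b#}" using ex_mset by blast
  let ?W = "{w. mset w = A}"
  have A: "mset (a # b # r) = A" "mset (b # a # r) = A"
    using ab(1) r by (simp_all add: subset_mset.add_diff_inverse[symmetric] add_mset_commute)
       (metis add_mset_add_single add_mset_commute subset_mset.add_diff_inverse union_mset_add_mset_left add.left_neutral)+
  have "coord k (a # b # r) \<in> fiber \<kappa> coord ?W k (a # b # r)"
    unfolding fiber_def using A by (intro imageI) auto
  moreover have "coord k (b # a # r) \<in> fiber \<kappa> coord ?W k (a # b # r)"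
    unfolding fiber_def using A ab(3) by (intro imageI) auto
  moreover have "finite (fiber \<kappa> coord ?W k (a # b # r))"
    by (simp add: fiber_def finite_words_mset)
  ultimately have "card {coord k (a # b # r), coord k (b # a # r)} \<le> card (fiber \<kappa> coord ?W k (a # b # r))"
    by (intro card_mono) auto
  moreover have "card {coord k (a # b # r), coord k (b # a # r)} = 2" using ab(2) by simp
  moreover have "card (fiber \<kappa> coord ?W k (a # b # r)) = M k"
    using unif A by (simp add: uniform_fibers_def)
  ultimately show ?thesis by simp
qed

section \<open>Finite Bernoulli schemes\<close>

locale finite_bernoulli = prob_space p for p :: "'b measure" +
  fixes E :: "'b set"
  assumes finE: "finite E" and space_p: "space p = E" and sets_p: "sets p = Pow E"
begin

sublocale O: product_prob_space "\<lambda>_::nat. p" UNIV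
  by unfold_locales

abbreviation "Om \<equiv> Pi\<^sub>M (UNIV :: nat set) (\<lambda>_. p)"

lemma space_Om: "space Om = UNIV \<rightarrow> E"
  by (auto simp: space_PiM space_p PiE_def)

lemma measurable_coordinate: "(\<lambda>\<omega>. \<omega> m) \<in> measurable Om p"
  by (rule measurable_component_singleton) auto

lemma measurable_function: "g \<in> measurable p N \<longleftrightarrow> g \<in> E \<rightarrow> space N"
  by (auto simp: measurable_def space_p sets_p)

lemma cylinder:
  assumes "\<And>m. m < N \<Longrightarrow> B m \<subseteq> E"
  shows "{\<omega>\<in>space Om. \<forall>m<N. \<omega> m \<in> B m} \<in> sets Om"
    and "measure Om {\<omega>\<in>space Om. \<forall>m<N. \<omega> m \<in> B m} = (\<Prod>m<N. measure p (B m))"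
proof -
  have eq: "{\<omega>\<in>space Om. \<forall>m<N. \<omega> m \<in> B m} = O.emb UNIV {..<N} (PiE {..<N} B)"
    using assms by (auto simp: prod_emb_def space_PiM PiE_def space_p Pi_iff)
  show "{\<omega>\<in>space Om. \<forall>m<N. \<omega> m \<in> B m} \<in> sets Om"
    unfolding eq using assms by (intro sets_PiM_I) (auto simp: sets_p)
  show "measure Om {\<omega>\<in>space Om. \<forall>m<N. \<omega> m \<in> B m} = (\<Prod>m<N. measure p (B m))"
    unfolding eq using assms by (intro O.measure_PiM_emb) (auto simp: sets_p)
qed

text \<open>Since \<open>E\<close> is finite, any condition on the first \<open>N\<close> letters is
  a finite union of cylinders.\<close>

lemma measurable_prefix:
  shows "{\<omega>\<in>space Om. Q (map \<omega> [0..<N])} \<in> sets Om"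
proof -
  have "{\<omega>\<in>space Om. Q (map \<omega> [0..<N])}
      = (\<Union>w\<in>{w. set w \<subseteq> E \<and> length w = N \<and> Q w}. {\<omega>\<in>space Om. \<forall>m<N. \<omega> m \<in> {w ! m}})" (is "?L = ?R")
  proof (intro equalityI subsetI)
    fix \<omega> assume "\<omega> \<in> ?L"
    then show "\<omega> \<in> ?R"
      by (intro UN_I[of "map \<omega> [0..<N]"]) (auto simp: space_Om)
  next
    fix \<omega> assume "\<omega> \<in> ?R"
    then obtain w where w: "length w = N" "Q w" "\<omega> \<in> space Om" "\<forall>m<N. \<omega> m = w ! m" by auto
    then have "map \<omega> [0..<N] = w" by (intro nth_equalityI) auto
    with w show "\<omega> \<in> ?L" by simp
  qed
  also have "\<dots> \<in> sets Om"
  proof (rule sets.finite_UN)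
    show "finite {w. set w \<subseteq> E \<and> length w = N \<and> Q w}"
    by (rule finite_subset[OF _ finite_lists_length_eq[OF finE, of N]]) auto
    show "{\<omega>\<in>space Om. \<forall>m<N. \<omega> m \<in> {w ! m}} \<in> sets Om"
      if "w \<in> {w. set w \<subseteq> E \<and> length w = N \<and> Q w}" for w
      using that by (intro cylinder) auto
  qed
  finally show ?thesis .
qed

text \<open>Hoeffding's inequality applies because a function on the finite set \<open>E\<close> is
  bounded; its exponential bound tends to 0.\<close>

lemma weak_law:
  fixes g :: "'b \<Rightarrow> real" and e :: real
  assumes e: "0 < e"
  shows "(\<lambda>N. measure Om {\<omega>\<in>space Om. e * N \<le> \<bar>(\<Sum>a\<leftarrow>map \<omega> [0..<N]. g a) - N * expectation g\<bar>}) \<longlonglongrightarrow> 0"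
proof -
  \<comment> \<open>The summand 1 keeps the interval from \<open>- C\<close> to \<open>C\<close>
    nondegenerate, as the bound divides by its squared length.\<close>
  define C where "C = (\<Sum>a\<in>E. \<bar>g a\<bar>) + 1"
  have gC: "\<bar>g a\<bar> < C" if "a \<in> E" for a
  proof -
    have "\<bar>g a\<bar> \<le> (\<Sum>a\<in>E. \<bar>g a\<bar>)" using that finE by (intro member_le_sum) auto
    then show ?thesis by (simp add: C_def)
  qed
  have C: "C > 0" by (auto simp: C_def intro!: add_nonneg_pos sum_nonneg)
  have gm: "g \<in> borel_measurable p" by (simp add: measurable_function)
  have dc: "distr Om p (\<lambda>\<omega>. \<omega> i) = p" for i by (rule O.PiM_component) simp
  have bound: "measure Om {\<omega>\<in>space Om. e * N \<le> \<bar>(\<Sum>a\<leftarrow>map \<omega> [0..<N]. g a) - N * expectation g\<bar>}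
      \<le> 2 * exp (- (e\<^sup>2 / (2 * C\<^sup>2)) * N)" if N: "N \<ge> 1" for N
  proof -
    have ind: "O.P.indep_vars (\<lambda>_. p) (\<lambda>i \<omega>. \<omega> i) {..<N}"
    proof (subst O.P.indep_vars_iff_distr_eq_PiM')
      show "{..<N} \<noteq> {}" using N by (auto simp: lessThan_empty_iff)
      show "(\<lambda>\<omega>. \<omega> i) \<in> measurable Om p" for i by (rule measurable_coordinate)
      have "(\<Pi>\<^sub>M i\<in>{..<N}. distr Om p (\<lambda>\<omega>. \<omega> i)) = (\<Pi>\<^sub>M i\<in>{..<N}. p)"
        by (simp add: dc)
      then show "distr Om (\<Pi>\<^sub>M i\<in>{..<N}. p) (\<lambda>x. \<lambda>i\<in>{..<N}. x i) = (\<Pi>\<^sub>M i\<in>{..<N}. distr Om p (\<lambda>\<omega>. \<omega> i))"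
        using O.distr_PiM_restrict_finite[of "{..<N}"] by simp
    qed
    interpret H: Hoeffding_ineq_iid Om "{..<N}" "\<lambda>i \<omega>. g (\<omega> i)" "\<lambda>\<omega>. g (\<omega> 0)" "- C" C
       "expectation g"
    proof unfold_locales
      show "O.P.indep_vars (\<lambda>_. borel) (\<lambda>i \<omega>. g (\<omega> i)) {..<N}"
        by (rule O.P.indep_vars_compose2[OF ind gm])
      have d: "distr Om borel (\<lambda>\<omega>. g (\<omega> i)) = distr p borel g" for i
        using distr_distr[OF gm measurable_coordinate[of i]] by (simp add: dc o_def)
      then show "distr Om borel (\<lambda>\<omega>. g (\<omega> i)) = distr Om borel (\<lambda>\<omega>. g (\<omega> 0))" for i by simp
      show "(\<lambda>\<omega>. g (\<omega> 0)) \<in> borel_measurable Om"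
        using measurable_compose[OF measurable_coordinate gm] .
      have "g (\<omega> 0) \<in> {- C..C}" if "\<omega> \<in> space Om" for \<omega>
      proof -
        have "\<omega> 0 \<in> E" using that by (auto simp: space_Om)
        then show ?thesis using gC[of "\<omega> 0"] by auto
      qed
      then show "AE x in Om. g (x 0) \<in> {- C..C}" by (rule AE_I2)
      have "O.P.expectation (\<lambda>\<omega>. g (\<omega> 0)) = integral\<^sup>L (distr Om p (\<lambda>\<omega>. \<omega> 0)) g"
        by (rule integral_distr[symmetric, OF measurable_coordinate gm])
      then show "expectation g \<equiv> O.P.expectation (\<lambda>\<omega>. g (\<omega> 0))" by (simp add: dc)
    qed simp
    have "(\<Sum>a\<leftarrow>map \<omega> [0..<N]. g a) = (\<Sum>i\<in>{..<N}. g (\<omega> i))" for \<omega>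
      by (simp add: o_def interv_sum_list_conv_sum_set_nat atLeast0LessThan)
    moreover have "- 2 * (e * N)\<^sup>2 / (real (card {..<N}) * (C - - C)\<^sup>2) = - (e\<^sup>2 / (2 * C\<^sup>2)) * N"
      using N C by (simp add: power2_eq_square field_simps)
    ultimately show ?thesis
      using H.Hoeffding_ineq_abs_ge[of "e * N"] e C N by (auto simp: lessThan_empty_iff)
  qed
  define D where "D = e\<^sup>2 / (2 * C\<^sup>2)"
  have D: "D > 0" using e C by (simp add: D_def)
  have "(\<lambda>N. 2 * exp (- D) ^ N) \<longlonglongrightarrow> 2 * 0"
    using D by (intro tendsto_mult tendsto_const LIMSEQ_realpow_zero) auto
  then have lim: "(\<lambda>N. 2 * exp (- D * real N)) \<longlonglongrightarrow> 0"
    by (simp add: exp_of_nat_mult[symmetric] mult.commute)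
  show ?thesis
  proof (rule Lim_null_comparison[OF _ lim])
    show "\<forall>\<^sub>F N in sequentially. norm (measure Om {\<omega>\<in>space Om. e * N \<le> \<bar>(\<Sum>a\<leftarrow>map \<omega> [0..<N]. g a) - N * expectation g\<bar>})
      \<le> 2 * exp (- D * real N)"
      using eventually_ge_at_top[of 1]
    proof eventually_elim
      case (elim N)
      then show ?case using bound[of N] by (simp add: D_def)
    qed
  qed
qed

section \<open>Typical words and the method of types\<close>

definition supp :: "'b set" where "supp = {a\<in>E. 0 < measure p {a}}"

lemma measure_supp: "measure p supp = 1"
proof -
  have "measure p E = measure p supp + measure p (E - supp)"
    using finite_measure_Diff[of E supp] by (auto simp: supp_def sets_p)
  also have "measure p (E - supp) = (\<Sum>a\<in>E - supp. measure p {a})"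
    using finE by (intro finite_measure_eq_sum_singleton) (auto simp: sets_p)
  also have "\<dots> = 0" by (intro sum.neutral) (auto simp: supp_def less_le)
  finally show ?thesis using prob_space by (simp add: space_p)
qed

text \<open>Restricting the letters to \<open>supp\<close> keeps all marginals positive, so that the
  logarithms in \<open>cond_info\<close> are genuine.\<close>

definition typical :: "('b \<Rightarrow> real) set \<Rightarrow> real \<Rightarrow> nat \<Rightarrow> 'b list \<Rightarrow> bool" where
  "typical G e N w \<longleftrightarrow> length w = N \<and> set w \<subseteq> supp \<and>
     (\<forall>g\<in>G. \<bar>(\<Sum>a\<leftarrow>w. g a) - N * expectation g\<bar> < e * N)"

lemma typical_tendsto:
  assumes G: "finite G" and e: "0 < e"
  shows "(\<lambda>N. measure Om {\<omega>\<in>space Om. \<not> typical G e N (map \<omega> [0..<N])}) \<longlonglongrightarrow> 0"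
proof -
  define bad where "bad g N = {\<omega>\<in>space Om. e * N \<le> \<bar>(\<Sum>a\<leftarrow>map \<omega> [0..<N]. g a) - N * expectation g\<bar>}"
    for g :: "'b \<Rightarrow> real" and N :: nat
  have badm: "bad g N \<in> sets Om" for g N unfolding bad_def by (rule measurable_prefix)
  have le: "measure Om {\<omega>\<in>space Om. \<not> typical G e N (map \<omega> [0..<N])} \<le> (\<Sum>g\<in>G. measure Om (bad g N))" for N
  proof -
    let ?S = "{\<omega>\<in>space Om. \<forall>m<N. \<omega> m \<in> supp}"
    have S: "?S \<in> sets Om" by (rule cylinder) (auto simp: supp_def)
    have "measure Om ?S = 1"
      using cylinder(2)[of N "\<lambda>_. supp"] by (simp add: measure_supp) (simp add: supp_def)
    then have S0: "measure Om (space Om - ?S) = 0" using O.P.prob_compl[OF S] by simp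
    have "{\<omega>\<in>space Om. \<not> typical G e N (map \<omega> [0..<N])} \<subseteq> (space Om - ?S) \<union> (\<Union>g\<in>G. bad g N)"
      by (auto simp: typical_def bad_def not_less)
    then have "measure Om {\<omega>\<in>space Om. \<not> typical G e N (map \<omega> [0..<N])}
         \<le> measure Om ((space Om - ?S) \<union> (\<Union>g\<in>G. bad g N))"
      by (intro O.P.finite_measure_mono sets.Un sets.finite_UN sets.Diff sets.top S badm G)
    also have "\<dots> \<le> measure Om (space Om - ?S) + measure Om (\<Union>g\<in>G. bad g N)"
      by (intro measure_Un_le sets.finite_UN sets.Diff sets.top S badm G)
    also have "measure Om (\<Union>g\<in>G. bad g N) \<le> (\<Sum>g\<in>G. measure Om (bad g N))"
      by (intro measure_UNION_le G badm)
    finally show ?thesis using S0 by simp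
  qed
  have "(\<lambda>N. \<Sum>g\<in>G. measure Om (bad g N)) \<longlonglongrightarrow> (\<Sum>g\<in>G. 0)"
    unfolding bad_def by (intro tendsto_sum weak_law e)
  then have lim: "(\<lambda>N. \<Sum>g\<in>G. measure Om (bad g N)) \<longlonglongrightarrow> 0" by simp
  show ?thesis
    by (rule Lim_null_comparison[OF always_eventually[OF allI] lim]) (simp add: le)
qed

text \<open>A type is determined by the multiplicities of the letters, each at most
  \<open>N\<close>; hence their number is polynomial in \<open>N\<close>.\<close>

lemma card_types:
  "card (mset ` {w. set w \<subseteq> E \<and> length w = N}) \<le> (N + 1) ^ card E"
proof -
  let ?A = "mset ` {w. set w \<subseteq> E \<and> length w = N}"
  have "inj_on (\<lambda>A. restrict (count A) E) ?A"
  proof (rule inj_onI)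
    fix A B assume AB: "A \<in> ?A" "B \<in> ?A" "restrict (count A) E = restrict (count B) E"
    show "A = B"
    proof (rule multiset_eqI)
      fix x show "count A x = count B x"
      proof (cases "x \<in> E")
        case True then show ?thesis using fun_cong[OF AB(3), of x] by simp
      next
        case False
        then have "x \<notin># A" "x \<notin># B" using AB by auto
        then show ?thesis by (simp add: not_in_iff)
      qed
    qed
  qed
  moreover have "(\<lambda>A. restrict (count A) E) ` ?A \<subseteq> PiE E (\<lambda>_. {..N})"
  proof (rule image_subsetI)
    fix A assume "A \<in> ?A"
    then have "count A x \<le> N" for x using count_le_size[of A x] by auto
    then show "restrict (count A) E \<in> PiE E (\<lambda>_. {..N})" by auto
  qed
  ultimately have "card ?A \<le> card (PiE E (\<lambda>_. {..N}))"
    using finE by (intro card_inj_on_le) (auto intro: finite_PiE)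
  then show ?thesis using finE by (simp add: card_PiE)
qed

text \<open>Typicality depends on the type only, and typical words have probability at least 1/2 for
  large \<open>N\<close>. Shared among polynomially many types, this leaves some typical type with
  at least the average.\<close>

lemma typical_type:
  assumes G: "finite G" and e: "0 < e"
  shows "\<forall>\<^sub>F N in sequentially. \<exists>A. (\<forall>w. mset w = A \<longrightarrow> typical G e N w) \<and> (\<exists>w. mset w = A) \<and>
      1 / (2 * (real N + 1) ^ card E) \<le> measure Om {\<omega>\<in>space Om. mset (map \<omega> [0..<N]) = A}"
proof -
  have "\<forall>\<^sub>F N in sequentially. measure Om {\<omega>\<in>space Om. \<not> typical G e N (map \<omega> [0..<N])} < 1 / 2"
    using order_tendstoD(2)[OF typical_tendsto[OF assms], of "1 / 2"] by simp
  then show ?thesis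
  proof eventually_elim
    case (elim N)
    let ?T = "{\<omega>\<in>space Om. typical G e N (map \<omega> [0..<N])}"
    let ?ev = "\<lambda>A. {\<omega>\<in>space Om. mset (map \<omega> [0..<N]) = A}"
    have "{\<omega>\<in>space Om. \<not> typical G e N (map \<omega> [0..<N])} = space Om - ?T" by auto
    then have "1 / 2 \<le> measure Om ?T"
      using elim O.P.prob_compl[OF measurable_prefix, of "typical G e N" N] by simp
    define \<A> where "\<A> = mset ` {w. typical G e N w}"
    have typ_sub: "{w. typical G e N w} \<subseteq> {w. set w \<subseteq> E \<and> length w = N}"
      by (auto simp: typical_def supp_def)
    have fin\<A>: "finite (mset ` {w. set w \<subseteq> E \<and> length w = N})"
      using finite_lists_length_eq[OF finE, of N] by auto
    have \<A>: "finite \<A>" "card \<A> \<le> (N + 1) ^ card E"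
      unfolding \<A>_def using fin\<A> typ_sub card_types[of N]
      by (auto intro: finite_subset[OF image_mono] order_trans[OF card_mono[OF _ image_mono]])
    have evm: "?ev A \<in> sets Om" for A by (rule measurable_prefix)
    have "measure Om ?T \<le> measure Om (\<Union>A\<in>\<A>. ?ev A)"
      by (intro O.P.finite_measure_mono sets.finite_UN evm \<A>) (auto simp: \<A>_def simp del: mset_map)
    also have "\<dots> \<le> (\<Sum>A\<in>\<A>. measure Om (?ev A))"
      by (intro measure_UNION_le \<A> evm)
    finally have half: "1 / 2 \<le> (\<Sum>A\<in>\<A>. measure Om (?ev A))" using \<open>1 / 2 \<le> measure Om ?T\<close> by simp
    have "\<exists>A\<in>\<A>. 1 / (2 * (real N + 1) ^ card E) \<le> measure Om (?ev A)"
    proof (rule ccontr)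
      assume "\<not> ?thesis"
      then have lt: "\<And>A. A \<in> \<A> \<Longrightarrow> measure Om (?ev A) < 1 / (2 * (real N + 1) ^ card E)"
        by (simp add: not_le)
      have "\<A> \<noteq> {}" using half by auto
      then have "(\<Sum>A\<in>\<A>. measure Om (?ev A)) < (\<Sum>A\<in>\<A>. 1 / (2 * (real N + 1) ^ card E))"
        using \<A>(1) lt by (intro sum_strict_mono) auto
      also have "\<dots> = card \<A> * (1 / (2 * (real N + 1) ^ card E))" by simp
      also have "\<dots> \<le> (real N + 1) ^ card E * (1 / (2 * (real N + 1) ^ card E))"
      proof (intro mult_right_mono)
        have "real (card \<A>) \<le> real ((N + 1) ^ card E)" using \<A>(2) by (simp only: of_nat_le_iff)
        then show "real (card \<A>) \<le> (real N + 1) ^ card E" by (simp add: add.commute)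
      qed auto
      also have "\<dots> = 1 / 2" by simp
      finally show False using half by simp
    qed
    then obtain A where A: "A \<in> \<A>" "1 / (2 * (real N + 1) ^ card E) \<le> measure Om (?ev A)" by blast
    then obtain w0 where w0: "mset w0 = A" "typical G e N w0" by (auto simp: \<A>_def)
    have "typical G e N w" if "mset w = A" for w
    proof -
      have eq: "mset w = mset w0" using that w0 by simp
      have "(\<Sum>a\<leftarrow>w. g a) = (\<Sum>a\<leftarrow>w0. g a)" for g :: "'b \<Rightarrow> real"
        by (simp only: sum_mset_sum_list[symmetric] mset_map eq)
      then show ?thesis
        using w0(2) mset_eq_setD[OF eq] mset_eq_length[OF eq] by (simp add: typical_def)
    qed
    then show ?case using A w0 by blast
  qed
qed

end

section \<open>Marginals, conditional information and the size of fibers\<close>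

definition marginal :: "('d \<Rightarrow> 'a) measure \<Rightarrow> 'd set \<Rightarrow> ('d \<Rightarrow> 'a) \<Rightarrow> real" where
  "marginal p S a = measure p {b\<in>space p. \<forall>j\<in>S. b j = a j}"

text \<open>The mean under \<open>p\<close> is the conditional entropy of coordinate \<open>k\<close> given the coordinates
  preceding it in the order \<open>\<kappa>\<close>.\<close>

definition cond_info :: "('d \<Rightarrow> real) \<Rightarrow> ('d \<Rightarrow> 'a) measure \<Rightarrow> 'd \<Rightarrow> ('d \<Rightarrow> 'a) \<Rightarrow> real" where
  "cond_info \<kappa> p k a = ln (marginal p {j. \<kappa> j < \<kappa> k} a / marginal p {j. \<kappa> j \<le> \<kappa> k} a)"

locale finite_bernoulli_coords = finite_bernoulli p E for p :: "('d::finite \<Rightarrow> 'a) measure" and E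
begin

lemma marginal_pos: "a \<in> supp \<Longrightarrow> 0 < marginal p S a"
proof -
  assume a: "a \<in> supp"
  then have "measure p {a} \<le> marginal p S a"
    unfolding marginal_def by (intro finite_measure_mono) (auto simp: space_p sets_p supp_def)
  with a show ?thesis by (auto simp: supp_def)
qed

lemma exp_cond_info:
  assumes "set w \<subseteq> supp"
  shows "exp (\<Sum>a\<leftarrow>w. cond_info \<kappa> p k a)
     = (\<Prod>a\<leftarrow>w. marginal p {j. \<kappa> j < \<kappa> k} a) / (\<Prod>a\<leftarrow>w. marginal p {j. \<kappa> j \<le> \<kappa> k} a)"
  using assms
proof (induction w)
  case (Cons a w)
  then show ?case
    using marginal_pos[of a] by (simp add: exp_add cond_info_def)
qed simp

lemma marginal_cylinder:
  fixes w :: "('d \<Rightarrow> 'a) list" and S :: "'d set"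
  defines "C \<equiv> {\<omega>\<in>space Om. \<forall>m<length w. \<forall>j\<in>S. \<omega> m j = (w ! m) j}"
  shows "C \<in> sets Om" and "measure Om C = (\<Prod>a\<leftarrow>w. marginal p S a)"
proof -
  have C: "C = {\<omega>\<in>space Om. \<forall>m<length w. \<omega> m \<in> {b\<in>E. \<forall>j\<in>S. b j = (w ! m) j}}"
    unfolding C_def space_Om by auto
  show "C \<in> sets Om" unfolding C by (rule cylinder) auto
  have "measure Om C = (\<Prod>m<length w. marginal p S (w ! m))"
    unfolding C marginal_def space_p by (rule cylinder) auto
  also have "\<dots> = (\<Prod>a\<leftarrow>w. marginal p S a)"
    by (simp add: prod.list_conv_set_nth atLeast0LessThan)
  finally show "measure Om C = (\<Prod>a\<leftarrow>w. marginal p S a)" .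
qed

text \<open>All words of type \<open>A\<close> give the same mass \<open>\<pi> S\<close> to the
  cylinder fixing the columns in \<open>S\<close>, as a product over letters ignores their order.
  Disjointness bounds the number of tuples of columns before \<open>k\<close> by
  \<open>1 / \<pi> Lt\<close>; adding column \<open>k\<close> multiplies this number by
  \<open>M k\<close>, and the resulting cylinders of mass \<open>\<pi> Le\<close> cover the event of
  type \<open>A\<close>. The ratio \<open>\<pi> Lt / \<pi> Le\<close> is the exponential of the
  information.\<close>

lemma uniform_fibers_entropy:
  assumes unif: "uniform_fibers \<kappa> coord {w. mset w = A} M"
    and inj: "inj \<kappa>" and supp: "set_mset A \<subseteq> supp" and w: "mset w = A"
  shows "measure Om {\<omega>\<in>space Om. mset (map \<omega> [0..<size A]) = A} * exp (\<Sum>a\<leftarrow>w. cond_info \<kappa> p k a) \<le> M k"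
proof -
  define T where "T = {w. mset w = A}"
  define N where "N = size A"
  define Lt Le where "Lt = {j. \<kappa> j < \<kappa> k}" and "Le = {j. \<kappa> j \<le> \<kappa> k}"
  have finT: "finite T" by (simp add: T_def finite_words_mset)
  have len: "length v = N" if "v \<in> T" for v using that by (auto simp: T_def N_def)
  define C where "C S v = {\<omega>\<in>space Om. \<forall>m<length v. \<forall>j\<in>S. \<omega> m j = (v ! m) j}" for S and v :: "('d \<Rightarrow> 'a) list"
  define \<pi> where "\<pi> S = (\<Prod>a\<leftarrow>w. marginal p S a)" for S
  have C: "C S v \<in> sets Om" "measure Om (C S v) = \<pi> S" if "v \<in> T" for S v
  proof -
    show "C S v \<in> sets Om" unfolding C_def by (rule marginal_cylinder)
    have "measure Om (C S v) = (\<Prod>a\<leftarrow>v. marginal p S a)" unfolding C_def by (rule marginal_cylinder)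
    also have "\<dots> = \<pi> S"
    proof -
      have "mset v = mset w" using that w by (simp add: T_def)
      then show ?thesis unfolding \<pi>_def by (simp only: prod_mset_prod_list[symmetric] mset_map)
    qed
    finally show "measure Om (C S v) = \<pi> S" .
  qed
  have \<pi>_pos: "0 < \<pi> S" for S
  proof -
    have "set w \<subseteq> supp" using supp w by auto
    then show ?thesis unfolding \<pi>_def by (induction w) (auto intro!: mult_pos_pos marginal_pos)
  qed
  define R where "R v = restrict (\<lambda>j. coord j v) Lt" for v :: "('d \<Rightarrow> 'a) list"
  define RL where "RL v = (R v, coord k v)" for v :: "('d \<Rightarrow> 'a) list"
  have coord_nth: "coord j v = coord j v' \<longleftrightarrow> (\<forall>m<N. (v ! m) j = (v' ! m) j)" if "v \<in> T" "v' \<in> T" for j v v'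
    using len[OF that(1)] len[OF that(2)] by (auto simp: coord_def list_eq_iff_nth_eq)
  have R_eq: "R v = R v' \<longleftrightarrow> (\<forall>j\<in>Lt. coord j v = coord j v')" for v v'
    by (auto simp: R_def fun_eq_iff restrict_def)
  have card: "card (RL ` T) = card (R ` T) * M k"
    using card_image_uniform_fibers[OF finT, of \<kappa> coord M k] unif
    by (simp add: RL_def R_def Lt_def T_def)
  have lower: "card (R ` T) * \<pi> Lt \<le> 1"
  proof -
    define rep where "rep = inv_into T R"
    have rep: "rep r \<in> T \<and> R (rep r) = r" if "r \<in> R ` T" for r
      using inv_into_into[OF that] f_inv_into_f[OF that] by (simp add: rep_def)
    have "(\<Sum>r\<in>R ` T. measure Om (C Lt (rep r))) = measure Om (\<Union>r\<in>R ` T. C Lt (rep r))"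
    proof (rule O.P.finite_measure_finite_Union[symmetric])
      show "disjoint_family_on (\<lambda>r. C Lt (rep r)) (R ` T)"
        unfolding disjoint_family_on_def
      proof (intro ballI impI)
        fix r r' assume r: "r \<in> R ` T" "r' \<in> R ` T" "r \<noteq> r'"
        show "C Lt (rep r) \<inter> C Lt (rep r') = {}"
        proof (rule ccontr)
          assume "\<not> ?thesis"
          then obtain \<omega> where "\<omega> \<in> C Lt (rep r)" "\<omega> \<in> C Lt (rep r')" by blast
          then have "R (rep r) = R (rep r')"
            using rep[OF r(1)] rep[OF r(2)] len unfolding R_eq C_def
            by (auto simp: coord_nth)
          then show False using rep[OF r(1)] rep[OF r(2)] r(3) by simp
        qed
      qed
    qed (use finT C rep in auto)
    also have "\<dots> \<le> 1" by simp
    finally show ?thesis using C rep by simp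
  qed
  have "measure Om {\<omega>\<in>space Om. mset (map \<omega> [0..<size A]) = A} \<le> measure Om (\<Union>D\<in>C Le ` T. D)"
  proof (rule O.P.finite_measure_mono)
    show "{\<omega>\<in>space Om. mset (map \<omega> [0..<size A]) = A} \<subseteq> (\<Union>D\<in>C Le ` T. D)"
    proof
      fix \<omega> assume *: "\<omega> \<in> {\<omega>\<in>space Om. mset (map \<omega> [0..<size A]) = A}"
      then have "map \<omega> [0..<N] \<in> T" by (simp add: T_def N_def)
      moreover have "\<omega> \<in> C Le (map \<omega> [0..<N])" using * by (simp add: C_def)
      ultimately show "\<omega> \<in> (\<Union>D\<in>C Le ` T. D)" by blast
    qed
  qed (use C finT in auto)
  also have "\<dots> \<le> (\<Sum>D\<in>C Le ` T. measure Om D)"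
    using C finT by (intro measure_UNION_le) auto
  also have "\<dots> = (\<Sum>D\<in>C Le ` T. \<pi> Le)"
    using C by (intro sum.cong) auto
  also have "\<dots> = card (C Le ` T) * \<pi> Le" by simp
  \<comment> \<open>A cylinder over \<open>Le\<close> is determined by \<open>RL\<close>:
    injectivity of \<open>\<kappa>\<close> leaves \<open>k\<close> as the only coordinate of
    \<open>Le\<close> outside \<open>Lt\<close>.\<close>
  also have "\<dots> \<le> card (RL ` T) * \<pi> Le"
  proof (intro mult_right_mono of_nat_mono)
    have "C Le v = C Le v'" if "v \<in> T" "v' \<in> T" "RL v = RL v'" for v v'
    proof -
      have "coord j v = coord j v'" if "j \<in> Le" for j
      proof (cases "\<kappa> j < \<kappa> k")
        case True
        then show ?thesis using \<open>RL v = RL v'\<close> by (auto simp: RL_def R_eq Lt_def)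
      next
        case False
        then have "j = k" using that inj by (auto simp: Le_def dest: injD)
        then show ?thesis using \<open>RL v = RL v'\<close> by (auto simp: RL_def)
      qed
      then show ?thesis using that len by (simp add: C_def coord_nth)
    qed
    note same = this
    have "C Le ` T \<subseteq> (\<lambda>r. C Le (inv_into T RL r)) ` RL ` T"
    proof (rule image_subsetI)
      fix v assume v: "v \<in> T"
      then have r: "RL v \<in> RL ` T" by (rule imageI)
      have "C Le v = C Le (inv_into T RL (RL v))"
        by (rule same[OF v inv_into_into[OF r] f_inv_into_f[OF r, symmetric]])
      then show "C Le v \<in> (\<lambda>r. C Le (inv_into T RL r)) ` RL ` T" using r by (rule image_eqI)
    qed
    then have "card (C Le ` T) \<le> card ((\<lambda>r. C Le (inv_into T RL r)) ` RL ` T)"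
      using finT by (intro card_mono finite_imageI)
    also have "\<dots> \<le> card (RL ` T)" using finT by (intro card_image_le) auto
    finally show "card (C Le ` T) \<le> card (RL ` T)" .
  qed (use \<pi>_pos in \<open>auto intro: less_imp_le\<close>)
  also have "\<dots> = M k * (card (R ` T) * \<pi> Lt) * (\<pi> Le / \<pi> Lt)"
    using \<pi>_pos[of Lt] by (simp add: card)
  also have "\<dots> \<le> real (M k) * 1 * (\<pi> Le / \<pi> Lt)"
    by (intro mult_right_mono mult_left_mono lower of_nat_0_le_iff divide_nonneg_nonneg less_imp_le \<pi>_pos)
  finally have "measure Om {\<omega>\<in>space Om. mset (map \<omega> [0..<size A]) = A} \<le> M k * (\<pi> Le / \<pi> Lt)" by simp
  then have "measure Om {\<omega>\<in>space Om. mset (map \<omega> [0..<size A]) = A} * (\<pi> Lt / \<pi> Le) \<le> M k"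
    using \<pi>_pos[of Lt] \<pi>_pos[of Le] by (simp add: field_simps)
  moreover have "exp (\<Sum>a\<leftarrow>w. cond_info \<kappa> p k a) = \<pi> Lt / \<pi> Le"
    unfolding \<pi>_def Lt_def Le_def using supp w by (intro exp_cond_info) auto
  ultimately show ?thesis by simp
qed

end

section \<open>The dimension of a Bernoulli measure\<close>

locale bernoulli_sponge = finite_bernoulli_coords p E for p :: "('d::finite \<Rightarrow> 'a) measure" and E +
  fixes A :: "'d \<Rightarrow> 'a set" and \<phi> :: "'d \<Rightarrow> 'a \<Rightarrow> real \<Rightarrow> real"
  assumes ifs: "diagonal_IFS A \<phi> E" and distinct: "distinct_lyapunov \<phi> p"
begin

abbreviation "\<kappa> \<equiv> lyapunov \<phi> p"

definition log_ratio :: "'d \<Rightarrow> ('d \<Rightarrow> 'a) \<Rightarrow> real" where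
  "log_ratio k a = - ln (contraction_ratio (\<phi> k (a k)))"

definition h :: "'d \<Rightarrow> real" where
  "h k = expectation (cond_info \<kappa> p k)"

lemma inj_\<kappa>: "inj \<kappa>" using distinct by (simp add: distinct_lyapunov_def)

lemma letter_mem: "a \<in> E \<Longrightarrow> a k \<in> A k"
  using ifs unfolding diagonal_IFS_def PiE_def Pi_def by blast

lemma letter_similarity: "a \<in> E \<Longrightarrow> contracting_similarity (\<phi> k (a k))"
  using ifs letter_mem unfolding diagonal_IFS_def by blast

lemma interval: "interval_IFS (\<phi> k) (A k)"
  by (rule diagonal_IFS_interval[OF ifs])

lemma expectation_log_ratio: "expectation (log_ratio k) = \<kappa> k"
  unfolding lyapunov_def log_ratio_def by (rule integral_minus)

lemma integrable_any: "integrable p (g :: _ \<Rightarrow> real)"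
proof (rule integrable_const_bound[of _ "\<Sum>a\<in>E. \<bar>g a\<bar>"])
  have "norm (g a) \<le> (\<Sum>a\<in>E. \<bar>g a\<bar>)" if "a \<in> space p" for a
    using that finE by (auto simp: space_p intro!: member_le_sum)
  then show "AE a in p. norm (g a) \<le> (\<Sum>a\<in>E. \<bar>g a\<bar>)" by (rule AE_I2)
qed (simp add: measurable_function)

lemma log_ratio_pos: "a \<in> E \<Longrightarrow> 0 < log_ratio k a"
  using contraction_ratio(1,2)[OF letter_similarity[of a k]] by (simp add: log_ratio_def)

lemma E_nonempty: "E \<noteq> {}"
  using ifs by (simp add: diagonal_IFS_def)

lemma \<kappa>_pos: "0 < \<kappa> k"
proof -
  define c where "c = Min (log_ratio k ` E)"
  have c: "c \<le> log_ratio k a" if "a \<in> space p" for a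
    using that finE by (auto simp: c_def space_p)
  have "0 < c" using finE E_nonempty log_ratio_pos by (simp add: c_def)
  also have "c \<le> expectation (log_ratio k)"
    using c by (intro integral_ge_const integrable_any AE_I2) auto
  finally show ?thesis by (simp add: expectation_log_ratio)
qed

lemma cond_info_nonneg: "0 \<le> cond_info \<kappa> p k a"
proof -
  define l where "l = marginal p {j. \<kappa> j \<le> \<kappa> k} a"
  define u where "u = marginal p {j. \<kappa> j < \<kappa> k} a"
  have lu: "0 \<le> l" "l \<le> u"
    unfolding l_def u_def marginal_def by (auto intro!: finite_measure_mono simp: sets_p space_p)
  show ?thesis
  proof (cases "l = 0")
    \<comment> \<open>Division by zero yields 0, and so does \<open>ln 0\<close>.\<close>
    case True then show ?thesis by (simp add: cond_info_def l_def)
  next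
    case False
    then have "1 \<le> u / l" using lu by simp
    then show ?thesis by (simp add: cond_info_def l_def u_def)
  qed
qed

lemma h_nonneg: "0 \<le> h k"
  unfolding h_def by (intro integral_nonneg_AE AE_I2 cond_info_nonneg)

lemma ratio_coord:
  assumes "set w \<subseteq> E"
  shows "interval_IFS.ratio (\<phi> k) (coord k w) = exp (- (\<Sum>a\<leftarrow>w. log_ratio k a))"
proof -
  interpret I: interval_IFS "\<phi> k" "A k" by (rule interval)
  show ?thesis
    using assms
  proof (induction w)
    case Nil
    then show ?case by (simp add: coord_def)
  next
    case (Cons a w)
    then show ?case
      using contraction_ratio(1)[OF letter_similarity[of a k]]
      by (simp add: log_ratio_def exp_diff exp_minus divide_inverse)
  qed
qed

lemma coding_nth: "\<omega> \<in> space Om \<Longrightarrow> coding_map \<phi> \<omega> $ k = code1 (\<phi> k) (\<lambda>n. \<omega> n k)"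
  by (rule coding_map_nth[OF ifs]) (auto simp: space_Om)

lemma coding_measurable: "coding_map \<phi> \<in> borel_measurable Om"
proof (rule borel_measurable_LIMSEQ_metric)
  show "(\<lambda>n. word_map \<phi> \<omega> n 0) \<longlonglongrightarrow> coding_map \<phi> \<omega>" if "\<omega> \<in> space Om" for \<omega>
  proof -
    have E: "\<And>n. \<omega> n \<in> E" using that by (auto simp: space_Om)
    have "coding_map \<phi> \<omega> = (\<chi> i. code1 (\<phi> i) (\<lambda>n. \<omega> n i))"
      using coding_nth[OF that] by (simp add: vec_eq_iff)
    then show ?thesis using word_map_LIMSEQ[OF ifs E] by simp
  qed
  show "(\<lambda>\<omega>. word_map \<phi> \<omega> n 0) \<in> borel_measurable Om" for n
  proof (rule measurableI)
    fix B :: "(real ^ 'd) set"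
    have "word_map \<phi> \<omega> n 0 = (\<chi> i. foldr (\<phi> i) (map (\<lambda>a. a i) (map \<omega> [0..<n])) 0)" for \<omega>
      by (simp add: vec_eq_iff word_map_nth o_def)
    then have "(\<lambda>\<omega>. word_map \<phi> \<omega> n 0) -` B \<inter> space Om
       = {\<omega>\<in>space Om. (\<lambda>w. (\<chi> i. foldr (\<phi> i) (map (\<lambda>a. a i) w) 0) \<in> B) (map \<omega> [0..<n])}"
      by auto
    also have "\<dots> \<in> sets Om" by (rule measurable_prefix)
    finally show "(\<lambda>\<omega>. word_map \<phi> \<omega> n 0) -` B \<inter> space Om \<in> sets Om" .
  qed simp
qed

text \<open>Chain rule along the order of the exponents: for \<open>a\<close> in
  \<open>supp\<close>, \<open>exp (- cond_info \<kappa> p k a)\<close> is the conditional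
  probability of the letter \<open>a k\<close> given the preceding coordinates. The induction
  removes the last coordinate of the initial segment.\<close>

lemma marginal_telescope:
  assumes S: "\<And>j k. k \<in> S \<Longrightarrow> \<kappa> j < \<kappa> k \<Longrightarrow> j \<in> S" and a: "a \<in> supp"
  shows "marginal p S a = (\<Prod>k\<in>S. exp (- cond_info \<kappa> p k a))"
  using finite[of S] S
proof (induction "card S" arbitrary: S)
  case 0
  then show ?case using prob_space by (simp add: marginal_def)
next
  case (Suc n)
  then have "S \<noteq> {}" by auto
  then obtain k where k: "k \<in> S" "\<And>j. j \<in> S \<Longrightarrow> \<kappa> j \<le> \<kappa> k"
    using ex_is_arg_min_if_finite[of S "\<lambda>j. - \<kappa> j"] by (auto simp: is_arg_min_linorder)
  have k': "\<kappa> j < \<kappa> k" if "j \<in> S" "j \<noteq> k" for j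
    using k(2)[OF that(1)] that inj_\<kappa> by (metis injD order_le_less)
  have S: "S = {j. \<kappa> j \<le> \<kappa> k}"
    using k Suc.prems(2)[OF k(1)] inj_\<kappa> by (auto simp: order_le_less dest: injD)
  have S': "S - {k} = {j. \<kappa> j < \<kappa> k}"
    using k' Suc.prems(2)[OF k(1)] by auto
  have "marginal p (S - {k}) a = (\<Prod>k\<in>S - {k}. exp (- cond_info \<kappa> p k a))"
  proof (rule Suc.hyps(1))
    show "n = card (S - {k})" using Suc.hyps(2) k(1) by simp
    show "j \<in> S - {k}" if "i \<in> S - {k}" "\<kappa> j < \<kappa> i" for i j
      using that unfolding S' by simp
  qed simp
  moreover have "marginal p S a = marginal p (S - {k}) a * exp (- cond_info \<kappa> p k a)"
  proof -
    have "exp (- ln (x / y)) = y / x" if "0 < x" "0 < y" for x y :: real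
      using that by (simp add: exp_minus)
    then have "exp (- cond_info \<kappa> p k a) = marginal p S a / marginal p (S - {k}) a"
      unfolding S' unfolding S cond_info_def using marginal_pos[OF a] by blast
    then show ?thesis using marginal_pos[OF a, of "S - {k}"] by simp
  qed
  ultimately show ?case using k(1) by (simp add: prod.remove mult.commute)
qed

section \<open>Approximate cubes in the symbolic space\<close>

definition N\<^sub>c :: "nat \<Rightarrow> 'd \<Rightarrow> nat" where
  "N\<^sub>c T k = nat \<lceil>real T / \<kappa> k\<rceil>"

lemma N\<^sub>c_bounds: "T / \<kappa> k \<le> N\<^sub>c T k" "N\<^sub>c T k \<le> T / \<kappa> k + 1"
proof -
  have "0 \<le> T / \<kappa> k" using \<kappa>_pos[of k] by simp
  then show "T / \<kappa> k \<le> N\<^sub>c T k" "N\<^sub>c T k \<le> T / \<kappa> k + 1" unfolding N\<^sub>c_def by linarith+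
qed

lemma N\<^sub>c_antimono: "\<kappa> j \<le> \<kappa> k \<Longrightarrow> N\<^sub>c T k \<le> N\<^sub>c T j"
  unfolding N\<^sub>c_def using \<kappa>_pos[of k] \<kappa>_pos[of j]
  by (intro nat_mono ceiling_mono divide_left_mono) auto

lemma N\<^sub>c_at_top: "filterlim (\<lambda>T. N\<^sub>c T k) sequentially sequentially"
proof -
  have "filterlim (\<lambda>T. real T * (1 / \<kappa> k)) at_top sequentially"
    using \<kappa>_pos[of k] by (intro filterlim_at_top_mult_tendsto_pos[OF tendsto_const] filterlim_real_sequentially) auto
  then have "filterlim (\<lambda>T. real (N\<^sub>c T k)) at_top sequentially"
    by (rule filterlim_at_top_mono) (use N\<^sub>c_bounds(1)[of _ k] in auto)
  then show ?thesis by (simp add: filterlim_sequentially_iff_filterlim_real)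
qed

text \<open>Approximate cubes: sequences whose coordinate \<open>k\<close> is prescribed up to the time
  \<open>N\<^sub>c T k\<close> at which it has contracted to size about \<open>exp (- T)\<close>.\<close>

definition cube :: "nat \<Rightarrow> (nat \<Rightarrow> 'd \<Rightarrow> 'a) \<Rightarrow> (nat \<Rightarrow> 'd \<Rightarrow> 'a) set" where
  "cube T \<omega> = {\<omega>'\<in>space Om. \<forall>k. \<forall>m<N\<^sub>c T k. \<omega>' m k = \<omega> m k}"

text \<open>Each coordinate is tested at its own time \<open>N\<^sub>c T k\<close>, because the mass
  and the size of a cube involve coordinate \<open>k\<close> up to this time only.\<close>

definition typ_at :: "real \<Rightarrow> nat \<Rightarrow> (nat \<Rightarrow> 'd \<Rightarrow> 'a) \<Rightarrow> bool" where
  "typ_at e T \<omega> \<longleftrightarrow> (\<forall>k. typical {cond_info \<kappa> p k, log_ratio k} e (N\<^sub>c T k) (map \<omega> [0..<N\<^sub>c T k]))"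

lemma not_typ_at_tendsto:
  assumes "0 < e" shows "(\<lambda>T. measure Om {\<omega>\<in>space Om. \<not> typ_at e T \<omega>}) \<longlonglongrightarrow> 0"
proof -
  define bad where "bad k N = {\<omega>\<in>space Om. \<not> typical {cond_info \<kappa> p k, log_ratio k} e N (map \<omega> [0..<N])}" for k N
  have badm: "bad k N \<in> sets Om" for k N unfolding bad_def by (rule measurable_prefix)
  have "(\<lambda>N. measure Om (bad k N)) \<longlonglongrightarrow> 0" for k
    unfolding bad_def by (rule typical_tendsto) (use assms in auto)
  from filterlim_compose[OF this N\<^sub>c_at_top]
  have "(\<lambda>T. \<Sum>k\<in>UNIV. measure Om (bad k (N\<^sub>c T k))) \<longlonglongrightarrow> (\<Sum>k\<in>(UNIV::'d set). 0)"
    by (intro tendsto_sum) auto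
  then have lim: "(\<lambda>T. \<Sum>k\<in>UNIV. measure Om (bad k (N\<^sub>c T k))) \<longlonglongrightarrow> 0" by simp
  have eq: "{\<omega>\<in>space Om. \<not> typ_at e T \<omega>} = (\<Union>k\<in>UNIV. bad k (N\<^sub>c T k))" for T
    by (auto simp: typ_at_def bad_def)
  have "norm (measure Om {\<omega>\<in>space Om. \<not> typ_at e T \<omega>}) \<le> (\<Sum>k\<in>UNIV. measure Om (bad k (N\<^sub>c T k)))" for T
    unfolding eq real_norm_def abs_of_nonneg[OF measure_nonneg] by (intro measure_UNION_le finite badm)
  then show ?thesis by (intro Lim_null_comparison[OF always_eventually lim] allI)
qed

lemma typ_at_sets: "{\<omega>\<in>space Om. \<not> typ_at e T \<omega>} \<in> sets Om"
proof -
  have "{\<omega>\<in>space Om. \<not> typ_at e T \<omega>}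
     = (\<Union>k\<in>UNIV. {\<omega>\<in>space Om. \<not> typical {cond_info \<kappa> p k, log_ratio k} e (N\<^sub>c T k) (map \<omega> [0..<N\<^sub>c T k])})"
    by (auto simp: typ_at_def)
  also have "\<dots> \<in> sets Om" by (intro sets.finite_UN finite measurable_prefix)
  finally show ?thesis .
qed

text \<open>At time \<open>m\<close> a cube prescribes the coordinates with
  \<open>m < N\<^sub>c T k\<close>, an initial segment of the order, so the chain rule writes the
  mass as a double product. Exchanging the products collects the information of each coordinate up
  to its own time, which typicality compares with \<open>h k\<close>.\<close>

lemma measure_cube:
  assumes \<omega>: "\<omega> \<in> space Om" and typ_at: "typ_at e T \<omega>"
  shows "cube T \<omega> \<in> sets Om"
    and "exp (- (\<Sum>k\<in>UNIV. N\<^sub>c T k * (h k + e))) \<le> measure Om (cube T \<omega>)"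
proof -
  define n where "n = Max (range (N\<^sub>c T))"
  have n: "N\<^sub>c T k \<le> n" for k by (simp add: n_def)
  have cube: "cube T \<omega> = {\<omega>'\<in>space Om. \<forall>m<n. \<omega>' m \<in> {b\<in>E. \<forall>k\<in>{k. m < N\<^sub>c T k}. b k = \<omega> m k}}"
  proof (intro equalityI subsetI)
    fix \<omega>' assume "\<omega>' \<in> cube T \<omega>"
    then show "\<omega>' \<in> {\<omega>'\<in>space Om. \<forall>m<n. \<omega>' m \<in> {b\<in>E. \<forall>k\<in>{k. m < N\<^sub>c T k}. b k = \<omega> m k}}"
      by (auto simp: cube_def space_Om)
  next
    fix \<omega>' assume *: "\<omega>' \<in> {\<omega>'\<in>space Om. \<forall>m<n. \<omega>' m \<in> {b\<in>E. \<forall>k\<in>{k. m < N\<^sub>c T k}. b k = \<omega> m k}}"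
    have "\<omega>' m k = \<omega> m k" if "m < N\<^sub>c T k" for m k
    proof -
      have "m < n" using that n[of k] by simp
      then show ?thesis using * that by auto
    qed
    then show "\<omega>' \<in> cube T \<omega>" using * by (simp add: cube_def)
  qed
  show "cube T \<omega> \<in> sets Om" unfolding cube by (rule cylinder) auto
  have supp: "\<omega> m \<in> supp" if "m < N\<^sub>c T k" for m k
  proof -
    have "set (map \<omega> [0..<N\<^sub>c T k]) \<subseteq> supp" using typ_at unfolding typ_at_def typical_def by blast
    moreover have "\<omega> m \<in> set (map \<omega> [0..<N\<^sub>c T k])" using that by simp
    ultimately show ?thesis by blast
  qed
  have "measure Om (cube T \<omega>) = (\<Prod>m<n. marginal p {k. m < N\<^sub>c T k} (\<omega> m))"
    unfolding cube marginal_def space_p by (rule cylinder) auto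
  also have "\<dots> = (\<Prod>m<n. \<Prod>k\<in>UNIV. if m < N\<^sub>c T k then exp (- cond_info \<kappa> p k (\<omega> m)) else 1)"
  proof (intro prod.cong refl)
    fix m
    show "marginal p {k. m < N\<^sub>c T k} (\<omega> m) = (\<Prod>k\<in>UNIV. if m < N\<^sub>c T k then exp (- cond_info \<kappa> p k (\<omega> m)) else 1)"
    proof (cases "\<exists>k. m < N\<^sub>c T k")
      case True
      then have sm: "\<omega> m \<in> supp" using supp by blast
      have "marginal p {k. m < N\<^sub>c T k} (\<omega> m) = (\<Prod>k\<in>{k. m < N\<^sub>c T k}. exp (- cond_info \<kappa> p k (\<omega> m)))"
      proof (rule marginal_telescope)
        show "\<omega> m \<in> supp" by (rule sm)
        fix j k assume "k \<in> {k. m < N\<^sub>c T k}" "\<kappa> j < \<kappa> k"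
        then show "j \<in> {k. m < N\<^sub>c T k}" using N\<^sub>c_antimono[of j k T] by simp
      qed
      then show ?thesis by (simp add: prod.If_cases)
    next
      case False
      then have "{k. m < N\<^sub>c T k} = {}" by auto
      then show ?thesis using False prob_space by (simp add: marginal_def)
    qed
  qed
  also have "\<dots> = (\<Prod>k\<in>UNIV. \<Prod>m<n. if m < N\<^sub>c T k then exp (- cond_info \<kappa> p k (\<omega> m)) else 1)"
    by (rule prod.swap)
  also have "\<dots> = (\<Prod>k\<in>UNIV. \<Prod>m<N\<^sub>c T k. exp (- cond_info \<kappa> p k (\<omega> m)))"
  proof (rule prod.cong[OF refl])
    fix k
    have "{..<n} \<inter> {m. m < N\<^sub>c T k} = {..<N\<^sub>c T k}" using n[of k] by auto
    then show "(\<Prod>m<n. if m < N\<^sub>c T k then exp (- cond_info \<kappa> p k (\<omega> m)) else 1)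
        = (\<Prod>m<N\<^sub>c T k. exp (- cond_info \<kappa> p k (\<omega> m)))"
      by (simp add: prod.If_cases)
  qed
  also have "\<dots> = exp (- (\<Sum>k\<in>UNIV. \<Sum>m<N\<^sub>c T k. cond_info \<kappa> p k (\<omega> m)))"
    by (simp add: exp_sum sum_negf[symmetric])
  also have "\<dots> \<ge> exp (- (\<Sum>k\<in>UNIV. N\<^sub>c T k * (h k + e)))"
  proof -
    have "(\<Sum>m<N\<^sub>c T k. cond_info \<kappa> p k (\<omega> m)) \<le> N\<^sub>c T k * (h k + e)" for k
    proof -
      have "\<bar>(\<Sum>a\<leftarrow>map \<omega> [0..<N\<^sub>c T k]. cond_info \<kappa> p k a) - N\<^sub>c T k * h k\<bar> < e * N\<^sub>c T k"
        using typ_at unfolding typ_at_def typical_def h_def by simp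
      moreover have "(\<Sum>a\<leftarrow>map \<omega> [0..<N\<^sub>c T k]. cond_info \<kappa> p k a) = (\<Sum>m<N\<^sub>c T k. cond_info \<kappa> p k (\<omega> m))"
        by (simp add: o_def interv_sum_list_conv_sum_set_nat atLeast0LessThan)
      ultimately show ?thesis by (simp add: algebra_simps)
    qed
    then show ?thesis by (simp add: sum_mono)
  qed
  finally show "exp (- (\<Sum>k\<in>UNIV. N\<^sub>c T k * (h k + e))) \<le> measure Om (cube T \<omega>)" .
qed

text \<open>Two cubes are equal or disjoint, and each typical one has mass at least
  \<open>q\<close>; so every finite subfamily has at most \<open>1 / q\<close> members, which also
  yields finiteness.\<close>

lemma card_cubes:
  fixes e :: real and T :: nat
  defines "Q \<equiv> cube T ` {\<omega>\<in>space Om. typ_at e T \<omega>}"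
  shows "finite Q" and "card Q \<le> exp (\<Sum>k\<in>UNIV. N\<^sub>c T k * (h k + e))"
proof -
  define q where "q = exp (- (\<Sum>k\<in>UNIV. N\<^sub>c T k * (h k + e)))"
  have bound: "card F * q \<le> 1" if F: "F \<subseteq> Q" "finite F" for F
  proof -
    have "card F * q = (\<Sum>C\<in>F. q)" by simp
    also have "\<dots> \<le> (\<Sum>C\<in>F. measure Om C)"
      using F(1) measure_cube(2) by (intro sum_mono) (auto simp: Q_def q_def)
    also have "\<dots> = measure Om (\<Union>C\<in>F. C)"
    proof (rule O.P.finite_measure_finite_Union[symmetric, OF F(2)])
      show "(\<lambda>C. C) ` F \<subseteq> sets Om" using F(1) measure_cube(1) by (auto simp: Q_def)
      show "disjoint_family_on (\<lambda>C. C) F"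
        unfolding disjoint_family_on_def
      proof (intro ballI impI)
        fix C D assume CD: "C \<in> F" "D \<in> F" "C \<noteq> D"
        have "C \<in> Q" "D \<in> Q" using CD F(1) by auto
        then obtain \<omega> \<omega>' where w: "C = cube T \<omega>" "D = cube T \<omega>'" unfolding Q_def by (elim imageE) blast
        show "C \<inter> D = {}"
        proof (rule ccontr)
          assume "C \<inter> D \<noteq> {}"
          then obtain x where "x \<in> cube T \<omega>" "x \<in> cube T \<omega>'" using w by blast
          then have "\<omega> m k = \<omega>' m k" if "m < N\<^sub>c T k" for m k using that by (auto simp: cube_def)
          then have "cube T \<omega> = cube T \<omega>'" by (auto simp: cube_def)
          then show False using CD(3) w by simp
        qed
      qed
    qed
    also have "\<dots> \<le> 1" by simp
    finally show ?thesis .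
  qed
  have q: "q > 0" by (simp add: q_def)
  have "finite Q \<and> card Q \<le> nat \<lfloor>1 / q\<rfloor>"
  proof (rule finite_if_finite_subsets_card_bdd)
    fix F assume "F \<subseteq> Q" "finite F"
    from bound[OF this] q have "card F \<le> 1 / q" by (simp add: field_simps)
    then show "card F \<le> nat \<lfloor>1 / q\<rfloor>" by (simp add: le_nat_floor)
  qed
  then show fin: "finite Q" ..
  show "card Q \<le> exp (\<Sum>k\<in>UNIV. N\<^sub>c T k * (h k + e))"
    using bound[OF subset_refl fin] q by (simp add: q_def exp_minus field_simps)
qed

text \<open>Closures are taken so that the set assembled from these images is Borel. The common
  lower bound \<open>\<kappa>0\<close> of the exponents lets one relative error
  \<open>e / \<kappa>0\<close> serve all coordinates.\<close>

lemma diameter_cube: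
  assumes \<omega>: "\<omega> \<in> space Om" and typ_at: "typ_at e T \<omega>" and e: "\<And>k. e \<le> \<kappa> k" "\<And>k. \<kappa>0 \<le> \<kappa> k" "0 < \<kappa>0" "0 < e"
  shows "bounded (closure (coding_map \<phi> ` cube T \<omega>))"
    and "diameter (closure (coding_map \<phi> ` cube T \<omega>)) \<le> CARD('d) * exp (- real T * (1 - e / \<kappa>0))"
proof -
  let ?D = "CARD('d) * exp (- real T * (1 - e / \<kappa>0))"
  have c: "\<bar>coding_map \<phi> x $ k - coding_map \<phi> y $ k\<bar> \<le> exp (- real T * (1 - e / \<kappa>0))"
    if x: "x \<in> cube T \<omega>" and y: "y \<in> cube T \<omega>" for x y k
  proof -
    interpret I: interval_IFS "\<phi> k" "A k" by (rule interval)
    have xy: "x \<in> space Om" "y \<in> space Om" using x y by (auto simp: cube_def)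
    have m: "map (\<lambda>n. x n k) [0..<N\<^sub>c T k] = map (\<lambda>n. \<omega> n k) [0..<N\<^sub>c T k]"
      using x by (simp add: cube_def)
    have "\<bar>coding_map \<phi> x $ k - coding_map \<phi> y $ k\<bar> \<le> I.ratio (map (\<lambda>n. x n k) [0..<N\<^sub>c T k])"
      unfolding coding_nth[OF xy(1)] coding_nth[OF xy(2)]
      using xy x y letter_mem by (intro I.code1_dist_le) (auto simp: space_Om cube_def Pi_iff)
    also have "\<dots> = exp (- (\<Sum>a\<leftarrow>map \<omega> [0..<N\<^sub>c T k]. log_ratio k a))"
    proof -
      have "set (map \<omega> [0..<N\<^sub>c T k]) \<subseteq> E" using \<omega> by (auto simp: space_Om)
      from ratio_coord[OF this, of k] show ?thesis unfolding m by (simp add: coord_def o_def)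
    qed
    also have "\<dots> \<le> exp (- real T * (1 - e / \<kappa>0))"
    proof -
      have "\<bar>(\<Sum>a\<leftarrow>map \<omega> [0..<N\<^sub>c T k]. log_ratio k a) - N\<^sub>c T k * \<kappa> k\<bar> < e * N\<^sub>c T k"
        using typ_at unfolding typ_at_def typical_def expectation_log_ratio[symmetric] by simp
      then have "N\<^sub>c T k * (\<kappa> k - e) \<le> (\<Sum>a\<leftarrow>map \<omega> [0..<N\<^sub>c T k]. log_ratio k a)" by (simp add: algebra_simps)
      moreover have "T / \<kappa> k * (\<kappa> k - e) \<le> N\<^sub>c T k * (\<kappa> k - e)"
        using e(1)[of k] by (intro mult_right_mono N\<^sub>c_bounds) auto
      moreover have "T * (1 - e / \<kappa>0) \<le> T / \<kappa> k * (\<kappa> k - e)"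
      proof -
        have "e / \<kappa> k \<le> e / \<kappa>0" using e \<kappa>_pos[of k] by (intro divide_left_mono) auto
        then have "T * (1 - e / \<kappa>0) \<le> T * (1 - e / \<kappa> k)" by (intro mult_left_mono) auto
        also have "\<dots> = T / \<kappa> k * (\<kappa> k - e)" using \<kappa>_pos[of k] by (simp add: field_simps)
        finally show ?thesis .
      qed
      ultimately show ?thesis by simp
    qed
    finally show ?thesis .
  qed
  have d: "dist x y \<le> ?D" if xy: "x \<in> coding_map \<phi> ` cube T \<omega>" "y \<in> coding_map \<phi> ` cube T \<omega>" for x y
  proof -
    have "dist x y \<le> (\<Sum>k\<in>UNIV. \<bar>(x - y) $ k\<bar>)" unfolding dist_norm by (rule norm_le_l1_cart)
    also have "\<dots> \<le> (\<Sum>k\<in>(UNIV::'d set). exp (- real T * (1 - e / \<kappa>0)))"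
      using xy c by (intro sum_mono) auto
    finally show ?thesis by simp
  qed
  have b: "bounded (coding_map \<phi> ` cube T \<omega>)"
    using d unfolding bounded_two_points by blast
  then show "bounded (closure (coding_map \<phi> ` cube T \<omega>))" by (rule bounded_closure)
  have "diameter (coding_map \<phi> ` cube T \<omega>) \<le> ?D"
    using d by (intro diameter_le) (auto simp: dist_norm)
  then show "diameter (closure (coding_map \<phi> ` cube T \<omega>)) \<le> ?D"
    using diameter_closure[OF b] by simp
qed

text \<open>Along scales \<open>T j\<close> with summable exceptional probabilities, Borel-Cantelli
  makes almost every sequence typical at all late scales. The set \<open>S\<close> is the lower
  limit of the closed sets \<open>C (T j)\<close>, and each of its pieces is covered at every late
  scale by few closed images of typical cubes.\<close>

lemma null_complement:
  assumes s: "(\<Sum>k\<in>UNIV. h k / \<kappa> k) < s"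
  shows "\<exists>S\<in>sets (bernoulli_measure \<phi> p). emeasure (bernoulli_measure \<phi> p) (space (bernoulli_measure \<phi> p) - S) = 0
    \<and> hausdorff_measure s S = 0"
proof -
  define \<delta> where "\<delta> = (\<Sum>k\<in>UNIV. h k / \<kappa> k)"
  have "0 \<le> \<delta>" unfolding \<delta>_def using h_nonneg \<kappa>_pos by (intro sum_nonneg divide_nonneg_pos) auto
  then have s0: "0 < s" using s by (simp add: \<delta>_def)
  define \<kappa>0 where "\<kappa>0 = Min (range \<kappa>)"
  have \<kappa>0: "0 < \<kappa>0" "\<And>k. \<kappa>0 \<le> \<kappa> k" using \<kappa>_pos by (auto simp: \<kappa>0_def)
  define r where "r = (\<Sum>k\<in>UNIV. 1 / \<kappa> k)"
  have r: "0 \<le> r" unfolding r_def using \<kappa>_pos by (intro sum_nonneg) (auto intro: less_imp_le)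
  \<comment> \<open>The error in the exponent is \<open>e * r\<close> from the number of cubes plus
    \<open>e * (s / \<kappa>0)\<close> from their diameter; this \<open>e\<close> makes it half of
    the margin \<open>s - \<delta>\<close>.\<close>
  define e where "e = (s - \<delta>) / (2 * (r + s / \<kappa>0))"
  have den: "0 < r + s / \<kappa>0" using r s0 \<kappa>0 by (intro add_nonneg_pos) auto
  have e0: "0 < e" using s den unfolding e_def \<delta>_def by (intro divide_pos_pos) auto
  have "(s - \<delta>) / (2 * x) * x = (s - \<delta>) / 2" if "0 < x" for x :: real using that by simp
  from this[OF den] have e2: "e * (r + s / \<kappa>0) = (s - \<delta>) / 2" by (simp only: e_def)
  have es: "e * (s / \<kappa>0) < s"
  proof -
    have "e * r + e * (s / \<kappa>0) = (s - \<delta>) / 2" using e2 by (simp only: distrib_left)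
    moreover have "0 \<le> e * r" using e0 r by simp
    moreover have "z < s" if "y + z = (s - \<delta>) / 2" "0 \<le> y" for y z :: real
      using that s0 \<open>0 \<le> \<delta>\<close> by (simp add: field_simps)
    ultimately show ?thesis by blast
  qed
  have e_le: "e \<le> \<kappa> k" for k
  proof -
    have "e * (s / \<kappa>0) \<le> s" using es by simp
    then have "e \<le> \<kappa>0" using s0 \<kappa>0 by (simp add: field_simps)
    then show ?thesis using \<kappa>0(2)[of k] by linarith
  qed
  define b where "b = 1 - e / \<kappa>0"
  define a where "a = \<delta> + e * r"
  have ab: "a - s * b = - ((s - \<delta>) / 2)"
  proof -
    have "a - s * b = \<delta> - s + e * (r + s / \<kappa>0)" by (simp add: a_def b_def algebra_simps)
    also have "\<dots> = - ((s - \<delta>) / 2)" unfolding e2 by (simp add: field_simps)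
    finally show ?thesis .
  qed
  define c where "c = (\<Sum>k\<in>UNIV. h k + e)"
  define C where "C T = (\<Union>Q\<in>cube T ` {\<omega>\<in>space Om. typ_at e T \<omega>}. closure (coding_map \<phi> ` Q))" for T
  have C_closed: "closed (C T)" for T
    unfolding C_def using card_cubes(1) by (intro closed_UN) auto
  have "\<forall>j. \<exists>T. j \<le> T \<and> measure Om {\<omega>\<in>space Om. \<not> typ_at e T \<omega>} < (1/2) ^ j"
  proof
    fix j
    show "\<exists>T. j \<le> T \<and> measure Om {\<omega>\<in>space Om. \<not> typ_at e T \<omega>} < (1/2) ^ j"
  proof -
    have "\<forall>\<^sub>F T in sequentially. measure Om {\<omega>\<in>space Om. \<not> typ_at e T \<omega>} < (1/2) ^ j"
      by (rule order_tendstoD(2)[OF not_typ_at_tendsto[OF e0]]) simp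
    then have "\<forall>\<^sub>F T in sequentially. j \<le> T \<and> measure Om {\<omega>\<in>space Om. \<not> typ_at e T \<omega>} < (1/2) ^ j"
      using eventually_ge_at_top[of j] by eventually_elim simp
    then show ?thesis by (blast dest: eventually_happens'[OF sequentially_bot])
  qed
  qed
  from choice[OF this] obtain T where
    T': "\<forall>j. j \<le> T j \<and> measure Om {\<omega>\<in>space Om. \<not> typ_at e (T j) \<omega>} < (1/2) ^ j" ..
  then have T: "\<And>j. j \<le> T j" "\<And>j. measure Om {\<omega>\<in>space Om. \<not> typ_at e (T j) \<omega>} < (1/2) ^ j"
    by simp_all
  define S where "S = (\<Union>J. \<Inter>j\<in>{J..}. C (T j))"
  have S_borel: "S \<in> sets borel"
    unfolding S_def using C_closed by (intro sets.countable_UN sets.countable_INT) auto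
  have AE: "AE \<omega> in Om. coding_map \<phi> \<omega> \<in> S"
  proof -
    have "summable (\<lambda>j. measure Om {\<omega>\<in>space Om. \<not> typ_at e (T j) \<omega>})"
    proof (rule summable_comparison_test')
      show "summable (\<lambda>j. (1/2 :: real) ^ j)" by (simp add: summable_geometric)
      show "norm (measure Om {\<omega>\<in>space Om. \<not> typ_at e (T j) \<omega>}) \<le> (1/2) ^ j" for j
        using T(2)[of j] by simp
    qed
    then have "AE \<omega> in Om. \<forall>\<^sub>F j in sequentially. \<omega> \<in> space Om - {\<omega>\<in>space Om. \<not> typ_at e (T j) \<omega>}"
      by (intro borel_cantelli_AE1 typ_at_sets) (auto simp: O.P.emeasure_eq_measure)
    then show ?thesis
    proof eventually_elim
      case (elim \<omega>)
      then obtain J where J: "\<And>j. J \<le> j \<Longrightarrow> \<omega> \<in> space Om \<and> typ_at e (T j) \<omega>"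
        by (auto simp: eventually_sequentially)
      have "coding_map \<phi> \<omega> \<in> C (T j)" if "J \<le> j" for j
      proof -
        have "\<omega> \<in> cube (T j) \<omega>" using J[OF that] by (simp add: cube_def)
        then have "coding_map \<phi> \<omega> \<in> closure (coding_map \<phi> ` cube (T j) \<omega>)"
          by (intro subsetD[OF closure_subset] imageI)
        moreover have "cube (T j) \<omega> \<in> cube (T j) ` {\<omega>\<in>space Om. typ_at e (T j) \<omega>}"
          using J[OF that] by (intro imageI) simp
        ultimately show ?thesis unfolding C_def by (rule UN_I[rotated])
      qed
      then show ?case unfolding S_def by (intro UN_I[of J] INT_I) auto
    qed
  qed
  have "emeasure (bernoulli_measure \<phi> p) (space (bernoulli_measure \<phi> p) - S) = 0"
  proof -
    have eq: "coding_map \<phi> -` (UNIV - S) \<inter> space Om = {\<omega>\<in>space Om. \<not> coding_map \<phi> \<omega> \<in> S}" by auto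
    have N: "{\<omega>\<in>space Om. \<not> coding_map \<phi> \<omega> \<in> S} \<in> sets Om"
      unfolding eq[symmetric] using S_borel by (intro measurable_sets[OF coding_measurable]) auto
    have "emeasure (bernoulli_measure \<phi> p) (space (bernoulli_measure \<phi> p) - S)
        = emeasure Om (coding_map \<phi> -` (UNIV - S) \<inter> space Om)"
      unfolding bernoulli_measure_def using S_borel
      by (subst emeasure_distr[OF coding_measurable]) auto
    also have "\<dots> = 0"
      unfolding eq by (rule AE_iff_measurable[OF N refl, THEN iffD1, OF AE])
    finally show ?thesis .
  qed
  moreover have "hausdorff_measure s S = 0"
    unfolding S_def
  proof (rule hausdorff_measure_zero_UN, rule hausdorff_measure_zero_finite_covers[OF s0])
    fix J and \<epsilon> :: real assume \<epsilon>: "\<epsilon> > 0"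
    define D where "D T = CARD('d) * exp (- real T * b)" for T :: nat
    have b: "b > 0" 
      using es s0 \<kappa>0 by (simp add: b_def field_simps)
    have expo: "(\<lambda>T. M * exp (- real T * x)) \<longlonglongrightarrow> 0" if "x > 0" for M x :: real
    proof -
      have "(\<lambda>T. M * exp (- x) ^ T) \<longlonglongrightarrow> M * 0"
        using that by (intro tendsto_mult tendsto_const LIMSEQ_realpow_zero) auto
      then show ?thesis by (simp add: exp_of_nat_mult[symmetric])
    qed
    have lim1: "D \<longlonglongrightarrow> 0" unfolding D_def using b by (rule expo)
    have lim2: "(\<lambda>T. (exp c * CARD('d) powr s) * exp (- real T * ((s - \<delta>) / 2))) \<longlonglongrightarrow> 0"
      using s by (intro expo) (simp add: \<delta>_def)
    have "\<forall>\<^sub>F T in sequentially. D T < \<epsilon> \<and> (exp c * CARD('d) powr s) * exp (- real T * ((s - \<delta>) / 2)) < \<epsilon>"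
      using \<epsilon> by (intro eventually_conj order_tendstoD(2)[OF lim1] order_tendstoD(2)[OF lim2])
    then obtain T0 where T0: "\<And>T. T0 \<le> T \<Longrightarrow> D T < \<epsilon> \<and> (exp c * CARD('d) powr s) * exp (- real T * ((s - \<delta>) / 2)) < \<epsilon>"
      by (auto simp: eventually_sequentially)
    \<comment> \<open>\<open>J \<le> j\<close> keeps the scale among those intersected, and
      \<open>T0 \<le> j \<le> T j\<close> makes it fine enough.\<close>
    define j where "j = max J T0"
    define \<Q> where "\<Q> = cube (T j) ` {\<omega>\<in>space Om. typ_at e (T j) \<omega>}"
    define \<U> where "\<U> = (\<lambda>Q. closure (coding_map \<phi> ` Q)) ` \<Q>"
    have "T0 \<le> T j" using T(1)[of j] by (simp add: j_def)
    note T0j = T0[OF this]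
    show "\<exists>\<U> D. finite \<U> \<and> (\<Inter>j\<in>{J..}. C (T j)) \<subseteq> \<Union>\<U> \<and> 0 \<le> D \<and> D \<le> \<epsilon> \<and> card \<U> * D powr s \<le> \<epsilon> \<and>
                 (\<forall>U\<in>\<U>. bounded U \<and> diameter U \<le> D)"
    proof (intro exI[of _ \<U>] exI[of _ "D (T j)"] conjI ballI)
      have fin\<Q>: "finite \<Q>" unfolding \<Q>_def by (rule card_cubes(1))
      then show "finite \<U>" unfolding \<U>_def by (rule finite_imageI)
      show "(\<Inter>j\<in>{J..}. C (T j)) \<subseteq> \<Union>\<U>"
      proof -
        have "(\<Inter>j\<in>{J..}. C (T j)) \<subseteq> C (T j)" by (auto simp: j_def)
        also have "\<dots> = \<Union>\<U>" by (simp add: C_def \<U>_def \<Q>_def)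
        finally show ?thesis .
      qed
      show "0 \<le> D (T j)" by (simp add: D_def)
      show "D (T j) \<le> \<epsilon>" using T0j by simp
      have "card \<U> \<le> card \<Q>" unfolding \<U>_def using fin\<Q> by (rule card_image_le)
      then have "real (card \<U>) \<le> exp (\<Sum>k\<in>UNIV. N\<^sub>c (T j) k * (h k + e))"
        using card_cubes(2)[of "T j" e] unfolding \<Q>_def by linarith
      also have "\<dots> \<le> exp (T j * a + c)"
      proof -
        have "N\<^sub>c (T j) k * (h k + e) \<le> T j * (h k / \<kappa> k + e * (1 / \<kappa> k)) + (h k + e)" for k
        proof -
          have "N\<^sub>c (T j) k * (h k + e) \<le> (T j / \<kappa> k + 1) * (h k + e)"
            using N\<^sub>c_bounds(2) h_nonneg[of k] e0 by (intro mult_right_mono) auto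
          also have "\<dots> = T j * (h k / \<kappa> k + e * (1 / \<kappa> k)) + (h k + e)"
            using \<kappa>_pos[of k] by (simp add: field_simps)
          finally show ?thesis .
        qed
        then have "(\<Sum>k\<in>UNIV. N\<^sub>c (T j) k * (h k + e)) \<le> (\<Sum>k\<in>UNIV. T j * (h k / \<kappa> k + e * (1 / \<kappa> k)) + (h k + e))"
          by (intro sum_mono)
        also have "\<dots> = T j * a + c"
          by (simp only: sum.distrib a_def c_def \<delta>_def r_def sum_distrib_left[symmetric])
        finally show ?thesis by simp
      qed
      finally have "card \<U> * D (T j) powr s \<le> exp (T j * a + c) * D (T j) powr s"
        by (intro mult_right_mono) auto
      also have "exp (T j * a + c) * D (T j) powr s = (exp c * CARD('d) powr s) * exp (T j * (a - s * b))"
      proof -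
        have "D (T j) powr s = CARD('d) powr s * exp (- (T j * (s * b)))"
          unfolding D_def by (simp add: powr_mult exp_powr_real mult_ac)
        then show ?thesis by (simp add: exp_add exp_diff exp_minus right_diff_distrib field_simps)
      qed
      also have "\<dots> \<le> \<epsilon>" using T0j unfolding ab by simp
      finally show "card \<U> * D (T j) powr s \<le> \<epsilon>" .
    next
      fix U assume "U \<in> \<U>"
      then obtain \<omega> where \<omega>: "\<omega> \<in> space Om" "typ_at e (T j) \<omega>" "U = closure (coding_map \<phi> ` cube (T j) \<omega>)"
        by (auto simp: \<U>_def \<Q>_def)
      note dc = diameter_cube[OF \<omega>(1,2) e_le \<kappa>0(2,1) e0]
      show "bounded U" "diameter U \<le> D (T j)" using dc unfolding \<omega>(3) D_def b_def by auto
    qed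
  qed
  moreover have "S \<in> sets (bernoulli_measure \<phi> p)" using S_borel by (simp add: bernoulli_measure_def)
  ultimately show ?thesis by blast
qed

theorem hausdorff_dim_bernoulli_le:
  "hausdorff_dim_measure (bernoulli_measure \<phi> p) \<le> ennreal (\<Sum>k\<in>UNIV. h k / \<kappa> k)"
proof (rule ennreal_le_epsilon)
  fix e :: real assume e: "0 < e"
  define \<delta> where "\<delta> = (\<Sum>k\<in>UNIV. h k / \<kappa> k)"
  have \<delta>: "0 \<le> \<delta>" unfolding \<delta>_def using h_nonneg \<kappa>_pos by (intro sum_nonneg divide_nonneg_pos) auto
  obtain S where S: "S \<in> sets (bernoulli_measure \<phi> p)"
    "emeasure (bernoulli_measure \<phi> p) (space (bernoulli_measure \<phi> p) - S) = 0" "hausdorff_measure (\<delta> + e) S = 0"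
    using null_complement[of "\<delta> + e"] e unfolding \<delta>_def by auto
  have "hausdorff_dim_measure (bernoulli_measure \<phi> p) \<le> hausdorff_dim S"
    unfolding hausdorff_dim_measure_def using S by (intro INF_lower) auto
  also have "\<dots> \<le> ennreal (\<delta> + e)" using S \<delta> e by (intro hausdorff_dim_le) auto
  also have "\<dots> = ennreal \<delta> + ennreal e" using \<delta> e by simp
  finally show "hausdorff_dim_measure (bernoulli_measure \<phi> p) \<le> ennreal (\<Sum>k\<in>UNIV. h k / \<kappa> k) + ennreal e"
    by (simp add: \<delta>_def)
qed

end

section \<open>Homogeneous sub-sponges\<close>

definition flat :: "(nat \<Rightarrow> 'b list) \<Rightarrow> nat \<Rightarrow> nat \<Rightarrow> 'b" where
  "flat v L m = v (m div L) ! (m mod L)"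

lemma flat_shift: "0 < L \<Longrightarrow> flat v L (n * L + m) = flat (\<lambda>i. v (n + i)) L m"
  by (simp add: flat_def)

lemma map_flat_block: "length (v 0) = L \<Longrightarrow> map (flat v L) [0..<L] = v 0"
  by (intro nth_equalityI) (auto simp: flat_def)

lemma map_flat:
  assumes "0 < L" "\<And>i. length (v i) = L"
  shows "map (flat v L) [0..<n * L] = concat (map v [0..<n])"
proof (induction n)
  case (Suc n)
  have "[0..<Suc n * L] = [0..<n * L] @ map (\<lambda>i. n * L + i) [0..<L]"
    using upt_add_eq_append[of 0 "n * L" L] by (simp add: add.commute map_add_upt)
  moreover have "map (\<lambda>i. flat v L (n * L + i)) [0..<L] = v n"
    using map_flat_block[of "\<lambda>i. v (n + i)" L] assms by (simp add: flat_shift cong: map_cong)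
  ultimately show ?case using Suc by (simp add: o_def)
qed simp

lemma finite_uniform_gap:
  assumes "finite S" and "\<And>s. s \<in> S \<Longrightarrow> \<exists>\<eta>>0. \<forall>x\<in>R s. \<eta> \<le> (x::real)"
  shows "\<exists>\<eta>>0. \<forall>s\<in>S. \<forall>x\<in>R s. \<eta> \<le> x"
  using assms
proof (induction S)
  case empty
  then show ?case by (auto intro: exI[of _ 1])
next
  case (insert s S)
  obtain \<eta> where "\<eta> > 0" "\<forall>s\<in>S. \<forall>x\<in>R s. \<eta> \<le> x" using insert by auto
  moreover obtain \<eta>' where "\<eta>' > 0" "\<forall>x\<in>R s. \<eta>' \<le> x" using insert.prems by auto
  ultimately show ?case by (intro exI[of _ "min \<eta> \<eta>'"]) (auto simp: min_le_iff_disj)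
qed

locale good_sponge = bernoulli_sponge p E A \<phi>
  for p :: "('d::finite \<Rightarrow> 'a) measure" and E A \<phi> +
  assumes irreducible: "irreducible_measure \<phi> E p" and good: "good_measure \<phi> E p"
begin

lemma irreducible_pair:
  obtains a b where "a \<in> E" "b \<in> E" "a k \<noteq> b k" "\<And>j. \<kappa> j < \<kappa> k \<Longrightarrow> a j = b j"
proof -
  obtain a b where "a \<in> E" "b \<in> E" "a k \<noteq> b k" "{j. a j \<noteq> b j} \<subseteq> {j. \<kappa> k \<le> \<kappa> j}"
    using irreducible unfolding irreducible_measure_def lyapunov_prec_def by blast
  then show thesis by (intro that[of a b]) (auto simp: subset_iff not_le[symmetric])
qed

text \<open>The good set used is the initial segment up to \<open>k\<close>, a sublevel set of the
  exponents at a positive threshold. Before \<open>k\<close> the letters agree, so the common point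
  1/2 is available there, and an overlap in coordinate \<open>k\<close> would make the two boxes
  meet.\<close>

lemma good_disjoint:
  assumes ab: "a \<in> E" "b \<in> E" "a k \<noteq> b k" "\<And>j. \<kappa> j < \<kappa> k \<Longrightarrow> a j = b j"
  shows "\<phi> k (a k) ` {0<..<1} \<inter> \<phi> k (b k) ` {0<..<1} = {}"
proof (rule ccontr)
  assume "\<not> ?thesis"
  then obtain x y where xy: "x \<in> {0<..<1}" "y \<in> {0<..<1}" "\<phi> k (a k) x = \<phi> k (b k) y" by blast
  define I where "I = {i. \<kappa> i \<le> \<kappa> k}"
  have kI: "k \<in> I" by (simp add: I_def)
  have "good_set \<phi> E I" using good \<kappa>_pos[of k] by (simp add: good_measure_def I_def)
  note D = this[unfolded good_set_def disjoint_family_on_def, THEN bspec, OF imageI[OF ab(1)],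
      THEN bspec, OF imageI[OF ab(2)], THEN mp]
  have "restrict a I \<noteq> restrict b I" using ab(3) kI by (metis restrict_apply')
  then have disj: "proj_map \<phi> I (restrict a I) ` (\<Pi>\<^sub>E i\<in>I. {0<..<1})
      \<inter> proj_map \<phi> I (restrict b I) ` (\<Pi>\<^sub>E i\<in>I. {0<..<1}) = {}"
    by (rule D)
  define X where "X z = (\<lambda>i\<in>I. if i = k then z else 1/2 :: real)" for z
  have X: "X z \<in> (\<Pi>\<^sub>E i\<in>I. {0<..<1})" if "z \<in> {0<..<1}" for z
    using that by (auto simp: X_def)
  have "proj_map \<phi> I (restrict a I) (X x) = proj_map \<phi> I (restrict b I) (X y)"
  proof
    fix i
    consider "i \<notin> I" | "i = k" | "\<kappa> i < \<kappa> k"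
      using inj_\<kappa> by (auto simp: I_def order_le_less dest: injD)
    then show "proj_map \<phi> I (restrict a I) (X x) i = proj_map \<phi> I (restrict b I) (X y) i"
    proof cases
      case 3
      then have "i \<in> I" "i \<noteq> k" by (auto simp: I_def)
      then show ?thesis using ab(4)[OF 3] by (simp add: proj_map_def X_def)
    qed (use kI xy in \<open>auto simp: proj_map_def X_def\<close>)
  qed
  then have "proj_map \<phi> I (restrict a I) (X x) \<in> proj_map \<phi> I (restrict b I) ` (\<Pi>\<^sub>E i\<in>I. {0<..<1})"
    using imageI[OF X[OF xy(2)], of "proj_map \<phi> I (restrict b I)"] by simp
  with imageI[OF X[OF xy(1)], of "proj_map \<phi> I (restrict a I)"] disj show False by blast
qed

section \<open>Separation of words\<close>

lemma coord_mem: "set w \<subseteq> E \<Longrightarrow> set (coord k w) \<subseteq> A k"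
  using letter_mem by (auto simp: coord_def)

text \<open>The coordinates are treated in turn, each by appending a two-letter word. Coordinates
  already treated stay so because the appended letters act first and map the closed interval into
  itself; the new one survives the action of \<open>w\<close> because similarities preserve the open
  interval.\<close>

lemma interior_word:
  obtains w where "set w \<subseteq> E" "\<And>k x. x \<in> {0..1} \<Longrightarrow> foldr (\<phi> k) (coord k w) x \<in> {0<..<1}"
proof -
  have "\<exists>w. set w \<subseteq> E \<and> (\<forall>k\<in>K. \<forall>x\<in>{0..1}. foldr (\<phi> k) (coord k w) x \<in> {0<..<1})" if "finite K" for K
    using that
  proof (induction K)
    case empty
    then show ?case by (intro exI[of _ "[]"]) auto
  next
    case (insert k K)
    then obtain w where w: "set w \<subseteq> E" "\<And>j x. j \<in> K \<Longrightarrow> x \<in> {0..1} \<Longrightarrow> foldr (\<phi> j) (coord j w) x \<in> {0<..<1}"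
      by blast
    obtain a b where ab: "a \<in> E" "b \<in> E" "a k \<noteq> b k" "\<And>j. \<kappa> j < \<kappa> k \<Longrightarrow> a j = b j"
      using irreducible_pair by metis
    obtain h h' where "h \<in> {\<phi> k (a k), \<phi> k (b k)}" "h' \<in> {\<phi> k (a k), \<phi> k (b k)}"
       "(\<lambda>x. h (h' x)) ` {0..1} \<subseteq> {0<..<1}"
      using interior_pair[OF letter_similarity[OF ab(1)] letter_similarity[OF ab(2)] good_disjoint[OF ab]] .
    then obtain u v where uv: "u \<in> E" "v \<in> E" "\<And>x. x \<in> {0..1} \<Longrightarrow> \<phi> k (u k) (\<phi> k (v k) x) \<in> {0<..<1}"
      using ab(1,2) by blast
    have "foldr (\<phi> j) (coord j (w @ [u, v])) x \<in> {0<..<1}" if "j \<in> insert k K" and x: "x \<in> {0..1}" for j x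
    proof -
      interpret I: interval_IFS "\<phi> j" "A j" by (rule interval)
      have split: "foldr (\<phi> j) (coord j (w @ [u, v])) x = foldr (\<phi> j) (coord j w) (foldr (\<phi> j) (coord j [u, v]) x)"
        by simp
      have uvE: "set [u, v] \<subseteq> E" using uv by simp
      show ?thesis
      proof (cases "j \<in> K")
        case True
        then show ?thesis
          unfolding split by (intro w(2) I.foldr_mem coord_mem uvE x)
      next
        case False
        with that have "j = k" by simp
        then have "foldr (\<phi> j) (coord j [u, v]) x \<in> {0<..<1}" using uv(3)[OF x] by (simp add: coord_def)
        then show ?thesis unfolding split by (rule I.foldr_open[OF coord_mem[OF w(1)]])
      qed
    qed
    then show ?case using w(1) uv by (intro exI[of _ "w @ [u, v]"]) auto
  qed
  from this[of UNIV] that show thesis by auto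
qed

lemma continuous_foldr:
  assumes "set w \<subseteq> E" shows "continuous_on {0..1} (foldr (\<phi> k) (coord k w))"
proof -
  interpret I: interval_IFS "\<phi> k" "A k" by (rule interval)
  have "(I.ratio (coord k w))-lipschitz_on {0..1} (foldr (\<phi> k) (coord k w))"
    using I.foldr_dist[OF coord_mem[OF assms]] I.ratio_pos[OF coord_mem[OF assms]]
    by (intro lipschitz_onI) (auto simp: dist_real_def)
  then show ?thesis by (rule lipschitz_on_continuous_on)
qed

text \<open>Distinct words sharing the coordinates before \<open>k\<close> have their \<open>k\<close>-th images at positive distance,
  since both end in a word \<open>s\<close> that keeps away from the boundary.\<close>

lemma word_gap:
  assumes s: "set s \<subseteq> E" "\<And>k x. x \<in> {0..1} \<Longrightarrow> foldr (\<phi> k) (coord k s) x \<in> {0<..<1}"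
    and u: "set u \<subseteq> E" and v: "set v \<subseteq> E" and len: "length u = length v"
    and lt: "\<And>j. \<kappa> j < \<kappa> k \<Longrightarrow> coord j (u @ s) = coord j (v @ s)"
    and ne: "coord k (u @ s) \<noteq> coord k (v @ s)"
  shows "\<exists>\<eta>>0. \<forall>x\<in>{0..1}. \<forall>y\<in>{0..1}.
     \<eta> \<le> \<bar>foldr (\<phi> k) (coord k (u @ s)) x - foldr (\<phi> k) (coord k (v @ s)) y\<bar>"
proof -
  interpret I: interval_IFS "\<phi> k" "A k" by (rule interval)
  let ?F = "\<lambda>w. foldr (\<phi> k) (coord k w)"
  have "\<exists>m. m < length u \<and> (u ! m) k \<noteq> (v ! m) k"
  proof -
    have "coord k u \<noteq> coord k v" using ne by auto
    then show ?thesis using len by (auto simp: coord_def list_eq_iff_nth_eq)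
  qed
  note ex = this
  \<comment> \<open>At the first position where column \<open>k\<close> differs, the two letters
    agree in the preceding coordinates, so their open images in coordinate \<open>k\<close> are
    disjoint. The letters after this position followed by \<open>s\<close> map into the open
    interval, where the disjointness applies; compactness turns it into a gap.\<close>
  define m where "m = (LEAST m. m < length u \<and> (u ! m) k \<noteq> (v ! m) k)"
  have m: "m < length u" "(u ! m) k \<noteq> (v ! m) k"
      "\<And>i. i < m \<Longrightarrow> \<not> (i < length u \<and> (u ! i) k \<noteq> (v ! i) k)"
    using LeastI_ex[OF ex] not_less_Least[of _ "\<lambda>m. m < length u \<and> (u ! m) k \<noteq> (v ! m) k"]
    unfolding m_def by blast+
  define a b where "a = u ! m" and "b = v ! m"
  define r where "r w = drop (Suc m) w @ s" for w
  have mv: "m < length v" using m len by simp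
  have ab: "a \<in> E" "b \<in> E" using u v m(1) mv by (auto simp: a_def b_def)
  have "a j = b j" if "\<kappa> j < \<kappa> k" for j
  proof -
    have "coord j (u @ s) ! m = coord j (v @ s) ! m" using lt[OF that] by simp
    then show ?thesis using m(1) mv by (simp add: coord_def a_def b_def nth_append)
  qed
  then have disj: "\<phi> k (a k) ` {0<..<1} \<inter> \<phi> k (b k) ` {0<..<1} = {}"
    using ab m(2) by (intro good_disjoint) (auto simp: a_def b_def)
  have pre: "coord k (take m u) = coord k (take m v)"
    using m len by (auto simp: coord_def list_eq_iff_nth_eq)
  have us: "u @ s = take m u @ a # r u" "v @ s = take m v @ b # r v"
    using id_take_nth_drop[OF m(1)] id_take_nth_drop[OF mv] by (simp_all add: a_def b_def r_def)
  have r: "?F (r w) x \<in> {0<..<1}" if w: "set w \<subseteq> E" and "x \<in> {0..1}" for w x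
  proof -
    have "set (drop (Suc m) w) \<subseteq> E" using set_drop_subset[of "Suc m" w] w by (rule order_trans)
    from I.foldr_open[OF coord_mem[OF this] s(2)[OF that(2)]] show ?thesis by (simp add: r_def)
  qed
  have "?F (u @ s) x \<noteq> ?F (v @ s) y" if xy: "x \<in> {0..1}" "y \<in> {0..1}" for x y
  proof -
    define x' y' where "x' = \<phi> k (a k) (?F (r u) x)" and "y' = \<phi> k (b k) (?F (r v) y)"
    have "x' \<noteq> y'" using disj r[OF u xy(1)] r[OF v xy(2)] unfolding x'_def y'_def by blast
    moreover have "x' \<in> {0..1}" "y' \<in> {0..1}"
      using contraction_ratio(4)[OF letter_similarity[OF ab(1)], of "?F (r u) x" k]
        contraction_ratio(4)[OF letter_similarity[OF ab(2)], of "?F (r v) y" k]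
        r[OF u xy(1)] r[OF v xy(2)] by (auto simp: x'_def y'_def)
    moreover have tk: "set (take m u) \<subseteq> E" using set_take_subset[of m u] u by (rule order_trans)
    ultimately have "\<bar>?F (take m u) x' - ?F (take m u) y'\<bar> > 0"
      using I.foldr_dist[OF coord_mem[OF tk, of k], of x' y'] I.ratio_pos[OF coord_mem[OF tk, of k]] by simp
    then show ?thesis unfolding us by (simp add: x'_def y'_def pre)
  qed
  then have "?F (u @ s) ` {0..1} \<inter> ?F (v @ s) ` {0..1} = {}" by blast
  moreover have "compact (?F (u @ s) ` {0..1})" "compact (?F (v @ s) ` {0..1})"
    using u v s(1) by (intro compact_continuous_image continuous_foldr compact_Icc; auto)+
  ultimately obtain \<eta> where "\<eta> > 0" "\<forall>x\<in>?F (u @ s) ` {0..1}. \<forall>y\<in>?F (v @ s) ` {0..1}. \<eta> \<le> dist x y"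
    using separate_compact_closed compact_imp_closed by metis
  then show ?thesis by (auto simp: dist_real_def)
qed

text \<open>Level \<open>m\<close> of a code is read as the word \<open>dec (c m)\<close>, and these
  words are concatenated. Since all of them have the same sums of \<open>log_ratio\<close>,
  \<open>n\<close> levels contract coordinate \<open>k\<close> by exactly
  \<open>exp (- n * l k)\<close>; since \<open>l\<close> orders the coordinates as
  \<open>\<kappa>\<close> does, the properties of the decoding turn into the assumptions of
  \<open>hierarchical_coding\<close>.\<close>

lemma sponge_dim_ge:
  fixes W :: "('d \<Rightarrow> 'a) list set" and l :: "'d \<Rightarrow> real"
  assumes s: "set s \<subseteq> E" "\<And>k x. x \<in> {0..1} \<Longrightarrow> foldr (\<phi> k) (coord k s) x \<in> {0<..<1}"
    and W: "finite W" "W \<noteq> {}" "\<And>w. w \<in> W \<Longrightarrow> set w \<subseteq> E \<and> length w = n"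
    and unif: "uniform_fibers \<kappa> coord {w @ s |w. w \<in> W} M" and M: "\<And>k. 2 \<le> M k"
    and l: "\<And>w k. w \<in> W \<Longrightarrow> (\<Sum>a\<leftarrow>w @ s. log_ratio k a) = l k" "\<And>k. 0 < l k"
      "\<And>j k. \<kappa> j < \<kappa> k \<Longrightarrow> l j < l k"
  shows "ennreal (\<Sum>k\<in>UNIV. ln (M k) / l k) \<le> hausdorff_dim (sponge \<phi> E \<inter> badly_approximable)"
proof -
  define V where "V = {w @ s |w. w \<in> W}"
  define L where "L = n + length s"
  have VE: "set w \<subseteq> E" "length w = L" if "w \<in> V" for w
  proof -
    obtain w' where w': "w = w' @ s" "w' \<in> W" using \<open>w \<in> V\<close> by (auto simp: V_def)
    show "set w \<subseteq> E" "length w = L" using W(3)[OF w'(2)] s(1) unfolding w'(1) L_def by auto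
  qed
  have Vfin: "finite V" "V \<noteq> {}" using W by (auto simp: V_def)
  have lV: "(\<Sum>a\<leftarrow>w. log_ratio k a) = l k" if "w \<in> V" for w k using l(1) that by (auto simp: V_def)
  have L: "0 < L"
  proof (rule ccontr)
    assume "\<not> 0 < L"
    then obtain w where "w \<in> V" "w = []" using Vfin VE by fastforce
    then show False using lV[of w] l(2) by fastforce
  qed
  show ?thesis
  proof (rule uniform_fibers_decode[OF inj_\<kappa> Vfin unif[folded V_def]])
  fix dec assume dec: "\<And>c. (\<And>k. c k < M k) \<Longrightarrow> dec c \<in> V"
    "\<And>c c' k. (\<And>k. c k < M k) \<Longrightarrow> (\<And>k. c' k < M k) \<Longrightarrow> (\<And>j. \<kappa> j \<le> \<kappa> k \<Longrightarrow> c j = c' j)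
           \<Longrightarrow> coord k (dec c) = coord k (dec c')"
    "\<And>c c' k. (\<And>k. c k < M k) \<Longrightarrow> (\<And>k. c' k < M k) \<Longrightarrow> (\<And>j. \<kappa> j < \<kappa> k \<Longrightarrow> c j = c' j)
           \<Longrightarrow> c k \<noteq> c' k \<Longrightarrow> coord k (dec c) \<noteq> coord k (dec c')"
  have l_iff: "l j \<le> l k \<longleftrightarrow> \<kappa> j \<le> \<kappa> k" "l j < l k \<longleftrightarrow> \<kappa> j < \<kappa> k" for j k
  proof -
    consider "\<kappa> j < \<kappa> k" | "j = k" | "\<kappa> k < \<kappa> j"
      using inj_\<kappa> by (metis injD linorder_less_linear)
    then show "l j \<le> l k \<longleftrightarrow> \<kappa> j \<le> \<kappa> k" "l j < l k \<longleftrightarrow> \<kappa> j < \<kappa> k"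
      using l(3)[of j k] l(3)[of k j] by (cases; simp)+
  qed
  define R where "R = (\<lambda>(u, v, k). {\<bar>foldr (\<phi> k) (coord k u) x - foldr (\<phi> k) (coord k v) y\<bar> |x y. x \<in> {0..1} \<and> y \<in> {0..1}})"
  \<comment> \<open>Only finitely many pairs of words arise, so one positive gap serves them
    all.\<close>
  define P where "P = {(u, v, k). u \<in> V \<and> v \<in> V \<and> (\<forall>j. \<kappa> j < \<kappa> k \<longrightarrow> coord j u = coord j v) \<and> coord k u \<noteq> coord k v}"
  have "\<exists>\<eta>>0. \<forall>q\<in>P. \<forall>x\<in>R q. \<eta> \<le> x"
  proof (rule finite_uniform_gap)
    show "finite P" by (rule finite_subset[of _ "V \<times> V \<times> UNIV"]) (use Vfin in \<open>auto simp: P_def\<close>)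
    fix q assume "q \<in> P"
    then obtain u v k where q: "q = (u @ s, v @ s, k)" "u \<in> W" "v \<in> W"
      "\<And>j. \<kappa> j < \<kappa> k \<Longrightarrow> coord j (u @ s) = coord j (v @ s)" "coord k (u @ s) \<noteq> coord k (v @ s)"
      by (auto simp: P_def V_def)
    have "set u \<subseteq> E" "set v \<subseteq> E" "length u = length v" using W(3) q(2,3) by auto
    from word_gap[OF s this q(4,5)] show "\<exists>\<eta>>0. \<forall>x\<in>R q. \<eta> \<le> x"
      unfolding q(1) R_def by auto
  qed
  then obtain \<eta> where \<eta>0: "\<eta> > 0" "\<And>q x. q \<in> P \<Longrightarrow> x \<in> R q \<Longrightarrow> \<eta> \<le> x" by blast
  have "\<eta> \<le> \<bar>foldr (\<phi> k) (coord k u) x - foldr (\<phi> k) (coord k v) y\<bar>"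
    if "u \<in> V" "v \<in> V" "\<And>j. \<kappa> j < \<kappa> k \<Longrightarrow> coord j u = coord j v" "coord k u \<noteq> coord k v"
      "x \<in> {0..1}" "y \<in> {0..1}" for u v k x y
  proof (rule \<eta>0(2))
    show "(u, v, k) \<in> P" using that(1-4) by (simp add: P_def)
    show "\<bar>foldr (\<phi> k) (coord k u) x - foldr (\<phi> k) (coord k v) y\<bar> \<in> R (u, v, k)"
      unfolding R_def using that(5,6) by blast
  qed
  note \<eta> = \<eta>0(1) this
  define \<Omega> where "\<Omega> c = flat (\<lambda>m. dec (c m)) L" for c :: "nat \<Rightarrow> 'd \<Rightarrow> nat"
  define X where "X c = coding_map \<phi> (\<Omega> c)" for c
  have \<Omega>_E: "\<Omega> c m \<in> E" if c: "\<And>m k. c m k < M k" for c m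
  proof -
    have "dec (c (m div L)) \<in> V" using c by (intro dec(1))
    then show ?thesis using VE[of "dec (c (m div L))"] L unfolding \<Omega>_def flat_def by (auto simp: subset_iff)
  qed
  have X_nth: "X c $ k = code1 (\<phi> k) (\<lambda>m. \<Omega> c m k)" if "\<And>m k. c m k < M k" for c k
    unfolding X_def using coding_map_nth[OF ifs \<Omega>_E[of c, OF that]] .
  have ratio: "interval_IFS.ratio (\<phi> k) (map (\<lambda>m. \<Omega> c m k) [0..<n * L]) = exp (- real n * l k)"
    if c: "\<And>m k. c m k < M k" for c k n
  proof -
    have decV: "dec (c i) \<in> V" for i using c by (intro dec(1))
    let ?w = "concat (map (\<lambda>i. dec (c i)) [0..<n])"
    have "map (\<lambda>m. \<Omega> c m k) [0..<n * L] = coord k (map (\<Omega> c) [0..<n * L])"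
      by (simp add: coord_def o_def)
    also have "map (\<Omega> c) [0..<n * L] = ?w"
      unfolding \<Omega>_def using L VE(2)[OF decV] by (rule map_flat)
    finally have eq: "map (\<lambda>m. \<Omega> c m k) [0..<n * L] = coord k ?w" .
    have sub: "set ?w \<subseteq> E" using VE(1)[OF decV] by auto
    have "(\<Sum>a\<leftarrow>?w. log_ratio k a) = real n * l k"
      by (induction n) (auto simp: lV[OF decV] algebra_simps)
    then show ?thesis unfolding eq ratio_coord[OF sub] by simp
  qed
  have agree: "\<Omega> c m k = \<Omega> c' m k"
    if c: "\<And>m k. c m k < M k" "\<And>m k. c' m k < M k" "\<And>m j. m < n \<Longrightarrow> \<kappa> j \<le> \<kappa> k \<Longrightarrow> c m j = c' m j" "m < n * L"
    for c c' n m k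
  proof -
    have "m div L < n" using that(4) L by (simp add: less_mult_imp_div_less)
    then have "coord k (dec (c (m div L))) = coord k (dec (c' (m div L)))" using c by (intro dec(2)) auto
    then have "coord k (dec (c (m div L))) ! (m mod L) = coord k (dec (c' (m div L))) ! (m mod L)" by simp
    moreover have "length (dec (c (m div L))) = L" "length (dec (c' (m div L))) = L"
      using c by (intro VE(2) dec(1); simp)+
    ultimately show ?thesis using L by (simp add: \<Omega>_def flat_def coord_def)
  qed
  interpret H: hierarchical_coding l M X \<eta>
  proof
    show "0 < l k" "2 \<le> M k" "0 < \<eta>" for k using l(2) M \<eta>(1) by auto
    show "inj l" by (metis injI inj_\<kappa> injD l_iff(1) order_antisym order_refl)
  next
    fix c c' :: "nat \<Rightarrow> 'd \<Rightarrow> nat" and n k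
    assume c: "\<And>m k. c m k < M k" "\<And>m k. c' m k < M k" and eq: "\<And>m j. m < n \<Longrightarrow> l j \<le> l k \<Longrightarrow> c m j = c' m j"
    interpret I: interval_IFS "\<phi> k" "A k" by (rule interval)
    have "\<bar>X c $ k - X c' $ k\<bar> \<le> I.ratio (map (\<lambda>m. \<Omega> c m k) [0..<n * L])"
      unfolding X_nth[of c, OF c(1)] X_nth[of c', OF c(2)]
      using \<Omega>_E[of c, OF c(1)] \<Omega>_E[of c', OF c(2)] letter_mem agree[of c c' n k, OF c] eq unfolding l_iff
      by (intro I.code1_dist_le) auto
    then show "\<bar>X c $ k - X c' $ k\<bar> \<le> exp (- real n * l k)" using ratio[of c, OF c(1)] by simp
  next
    fix c c' :: "nat \<Rightarrow> 'd \<Rightarrow> nat" and n k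
    assume c: "\<And>m k. c m k < M k" "\<And>m k. c' m k < M k" and eq: "\<And>m j. m < n \<Longrightarrow> l j \<le> l k \<Longrightarrow> c m j = c' m j"
      and eqn: "\<And>j. l j < l k \<Longrightarrow> c n j = c' n j" and ne: "c n k \<noteq> c' n k"
    interpret I: interval_IFS "\<phi> k" "A k" by (rule interval)
    have mem: "\<Omega> d m k \<in> A k" if "\<And>m k. d m k < M k" for d m using \<Omega>_E[of d, OF that] letter_mem by blast
    \<comment> \<open>The point left over in coordinate \<open>k\<close> after \<open>n\<close>
      levels. Its first block is the word chosen at level \<open>n\<close>, where the gap
      \<open>\<eta>\<close> appears before the common contraction is applied.\<close>
    define z where "z d = code1 (\<phi> k) (\<lambda>m. \<Omega> d (n * L + m) k)" for d
    have z: "\<exists>x\<in>{0..1}. z d = foldr (\<phi> k) (coord k (dec (d n))) x" if d: "\<And>m k. d m k < M k" for d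
    proof -
      have "z d = foldr (\<phi> k) (map (\<lambda>m. \<Omega> d (n * L + m) k) [0..<L]) (code1 (\<phi> k) (\<lambda>i. \<Omega> d (n * L + (L + i)) k))"
        unfolding z_def using mem[of d, OF d] by (intro I.code1_shift)
      moreover have "map (\<lambda>m. \<Omega> d (n * L + m) k) [0..<L] = coord k (dec (d n))"
      proof -
        have "length (dec (d n)) = L" using d by (intro VE(2) dec(1))
        then have "map (\<lambda>m. \<Omega> d (n * L + m)) [0..<L] = dec (d n)"
          using map_flat_block[of "\<lambda>i. dec (d (n + i))" L] L by (simp add: \<Omega>_def flat_shift)
        then have "coord k (map (\<lambda>m. \<Omega> d (n * L + m)) [0..<L]) = coord k (dec (d n))" by simp
        then show ?thesis by (simp add: coord_def o_def)
      qed
      moreover have "code1 (\<phi> k) (\<lambda>i. \<Omega> d (n * L + (L + i)) k) \<in> {0..1}"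
        using mem[of d, OF d] by (intro I.code1_mem)
      ultimately show ?thesis by auto
    qed
    obtain x y where xy: "x \<in> {0..1}" "y \<in> {0..1}" "z c = foldr (\<phi> k) (coord k (dec (c n))) x"
       "z c' = foldr (\<phi> k) (coord k (dec (c' n))) y"
      using z[of c, OF c(1)] z[of c', OF c(2)] by blast
    have "\<eta> \<le> \<bar>z c - z c'\<bar>"
      unfolding xy(3,4)
    proof (rule \<eta>(2))
      show "coord j (dec (c n)) = coord j (dec (c' n))" if "\<kappa> j < \<kappa> k" for j
        using c eqn that unfolding l_iff by (intro dec(2)) auto
      show "coord k (dec (c n)) \<noteq> coord k (dec (c' n))"
        using c eqn ne unfolding l_iff by (intro dec(3)) auto
    qed (use c xy dec(1) in auto)
    have m: "map (\<lambda>m. \<Omega> c' m k) [0..<n * L] = map (\<lambda>m. \<Omega> c m k) [0..<n * L]"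
      using agree[of c c' n k, OF c] eq unfolding l_iff by (intro map_cong) auto
    have sub: "set (map (\<lambda>m. \<Omega> c m k) [0..<n * L]) \<subseteq> A k" using mem[of c, OF c(1)] by auto
    have "X d $ k = foldr (\<phi> k) (map (\<lambda>m. \<Omega> d m k) [0..<n * L]) (z d)" if d: "\<And>m k. d m k < M k" for d
      unfolding X_nth[of d, OF d] z_def using mem[of d, OF d] by (intro I.code1_shift)
    note Xz = this[of c, OF c(1)] this[of c', OF c(2)]
    have "z d \<in> {0..1}" if d: "\<And>m k. d m k < M k" for d
      unfolding z_def using mem[of d, OF d] by (intro I.code1_mem)
    note z01 = this[of c, OF c(1)] this[of c', OF c(2)]
    have "\<bar>X c $ k - X c' $ k\<bar> = exp (- real n * l k) * \<bar>z c - z c'\<bar>"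
      unfolding Xz m I.foldr_dist[OF sub z01] ratio[of c, OF c(1)] ..
    then show "\<eta> * exp (- real n * l k) \<le> \<bar>X c $ k - X c' $ k\<bar>"
      using \<open>\<eta> \<le> \<bar>z c - z c'\<bar>\<close> by (simp add: mult.commute)
  qed
  have "X ` H.codes \<subseteq> sponge \<phi> E"
    unfolding X_def sponge_def H.codes_def using \<Omega>_E by auto
  then have "hausdorff_dim (X ` H.codes \<inter> badly_approximable) \<le> hausdorff_dim (sponge \<phi> E \<inter> badly_approximable)"
    by (intro hausdorff_dim_mono) auto
  with H.hausdorff_dim_badly_approximable_ge show ?thesis by (rule order_trans)
  qed
qed

section \<open>Passage to typical words of growing length\<close>

lemma log_growth:
  assumes "0 < (e::real)"
  shows "\<forall>\<^sub>F N in sequentially. ln (2 * (real N + 1) ^ c) \<le> e * N"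
proof -
  have "(\<lambda>N. (real c + 1) * ln 2 * (1 / real N) + real c * (ln (real N) / real N)) \<longlonglongrightarrow> (real c + 1) * ln 2 * 0 + real c * 0"
    by (intro tendsto_intros lim_ln_over_n lim_1_over_n)
  then have "(\<lambda>N. (real c + 1) * ln 2 * (1 / real N) + real c * (ln (real N) / real N)) \<longlonglongrightarrow> 0" by simp
  from order_tendstoD(2)[OF this assms] show ?thesis
    using eventually_ge_at_top[of 1]
  proof eventually_elim
    case (elim N)
    have "ln (2 * (real N + 1) ^ c) = ln 2 + c * ln (real N + 1)"
      using elim(2) by (simp add: ln_mult ln_realpow)
    also have "\<dots> \<le> ln 2 + c * (ln 2 + ln N)"
    proof -
      have "ln (real N + 1) \<le> ln (2 * real N)" using elim(2) by (subst ln_le_cancel_iff) auto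
      then have "ln (real N + 1) \<le> ln 2 + ln N" using elim(2) by (simp add: ln_mult)
      then show ?thesis by (intro add_left_mono mult_left_mono) auto
    qed
    also have "\<dots> = (real c + 1) * ln 2 + c * ln N" by (simp add: algebra_simps)
    also have "\<dots> = ((real c + 1) * ln 2 * (1 / real N) + real c * (ln (real N) / real N)) * N"
      using elim(2) by (simp add: field_simps)
    also have "\<dots> \<le> e * N" using elim(1) by (intro mult_right_mono) auto
    finally show ?case .
  qed
qed

text \<open>The words consist of \<open>u\<close> of one typical type, \<open>v\<close> an
  arrangement of the letters of \<open>E\<close>, and \<open>s\<close> from
  \<open>interior_word\<close>. The part \<open>u\<close> carries the entropy, \<open>v\<close>
  guarantees two digits in every coordinate, and \<open>s\<close> provides the gaps. The last
  condition on \<open>e\<close> keeps the exponents \<open>l\<close> in the order of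
  \<open>\<kappa>\<close>.\<close>

lemma sponge_dim_ge_approx:
  assumes e: "0 < e" "\<And>k. e < \<kappa> k" "\<And>j k. \<kappa> j < \<kappa> k \<Longrightarrow> \<kappa> j + e < \<kappa> k - e"
  shows "ennreal (\<Sum>k\<in>UNIV. (h k - e) / (\<kappa> k + e)) \<le> hausdorff_dim (sponge \<phi> E \<inter> badly_approximable)"
proof -
  obtain s where s: "set s \<subseteq> E" "\<And>k x. x \<in> {0..1} \<Longrightarrow> foldr (\<phi> k) (coord k s) x \<in> {0<..<1}"
    using interior_word by metis
  define E0 where "E0 = mset_set E"
  \<comment> \<open>The contribution of \<open>v\<close> and \<open>s\<close> to the exponents: the
    same for all words, and independent of \<open>N\<close>.\<close>
  define cst where "cst k = (\<Sum>a\<in>#E0. log_ratio k a) + (\<Sum>a\<leftarrow>s. log_ratio k a)" for k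
  have cst0: "0 \<le> cst k" for k
    unfolding cst_def E0_def sum_unfold_sum_mset[symmetric] using s(1)
    by (intro add_nonneg_nonneg sum_nonneg sum_list_nonneg) (auto intro!: less_imp_le log_ratio_pos)
  \<comment> \<open>One family for all coordinates, so that a single type is typical for every
    entropy and every exponent.\<close>
  define G where "G = cond_info \<kappa> p ` UNIV \<union> log_ratio ` UNIV"
  have G: "finite G" by (simp add: G_def)
  have "\<forall>\<^sub>F N in sequentially. cst k \<le> e / 2 * real N" for k
  proof -
    have "\<forall>\<^sub>F N in sequentially. cst k / (e / 2) \<le> real N"
      using filterlim_real_sequentially unfolding filterlim_at_top by blast
    then show ?thesis by eventually_elim (use e(1) in \<open>simp add: field_simps\<close>)
  qed
  then have ev1: "\<forall>\<^sub>F N in sequentially. \<forall>k. cst k \<le> e / 2 * real N" by (intro eventually_all_finite)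
  have ev2: "\<forall>\<^sub>F N in sequentially. ln (2 * (real N + 1) ^ card E) \<le> e / 2 * real N"
    using e(1) by (intro log_growth) simp
  have ev3: "\<forall>\<^sub>F N in sequentially. \<exists>A. (\<forall>w. mset w = A \<longrightarrow> typical G (e / 2) N w) \<and> (\<exists>w. mset w = A) \<and>
      1 / (2 * (real N + 1) ^ card E) \<le> measure Om {\<omega>\<in>space Om. mset (map \<omega> [0..<N]) = A}"
    using e(1) by (intro typical_type[OF G]) simp
  obtain N B where N: "1 \<le> N" "\<And>k. cst k \<le> e / 2 * real N" "ln (2 * (real N + 1) ^ card E) \<le> e / 2 * real N"
    and B: "\<And>w. mset w = B \<Longrightarrow> typical G (e / 2) N w" "\<exists>w. mset w = B"
      "1 / (2 * (real N + 1) ^ card E) \<le> measure Om {\<omega>\<in>space Om. mset (map \<omega> [0..<N]) = B}"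
    using eventually_happens'[OF sequentially_bot
      eventually_conj[OF eventually_conj[OF ev1 ev2] eventually_conj[OF ev3 eventually_ge_at_top[of 1]]]]
    by blast
  obtain w0 where w0: "mset w0 = B" using B(2) by blast
  have typ0: "typical G (e / 2) N w0" by (rule B(1)[OF w0])
  define T T0 where "T = {w. mset w = B}" and "T0 = {w. mset w = E0}"
  obtain MT where MT: "uniform_fibers \<kappa> coord T MT" unfolding T_def by (rule uniform_fibers_mset)
  obtain M0 where M0: "uniform_fibers \<kappa> coord T0 M0" unfolding T0_def by (rule uniform_fibers_mset)
  define W where "W = {u @ v |u v. u \<in> T \<and> v \<in> T0}"
  define M where "M k = MT k * M0 k * 1" for k
  define l where "l k = (\<Sum>a\<leftarrow>w0. log_ratio k a) + cst k" for k
  have lenT: "length u = N" "set u \<subseteq> supp" if "u \<in> T" for u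
    using B(1)[of u] that by (auto simp: T_def typical_def)
  have supp_E: "supp \<subseteq> E" by (auto simp: supp_def)
  have T0E: "set v = E" "length v = card E" if "v \<in> T0" for v
  proof -
    have "mset v = mset_set E" using that by (simp add: T0_def E0_def)
    then show "set v = E" "length v = card E"
      using finE by (metis finite_set_mset_mset_set set_mset_mset, metis size_mset size_mset_set)
  qed
  have unifW: "uniform_fibers \<kappa> coord W (\<lambda>k. MT k * M0 k)"
    unfolding W_def by (rule uniform_fibers_append[OF MT lenT(1) M0])
  have W_len: "length w = N + card E" if "w \<in> W" for w using that lenT(1) T0E(2) by (auto simp: W_def)
  have unif: "uniform_fibers \<kappa> coord {w @ s |w. w \<in> W} M"
  proof -
    have "uniform_fibers \<kappa> coord {u @ v |u v. u \<in> W \<and> v \<in> {s}} (\<lambda>k. (MT k * M0 k) * 1)"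
      by (rule uniform_fibers_append[OF unifW W_len uniform_fibers_singleton])
    moreover have "{u @ v |u v. u \<in> W \<and> v \<in> {s}} = {w @ s |w. w \<in> W}" by auto
    ultimately show ?thesis unfolding M_def by simp
  qed
  \<comment> \<open>\<open>E0\<close> contains every letter, hence also the two given by
    irreducibility, even if their mass is zero.\<close>
  have M0_2: "2 \<le> M0 k" for k
  proof -
    obtain a b where ab: "a \<in> E" "b \<in> E" "a k \<noteq> b k" "\<And>j. \<kappa> j < \<kappa> k \<Longrightarrow> a j = b j"
      using irreducible_pair by metis
    then have "a \<noteq> b" by auto
    then have "{#a, b#} = mset_set {a, b}" by simp
    also have "\<dots> \<subseteq># E0" unfolding E0_def using ab finE by (intro subset_imp_msubset_mset_set) auto
    finally show ?thesis
      using uniform_fibers_ge_2[of \<kappa> E0 M0 a b k] M0 ab unfolding T0_def by blast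
  qed
  \<comment> \<open>The deviation of the information costs \<open>e / 2 * N\<close> in the exponent,
    and so, at most, does the polynomially small probability of the type.\<close>
  have MT_ge: "exp (N * (h k - e)) \<le> MT k" for k
  proof -
    have sB: "size B = N" "set_mset B \<subseteq> supp" using w0 typ0 unfolding typical_def by auto
    have "cond_info \<kappa> p k \<in> G" by (simp add: G_def)
    then have "\<bar>(\<Sum>a\<leftarrow>w0. cond_info \<kappa> p k a) - N * h k\<bar> < e / 2 * N"
      using typ0 unfolding typical_def h_def by blast
    then have "N * (h k - e) \<le> (\<Sum>a\<leftarrow>w0. cond_info \<kappa> p k a) - e / 2 * N" by (simp add: algebra_simps abs_if split: if_splits)
    also have "\<dots> \<le> (\<Sum>a\<leftarrow>w0. cond_info \<kappa> p k a) - ln (2 * (real N + 1) ^ card E)" using N(3) by simp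
    finally have "exp (N * (h k - e)) \<le> exp ((\<Sum>a\<leftarrow>w0. cond_info \<kappa> p k a) - ln (2 * (real N + 1) ^ card E))" by simp
    also have "\<dots> = 1 / (2 * (real N + 1) ^ card E) * exp (\<Sum>a\<leftarrow>w0. cond_info \<kappa> p k a)"
    proof -
      have "0 < 2 * (real N + 1) ^ card E" by (simp add: add_nonneg_pos)
      then show ?thesis by (simp only: exp_diff exp_ln) simp
    qed
    also have "\<dots> \<le> measure Om {\<omega>\<in>space Om. mset (map \<omega> [0..<N]) = B} * exp (\<Sum>a\<leftarrow>w0. cond_info \<kappa> p k a)"
      using B(3) by (intro mult_right_mono) auto
    also have "\<dots> \<le> MT k"
      using uniform_fibers_entropy[OF MT[unfolded T_def] inj_\<kappa> sB(2) w0, of k] unfolding sB(1) .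
    finally show ?thesis .
  qed
  have MT_pos: "0 < MT k" for k using less_le_trans[OF exp_gt_zero MT_ge[of k]] by simp
  have M2: "2 \<le> M k" for k
    using mult_le_mono[of 1 "MT k" 2 "M0 k"] MT_pos[of k] M0_2[of k] by (simp add: M_def)
  \<comment> \<open>\<open>h k - e\<close> may be negative. The maximum with 0 makes it legitimate,
    below, to replace the denominator by the smaller \<open>l k\<close>.\<close>
  have lnM: "max 0 (N * (h k - e)) \<le> ln (M k)" for k
  proof -
    have "exp (N * (h k - e)) \<le> MT k" by (rule MT_ge)
    also have "real (MT k) \<le> M k"
    proof -
      have "MT k * 1 \<le> MT k * M0 k" using M0_2[of k] by (intro mult_le_mono) auto
      then show ?thesis unfolding M_def by (simp only: of_nat_le_iff mult_1_right)
    qed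
    finally have "N * (h k - e) \<le> ln (M k)" using M2[of k] by (subst ln_ge_iff) auto
    moreover have "0 \<le> ln (M k)" using M2[of k] by simp
    ultimately show ?thesis by simp
  qed
  have l_bounds: "N * (\<kappa> k - e) < l k" "l k < N * (\<kappa> k + e)" for k
  proof -
    have "log_ratio k \<in> G" by (simp add: G_def)
    then have "\<bar>(\<Sum>a\<leftarrow>w0. log_ratio k a) - N * expectation (log_ratio k)\<bar> < e / 2 * N"
      using typ0 unfolding typical_def by blast
    then have "\<bar>(\<Sum>a\<leftarrow>w0. log_ratio k a) - N * \<kappa> k\<bar> < e / 2 * N" by (simp only: expectation_log_ratio)
    moreover have "z - t < y + c" "y + c < z + t"
      if "\<bar>y - z\<bar> < t / 2" "0 < t" "0 \<le> c" "c \<le> t / 2" for y z t c :: real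
      using that unfolding abs_less_iff by linarith+
    note this[of _ _ "e * N" "cst k"]
    moreover have "0 < e * N" using e(1) N(1) by simp
    moreover have "N * (\<kappa> k - e) = N * \<kappa> k - e * N" "N * (\<kappa> k + e) = N * \<kappa> k + e * N"
      by (simp_all add: algebra_simps)
    ultimately show "N * (\<kappa> k - e) < l k" "l k < N * (\<kappa> k + e)"
      unfolding l_def using cst0[of k] N(2)[of k] by simp_all
  qed
  have l0: "0 < l k" for k
    using less_trans[OF _ l_bounds(1)[of k]] e(2)[of k] N(1) by simp
  have "ennreal (\<Sum>k\<in>UNIV. (h k - e) / (\<kappa> k + e)) \<le> ennreal (\<Sum>k\<in>UNIV. ln (M k) / l k)"
  proof (intro ennreal_leI sum_mono)
    fix k
    have pos: "0 < \<kappa> k + e" using \<kappa>_pos[of k] e(1) by simp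
    have "(h k - e) / (\<kappa> k + e) = (N * (h k - e)) / (N * (\<kappa> k + e))" using N(1) by simp
    also have "\<dots> \<le> max 0 (N * (h k - e)) / (N * (\<kappa> k + e))"
      using pos N(1) by (intro divide_right_mono) auto
    also have "\<dots> \<le> max 0 (N * (h k - e)) / l k"
      using l_bounds(2)[of k] l0[of k] by (intro divide_left_mono) auto
    also have "\<dots> \<le> ln (M k) / l k" using lnM l0[of k] by (intro divide_right_mono) auto
    finally show "(h k - e) / (\<kappa> k + e) \<le> ln (M k) / l k" .
  qed
  also have "\<dots> \<le> hausdorff_dim (sponge \<phi> E \<inter> badly_approximable)"
  proof (rule sponge_dim_ge[OF s _ _ _ unif M2 _ l0])
    show "finite W"
      unfolding W_def T_def T0_def by (intro finite_image_set2) (simp_all add: finite_words_mset)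
    show "W \<noteq> {}"
    proof -
      obtain v where "mset v = E0" using ex_mset by blast
      then have "w0 @ v \<in> W" using w0 by (auto simp: W_def T_def T0_def)
      then show ?thesis by blast
    qed
    show "set w \<subseteq> E \<and> length w = N + card E" if "w \<in> W" for w
      using that lenT T0E supp_E by (fastforce simp: W_def)
    show "(\<Sum>a\<leftarrow>w @ s. log_ratio k a) = l k" if w: "w \<in> W" for w k
    proof -
      obtain u v where uv: "w = u @ v" "mset u = B" "mset v = E0" using w by (auto simp: W_def T_def T0_def)
      have "(\<Sum>a\<leftarrow>u. log_ratio k a) = (\<Sum>a\<leftarrow>w0. log_ratio k a)"
        by (simp only: sum_mset_sum_list[symmetric] mset_map uv w0)
      moreover have "(\<Sum>a\<leftarrow>v. log_ratio k a) = (\<Sum>a\<in>#E0. log_ratio k a)"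
        by (simp only: sum_mset_sum_list[symmetric] mset_map uv)
      ultimately show ?thesis by (simp add: uv(1) l_def cst_def)
    qed
    show "l j < l k" if "\<kappa> j < \<kappa> k" for j k
    proof -
      have "l j < N * (\<kappa> j + e)" by (rule l_bounds)
      also have "\<dots> \<le> N * (\<kappa> k - e)" using e(3)[OF that] by (intro mult_left_mono) auto
      also have "\<dots> < l k" by (rule l_bounds)
      finally show ?thesis .
    qed
  qed
  finally show ?thesis .
qed

theorem sponge_badly_approximable_dim_ge:
  "ennreal (\<Sum>k\<in>UNIV. h k / \<kappa> k) \<le> hausdorff_dim (sponge \<phi> E \<inter> badly_approximable)"
proof (rule tendsto_upperbound)
  have "((\<lambda>e. \<Sum>k\<in>UNIV. (h k - e) / (\<kappa> k + e)) \<longlongrightarrow> (\<Sum>k\<in>UNIV. (h k - 0) / (\<kappa> k + 0))) (at_right 0)"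
    using \<kappa>_pos by (intro tendsto_intros) (auto simp: less_imp_neq[symmetric])
  then show "((\<lambda>e. ennreal (\<Sum>k\<in>UNIV. (h k - e) / (\<kappa> k + e))) \<longlongrightarrow> ennreal (\<Sum>k\<in>UNIV. h k / \<kappa> k)) (at_right 0)"
    by (intro tendsto_ennrealI) simp
  have small: "\<forall>\<^sub>F e in at_right 0. e < c" if "0 < c" for c :: real
    using eventually_at_right_less that by (intro eventually_at_rightI[of 0 c]) auto
  have "\<forall>\<^sub>F e in at_right 0. 0 < e \<and> (\<forall>k. e < \<kappa> k) \<and> (\<forall>j k. \<kappa> j < \<kappa> k \<longrightarrow> \<kappa> j + e < \<kappa> k - e)"
  proof (intro eventually_conj eventually_all_finite)
    show "\<forall>\<^sub>F e in at_right 0. (0::real) < e" by (rule eventually_at_right_less)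
    show "\<forall>\<^sub>F e in at_right 0. e < \<kappa> k" for k by (rule small[OF \<kappa>_pos])
    show "\<forall>\<^sub>F e in at_right 0. \<kappa> j < \<kappa> k \<longrightarrow> \<kappa> j + e < \<kappa> k - e" for j k
    proof (cases "\<kappa> j < \<kappa> k")
      case True
      then have "\<forall>\<^sub>F e in at_right 0. e < (\<kappa> k - \<kappa> j) / 2" by (intro small) simp
      then show ?thesis by eventually_elim (simp add: field_simps)
    qed simp
  qed
  then show "\<forall>\<^sub>F e in at_right 0. ennreal (\<Sum>k\<in>UNIV. (h k - e) / (\<kappa> k + e))
      \<le> hausdorff_dim (sponge \<phi> E \<inter> badly_approximable)"
    by eventually_elim (intro sponge_dim_ge_approx; blast)
qed simp

end

theorem theorem1p8:
  fixes A :: "'d::finite \<Rightarrow> 'a set"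
    and \<phi> :: "'d \<Rightarrow> 'a \<Rightarrow> real \<Rightarrow> real"
    and E :: "('d \<Rightarrow> 'a) set"
    and p :: "('d \<Rightarrow> 'a) measure"
  assumes "diagonal_IFS A \<phi> E"
    and "prob_measure_on E p"
    and "irreducible_measure \<phi> E p"
    and "good_measure \<phi> E p"
    and "distinct_lyapunov \<phi> p"
  shows "hausdorff_dim (sponge \<phi> E \<inter> badly_approximable)
           \<ge> hausdorff_dim_measure (bernoulli_measure \<phi> p)
       \<and> (hausdorff_dim_measure (bernoulli_measure \<phi> p) = hausdorff_dim (sponge \<phi> E) \<longrightarrow>
           hausdorff_dim (sponge \<phi> E \<inter> badly_approximable) = hausdorff_dim (sponge \<phi> E))"
proof -
  have "finite E"
  proof (rule finite_subset)
    show "E \<subseteq> (\<Pi>\<^sub>E i\<in>UNIV. A i)" using assms(1) by (simp add: diagonal_IFS_def)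
    show "finite (\<Pi>\<^sub>E i\<in>UNIV. A i)" using assms(1) by (intro finite_PiE) (auto simp: diagonal_IFS_def)
  qed
  then have "finite_bernoulli p E"
    using assms(2) by (simp add: prob_measure_on_def finite_bernoulli_def finite_bernoulli_axioms_def)
  then interpret good_sponge p E A \<phi>
    by (simp add: good_sponge_def good_sponge_axioms_def bernoulli_sponge_def
        bernoulli_sponge_axioms_def finite_bernoulli_coords_def assms)
  have "hausdorff_dim_measure (bernoulli_measure \<phi> p) \<le> hausdorff_dim (sponge \<phi> E \<inter> badly_approximable)"
    using hausdorff_dim_bernoulli_le sponge_badly_approximable_dim_ge by (rule order_trans)
  moreover have "hausdorff_dim (sponge \<phi> E \<inter> badly_approximable) \<le> hausdorff_dim (sponge \<phi> E)"
    by (intro hausdorff_dim_mono) auto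
  ultimately show ?thesis by (auto intro: antisym)
qed

end
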